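(* Let $M$ be a locally compact, but not compact, Polish space with a positive, locally finite Borel measure $\mu$ of full topological support, and let $\{U_t:t\ge 0\}$ be a strongly continuous semigroup of bounded, positivity preserving linear operators on $L^2(M,\mu)$ with adjoint semigroup $\{U_t^*:t\ge 0\}$, both given for $t>0$ by a real-valued measurable kernel $u_t(x,y)$. Fix $t_0>0$ and assume: every $U_t$, $t>0$, is compact on $L^2(M,\mu)$; $U_{t_0}$ is positivity improving; both semigroups have the strong Feller property; $U_{t_0},U_{t_0}^*:L^2(M,\mu)\to L^\infty(M,\mu)$ are bounded; and for every $t\ge t_0$ and $\epsilon>0$ there is a compact set $K\subset M$ with $U_t\mathbf 1_M(x)\le\epsilon$ and $U_t^*\mathbf 1_M(x)\le\epsilon$ for every $x\in M\setminus K$. Let $\mathcal N$ be as defined in the context. Then the following conditions are equivalent: (a) Both semigroups $\{U_t\}$ and $\{U_t^*\}$ are progressively ground state dominated (pGSD). (b) There exist probability measures $\rho,\rho^*$ on $M$ with $\operatorname{supp}\rho\cap(M\setminus\mathcal N)\ne\emptyset$ and $\operatorname{supp}\rho^*\cap(M\setminus\mathcal N)\neq\emptyset$, and an exhausting family of sets $\{K_t:t\ge t_0\}$ in $M$ such that $$\sup_{x\in K_t\setminus\mathcal N}\ \sup_{f\in L^\infty(M,\mu),\ \|f\|_\infty\le 1}\left|\frac{U_tf(x)}{U_t\mathbf 1_M(x)}-\rho(f)\right|\to0\quad\text{as }t\to\infty$$ and $$\sup_{y\in K_t\setminus\mathcal N}\ \sup_{f\in L^\infty(M,\mu),\ \|f\|_\infty\le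 1}\left|\frac{U_t^*f(y)}{U_t^*\mathbf 1_M(y)}-\rho^*(f)\right|\to0\quad\text{as }t\to\infty.$$
   Context: For a measure $\rho$ write $\rho(g)=\int g\,d\rho$; $\mathbf 1_M$ is the constant function $1$. Kernels: $U_tf(x)=\int u_t(x,y)f(y)\,\mu(dy)$ and $U_t^*g(y)=\int u_t(x,y)g(x)\,\mu(dx)$, $t>0$; these formulas also define $U_t,U_t^*$ on $L^\infty(M,\mu)$. Positivity preserving: $f\ge0$ a.e. implies $U_tf\ge 0$ a.e. Positivity improving: $f\ge 0$, $f\not\equiv 0$ in $L^2$ implies $U_{t_0}f>0$ $\mu$-a.e. Strong Feller property: for every $t>0$ and $f\in L^\infty(M,\mu)$ one has $U_tf,U_t^*f\in C_b(M)$; $U_tf$, $U_t^*f$ are understood as these continuous functions. Ground states: with $A$ the generator of $\{U_t\}$ and $A^*$ that of $\{U_t^*\}$, $\lambda_0:=\inf\mathrm{Re}(\mathrm{Spec}(-A))=\inf\mathrm{Re}(\mathrm{Spec}(-A^* ))$ is a joint isolated simple eigenvalue of $-A$ and $-A^*$, with $L^2$-normalized, $\mu$-a.e. strictly positive eigenfunctions $\phi_0$ (of $-A$) and $\psi_0$ (of $-A^*$), so $U_t\phi_0=e^{-\lambda_0t}\phi_0$, $U_t^*\psi_0=e^{-\lambda_0t}\psi_0$; they have continuous bounded versions, which are used. Set $\mathcal N:=\{\phi_0=0\}\cup\{\psi_0=0\}$ (a closed $\mu$-null set). Exhausting family: a family $\{K_t:t\ge t_1\}$ of compact subsets of $M$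 with $K_t\subset K_s$ for $t_1\le t<s$, $\bigcup_{t\ge t_1}K_t=M$, and such that every compact $K\subset M$ is contained in some $K_t$. pGSD: $\{U_t\}$ is pGSD if there exist $C,t_1>0$ and an exhausting family $\{K_t:t\ge t_1\}$ with $\mathbf 1_{K_t}(x)U_t\mathbf 1_M(x)\le Ce^{-\lambda_0t}\phi_0(x)$ for all $t\ge t_1$, $x\in M$; for $\{U_t^*\}$ replace $U_t,\phi_0$ by $U_t^*,\psi_0$. *)

theory Defs
  imports "HOL-Probability.Probability" "HOL-Library.Complex_Order"
begin

text \<open>
  Elements of the complex spaces \<open>L\<^sup>2(M,\<mu>)\<close> and \<open>L\<^sup>\<infinity>(M,\<mu>)\<close> are represented by functions, and
  equality of elements is equality \<open>\<mu>\<close>-almost everywhere. The order on the type \<^typ>\<open>complex\<close> is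
  that of Complex Order: \<open>a \<le> b\<close> says that \<open>b - a\<close> is a nonnegative real number.
\<close>

definition L2 :: "'a measure \<Rightarrow> ('a \<Rightarrow> complex) set" where
  "L2 \<mu> = {f. f \<in> borel_measurable \<mu> \<and> integrable \<mu> (\<lambda>x. (cmod (f x))\<^sup>2)}"

definition L2_norm :: "'a measure \<Rightarrow> ('a \<Rightarrow> complex) \<Rightarrow> real" where
  "L2_norm \<mu> f = sqrt (\<integral>x. (cmod (f x))\<^sup>2 \<partial>\<mu>)"

definition L2_inner :: "'a measure \<Rightarrow> ('a \<Rightarrow> complex) \<Rightarrow> ('a \<Rightarrow> complex) \<Rightarrow> complex" where
  "L2_inner \<mu> f g = (\<integral>x. f x * cnj (g x) \<partial>\<mu>)"

definition Linf :: "'a measure \<Rightarrow> ('a \<Rightarrow> complex) set" where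
  "Linf \<mu> = {f. f \<in> borel_measurable \<mu> \<and> (\<exists>C. AE x in \<mu>. cmod (f x) \<le> C)}"

definition Linf_unit_ball :: "'a measure \<Rightarrow> ('a \<Rightarrow> complex) set" where
  "Linf_unit_ball \<mu> = {f \<in> Linf \<mu>. AE x in \<mu>. cmod (f x) \<le> 1}"

definition Cb :: "('a::topological_space \<Rightarrow> complex) set" where
  "Cb = {f. continuous_on UNIV f \<and> bounded (range f)}"

definition locally_finite_measure :: "'a::topological_space measure \<Rightarrow> bool" where
  "locally_finite_measure \<mu> \<longleftrightarrow> (\<forall>x. \<exists>V. open V \<and> x \<in> V \<and> emeasure \<mu> V < \<infinity>)"

definition topological_support :: "'a::topological_space measure \<Rightarrow> 'a set" where
  "topological_support \<rho> = {x. \<forall>V. open V \<and> x \<in> V \<longrightarrow> emeasure \<rho> V > 0}"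


text \<open>Well-definedness on almost-everywhere classes follows from linearity and boundedness.\<close>

definition bounded_linear_L2 ::
    "'a measure \<Rightarrow> (('a \<Rightarrow> complex) \<Rightarrow> 'a \<Rightarrow> complex) \<Rightarrow> bool" where
  "bounded_linear_L2 \<mu> T \<longleftrightarrow>
     (\<forall>f\<in>L2 \<mu>. T f \<in> L2 \<mu>) \<and>
     (\<forall>f\<in>L2 \<mu>. \<forall>g\<in>L2 \<mu>. \<forall>a b. AE x in \<mu>. T (\<lambda>x. a * f x + b * g x) x = a * T f x + b * T g x) \<and>
     (\<exists>C. \<forall>f\<in>L2 \<mu>. L2_norm \<mu> (T f) \<le> C * L2_norm \<mu> f)"

definition adjoint_L2 ::
    "'a measure \<Rightarrow> (('a \<Rightarrow> complex) \<Rightarrow> 'a \<Rightarrow> complex) \<Rightarrow> (('a \<Rightarrow> complex) \<Rightarrow> 'a \<Rightarrow> complex) \<Rightarrow> bool"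
  where
  "adjoint_L2 \<mu> T S \<longleftrightarrow>
     (\<forall>g\<in>L2 \<mu>. S g \<in> L2 \<mu>) \<and>
     (\<forall>f\<in>L2 \<mu>. \<forall>g\<in>L2 \<mu>. L2_inner \<mu> (T f) g = L2_inner \<mu> f (S g))"

definition positivity_preserving ::
    "'a measure \<Rightarrow> (('a \<Rightarrow> complex) \<Rightarrow> 'a \<Rightarrow> complex) \<Rightarrow> bool" where
  "positivity_preserving \<mu> T \<longleftrightarrow>
     (\<forall>f\<in>L2 \<mu>. (AE x in \<mu>. 0 \<le> f x) \<longrightarrow> (AE x in \<mu>. 0 \<le> T f x))"

definition positivity_improving ::
    "'a measure \<Rightarrow> (('a \<Rightarrow> complex) \<Rightarrow> 'a \<Rightarrow> complex) \<Rightarrow> bool" where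
  "positivity_improving \<mu> T \<longleftrightarrow>
     (\<forall>f\<in>L2 \<mu>. (AE x in \<mu>. 0 \<le> f x) \<and> \<not> (AE x in \<mu>. f x = 0) \<longrightarrow> (AE x in \<mu>. 0 < T f x))"

text \<open>Compactness of a bounded linear operator: images of bounded sequences have convergent
  subsequences.\<close>

definition compact_L2 ::
    "'a measure \<Rightarrow> (('a \<Rightarrow> complex) \<Rightarrow> 'a \<Rightarrow> complex) \<Rightarrow> bool" where
  "compact_L2 \<mu> T \<longleftrightarrow>
     (\<forall>f. (\<forall>n. f n \<in> L2 \<mu>) \<and> (\<exists>B. \<forall>n. L2_norm \<mu> (f n) \<le> B) \<longrightarrow>
        (\<exists>g\<in>L2 \<mu>. \<exists>r::nat \<Rightarrow> nat. strict_mono r \<and>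
           (\<lambda>n. L2_norm \<mu> (\<lambda>x. T (f (r n)) x - g x)) \<longlonglongrightarrow> 0))"

definition bounded_L2_Linf ::
    "'a measure \<Rightarrow> (('a \<Rightarrow> complex) \<Rightarrow> 'a \<Rightarrow> complex) \<Rightarrow> bool" where
  "bounded_L2_Linf \<mu> T \<longleftrightarrow> (\<exists>C. \<forall>f\<in>L2 \<mu>. AE x in \<mu>. cmod (T f x) \<le> C * L2_norm \<mu> f)"

definition C0_semigroup_L2 ::
    "'a measure \<Rightarrow> (real \<Rightarrow> ('a \<Rightarrow> complex) \<Rightarrow> 'a \<Rightarrow> complex) \<Rightarrow> bool" where
  "C0_semigroup_L2 \<mu> U \<longleftrightarrow>
     (\<forall>t\<ge>0. bounded_linear_L2 \<mu> (U t)) \<and>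
     (\<forall>f\<in>L2 \<mu>. AE x in \<mu>. U 0 f x = f x) \<and>
     (\<forall>s\<ge>0. \<forall>t\<ge>0. \<forall>f\<in>L2 \<mu>. AE x in \<mu>. U (s + t) f x = U s (U t f) x) \<and>
     (\<forall>f\<in>L2 \<mu>. ((\<lambda>t. L2_norm \<mu> (\<lambda>x. U t f x - f x)) \<longlongrightarrow> 0) (at_right 0))"


text \<open>Unbounded operators on \<open>L\<^sup>2\<close> are given by their graphs.\<close>

definition generator ::
    "'a measure \<Rightarrow> (real \<Rightarrow> ('a \<Rightarrow> complex) \<Rightarrow> 'a \<Rightarrow> complex) \<Rightarrow> (('a \<Rightarrow> complex) \<times> ('a \<Rightarrow> complex)) set"
  where
  "generator \<mu> U = {(f, g). f \<in> L2 \<mu> \<and> g \<in> L2 \<mu> \<and>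
     ((\<lambda>t. L2_norm \<mu> (\<lambda>x. (U t f x - f x) / of_real t - g x)) \<longlongrightarrow> 0) (at_right 0)}"

definition neg_operator ::
    "(('a \<Rightarrow> complex) \<times> ('a \<Rightarrow> complex)) set \<Rightarrow> (('a \<Rightarrow> complex) \<times> ('a \<Rightarrow> complex)) set" where
  "neg_operator A = {(f, \<lambda>x. - g x) | f g. (f, g) \<in> A}"

text \<open>\<open>z\<close> lies in the resolvent set of \<open>A\<close> iff \<open>z - A\<close> is a bijection from the domain of \<open>A\<close>
  onto \<open>L\<^sup>2\<close> with bounded inverse; the norm estimate contains injectivity.\<close>

definition resolvent_set ::
    "'a measure \<Rightarrow> (('a \<Rightarrow> complex) \<times> ('a \<Rightarrow> complex)) set \<Rightarrow> complex set" where
  "resolvent_set \<mu> A = {z.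
     (\<forall>h\<in>L2 \<mu>. \<exists>(f, g)\<in>A. AE x in \<mu>. z * f x - g x = h x) \<and>
     (\<exists>C. \<forall>(f, g)\<in>A. L2_norm \<mu> f \<le> C * L2_norm \<mu> (\<lambda>x. z * f x - g x))}"

definition spectrum_L2 ::
    "'a measure \<Rightarrow> (('a \<Rightarrow> complex) \<times> ('a \<Rightarrow> complex)) set \<Rightarrow> complex set" where
  "spectrum_L2 \<mu> A = - resolvent_set \<mu> A"

definition spectral_bottom ::
    "'a measure \<Rightarrow> (real \<Rightarrow> ('a \<Rightarrow> complex) \<Rightarrow> 'a \<Rightarrow> complex) \<Rightarrow> real" where
  "spectral_bottom \<mu> U = Inf (Re ` spectrum_L2 \<mu> (neg_operator (generator \<mu> U)))"

text \<open>The continuous bounded version of an \<open>L\<^sup>2\<close>-normalized, almost everywhere strictly positive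
  eigenfunction of \<open>-A\<close> with eigenvalue \<open>l\<close>, where \<open>A\<close> is the generator of \<open>U\<close>.\<close>

definition ground_state ::
    "'a::topological_space measure \<Rightarrow> (real \<Rightarrow> ('a \<Rightarrow> complex) \<Rightarrow> 'a \<Rightarrow> complex) \<Rightarrow> real \<Rightarrow>
     ('a \<Rightarrow> complex) \<Rightarrow> bool" where
  "ground_state \<mu> U l \<phi> \<longleftrightarrow>
     (\<phi>, \<lambda>x. of_real l * \<phi> x) \<in> neg_operator (generator \<mu> U) \<and>
     L2_norm \<mu> \<phi> = 1 \<and> (AE x in \<mu>. 0 < \<phi> x) \<and> \<phi> \<in> Cb"


definition kernel_op ::
    "'a measure \<Rightarrow> ('a \<Rightarrow> 'a \<Rightarrow> real) \<Rightarrow> ('a \<Rightarrow> complex) \<Rightarrow> 'a \<Rightarrow> complex" where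
  "kernel_op \<mu> k f x = (\<integral>y. of_real (k x y) * f y \<partial>\<mu>)"

definition transpose_kernel :: "(real \<Rightarrow> 'a \<Rightarrow> 'a \<Rightarrow> real) \<Rightarrow> real \<Rightarrow> 'a \<Rightarrow> 'a \<Rightarrow> real" where
  "transpose_kernel u t = (\<lambda>y x. u t x y)"

definition given_by_kernel ::
    "'a measure \<Rightarrow> (real \<Rightarrow> ('a \<Rightarrow> complex) \<Rightarrow> 'a \<Rightarrow> complex) \<Rightarrow> (real \<Rightarrow> 'a \<Rightarrow> 'a \<Rightarrow> real) \<Rightarrow> bool" where
  "given_by_kernel \<mu> U u \<longleftrightarrow>
     (\<forall>t>0. \<forall>f\<in>L2 \<mu>. AE x in \<mu>.
        integrable \<mu> (\<lambda>y. of_real (u t x y) * f y) \<and> U t f x = kernel_op \<mu> (u t) f x)"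

text \<open>The kernel formula determines an element of \<open>L\<^sup>\<infinity>\<close>, which the strong Feller property asserts
  to have a bounded continuous representative. If \<open>\<mu>\<close> has full topological support, the
  representative is unique; it is the function \<open>Linf_op \<mu> k f\<close>.\<close>

definition strong_feller :: "'a::topological_space measure \<Rightarrow> (real \<Rightarrow> 'a \<Rightarrow> 'a \<Rightarrow> real) \<Rightarrow> bool" where
  "strong_feller \<mu> u \<longleftrightarrow>
     (\<forall>t>0. \<forall>f\<in>Linf \<mu>.
        (AE x in \<mu>. integrable \<mu> (\<lambda>y. of_real (u t x y) * f y)) \<and>
        (\<exists>g\<in>Cb. AE x in \<mu>. g x = kernel_op \<mu> (u t) f x))"

definition Linf_op ::
    "'a::topological_space measure \<Rightarrow> ('a \<Rightarrow> 'a \<Rightarrow> real) \<Rightarrow> ('a \<Rightarrow> complex) \<Rightarrow> 'a \<Rightarrow> complex" where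
  "Linf_op \<mu> k f = (THE g. g \<in> Cb \<and> (AE x in \<mu>. g x = kernel_op \<mu> k f x))"


definition exhausting_family :: "real \<Rightarrow> (real \<Rightarrow> 'a::topological_space set) \<Rightarrow> bool" where
  "exhausting_family t\<^sub>1 K \<longleftrightarrow>
     (\<forall>t\<ge>t\<^sub>1. compact (K t)) \<and>
     (\<forall>t s. t\<^sub>1 \<le> t \<and> t < s \<longrightarrow> K t \<subseteq> K s) \<and>
     (\<Union>t\<in>{t\<^sub>1..}. K t) = UNIV \<and>
     (\<forall>L. compact L \<longrightarrow> (\<exists>t\<ge>t\<^sub>1. L \<subseteq> K t))"

definition pGSD ::
    "'a::topological_space measure \<Rightarrow> (real \<Rightarrow> 'a \<Rightarrow> 'a \<Rightarrow> real) \<Rightarrow> real \<Rightarrow> ('a \<Rightarrow> complex) \<Rightarrow> bool" where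
  "pGSD \<mu> u l \<phi> \<longleftrightarrow>
     (\<exists>C>0. \<exists>t\<^sub>1>0. \<exists>K. exhausting_family t\<^sub>1 K \<and>
        (\<forall>t\<ge>t\<^sub>1. \<forall>x. indicator (K t) x * Linf_op \<mu> (u t) (\<lambda>_. 1) x
           \<le> of_real (C * exp (- l * t)) * \<phi> x))"

text \<open>The suprema are taken in \<^typ>\<open>ennreal\<close>, so that they are \<open>0\<close> over the empty set and \<open>\<infinity>\<close> if
  unbounded. Since \<open>f\<close> ranges over all representatives, convergence to \<open>0\<close> forces
  \<open>\<rho>\<close> to vanish on \<open>\<mu>\<close>-null sets, as is implicit in writing \<open>\<rho>(f)\<close> for \<open>f\<close> in \<open>L\<^sup>\<infinity>(M,\<mu>)\<close>.\<close>

definition progressive_uniform_convergence ::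
    "'a::topological_space measure \<Rightarrow> (real \<Rightarrow> 'a \<Rightarrow> 'a \<Rightarrow> real) \<Rightarrow> (real \<Rightarrow> 'a set) \<Rightarrow> 'a set \<Rightarrow>
     'a measure \<Rightarrow> bool" where
  "progressive_uniform_convergence \<mu> u K N \<rho> \<longleftrightarrow>
     ((\<lambda>t. SUP x\<in>K t - N. SUP f\<in>Linf_unit_ball \<mu>.
         ennreal (cmod (Linf_op \<mu> (u t) f x / Linf_op \<mu> (u t) (\<lambda>_. 1) x - (\<integral>y. f y \<partial>\<rho>)))) \<longlongrightarrow> 0)
       at_top"

end

theory Submission
  imports Defs
begin

text \<open>
  Write \<open>V\<^sub>t = exp (\<lambda>\<^sub>0 t) U\<^sub>t\<close> and \<open>P f = (\<integral> f \<psi>\<^sub>0 / \<integral> \<phi>\<^sub>0 \<psi>\<^sub>0) \<phi>\<^sub>0\<close>. Both implications compare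
  \<open>U\<^sub>t \<one>\<close> with \<open>exp (- \<lambda>\<^sub>0 t) \<phi>\<^sub>0\<close>.

  Convergence implies domination: test the convergence with \<open>\<phi>\<^sub>0\<close>, scaled into the unit ball. Since \<open>\<phi>\<^sub>0\<close> is
  an eigenfunction, \<open>exp (- \<lambda>\<^sub>0 t) \<phi>\<^sub>0 / U\<^sub>t \<one>\<close> converges uniformly on \<open>K\<^sub>t - N\<close> to \<open>\<rho>(\<phi>\<^sub>0)\<close>, which is
  positive because \<open>\<rho>\<close> charges every neighbourhood of some point outside \<open>N\<close>. So for large \<open>t\<close> the
  quotient is at least half of this limit, which is the domination off \<open>N\<close>. The set \<open>N\<close> is null and the
  measure has full support, hence the inequality extends by continuity to the closure of the interior of
  \<open>K\<^sub>t\<close>; these sets exhaust the space as well, because it is locally compact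
  (\<open>convergence_imp_pGSD\<close>, \<open>exhausting_closure_interior\<close>).

  Domination implies convergence: suppose that the suprema \<open>\<epsilon>\<^sub>n\<close> of \<open>\<bar>V\<^sub>r f - P f\<bar>\<close> over all points and all
  \<open>\<bar>f\<bar> \<le> 1\<close>, where \<open>r = n t\<^sub>0\<close>, tend to zero. Split \<open>t = s + n t\<^sub>0\<close> with \<open>s \<ge> t / 2\<close>. As \<open>V\<^sub>s P = P\<close>,
  positivity gives \<open>\<bar>V\<^sub>t f - P f\<bar> \<le> \<epsilon>\<^sub>n V\<^sub>s \<one>\<close>, and on the member of the exhausting family for the time
  \<open>t / 2\<close> the domination bounds this by \<open>C \<epsilon>\<^sub>n \<phi>\<^sub>0\<close>. Dividing the estimates for \<open>f\<close> and for \<open>\<one>\<close> yields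
  convergence of the ratios to \<open>\<integral> f \<psi>\<^sub>0 / \<integral> \<psi>\<^sub>0\<close> (\<open>progressive_estimate\<close>, \<open>pGSD_imp_convergence\<close>). Here
  \<open>\<psi>\<^sub>0\<close> is integrable because of the domination: for a set \<open>B\<close> of finite measure \<open>V\<^sub>t \<one>\<^sub>B\<close> converges to
  \<open>P \<one>\<^sub>B\<close> along the multiples of \<open>t\<^sub>0\<close> and is eventually at most \<open>C \<phi>\<^sub>0\<close> at each point (\<open>q_integrable\<close>).

  It remains to see that \<open>\<epsilon>\<^sub>n \<rightarrow> 0\<close>. If \<open>\<bar>f\<bar> \<le> 1\<close>, then one step of length \<open>t\<^sub>0\<close> makes \<open>f\<close> at most \<open>1/2\<close> off a
  compact set, and on the compact set leaves a function in \<open>L\<^sup>2\<close>; so \<open>\<epsilon>\<^sub>n\<^sub>+\<^sub>1 \<le> \<epsilon>\<^sub>n / 2 + c e\<^sub>n\<close>, where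
  \<open>e\<^sub>n\<close> is the norm of \<open>V\<^sub>r - P\<close> as an operator from \<open>L\<^sup>2\<close> to \<open>L\<^sup>\<infinity>\<close> (\<open>error_le_recursion\<close>,
  \<open>Linf_convergence\<close>). Ultracontractivity reduces \<open>e\<^sub>n \<rightarrow> 0\<close> to convergence in the operator norm of \<open>L\<^sup>2\<close>,
  a theorem of Jentzsch type for the step operator \<open>V\<close> of time \<open>t\<^sub>0\<close> (\<open>jentzsch\<close>): \<open>V\<close> contracts the norm of
  \<open>L\<^sup>1(\<psi>\<^sub>0 \<mu>)\<close> and fixes \<open>\<phi>\<^sub>0\<close>, compactness and ultracontractivity make its powers bounded and compactness
  provides limit points of orbits, and a limit point with vanishing \<open>\<psi>\<^sub>0\<close>-mean whose \<open>L\<^sup>1(\<psi>\<^sub>0 \<mu>)\<close> norm is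
  preserved by \<open>V\<close> must vanish, because \<open>V\<close> is positivity improving. The adjoint semigroup
  inherits the operator norm convergence by duality (\<open>conv_A'\<close>).

  The eigenvalue equation of the generator is turned into \<open>U\<^sub>t \<phi>\<^sub>0 = exp (- \<lambda>\<^sub>0 t) \<phi>\<^sub>0\<close> by a telescoping
  argument, which rests on bounded operator norms for small times; for the semigroup these come from positivity
  (\<open>bounded_near_0\<close>), for its adjoint by duality. Since the kernel is real, everything is done for real
  functions; complex ones are treated through their real and imaginary parts.
\<close>

section \<open>Real square integrable functions\<close>

text \<open>
  Membership in the real \<open>L\<^sup>2\<close> space. Real functions suffice, because the kernel is real valued and
  acts on real and imaginary parts separately.
\<close>

definition sqint :: "'a measure \<Rightarrow> ('a \<Rightarrow> real) \<Rightarrow> bool" where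
  "sqint \<mu> f \<longleftrightarrow> f \<in> borel_measurable \<mu> \<and> integrable \<mu> (\<lambda>x. (f x)\<^sup>2)"

definition l2n :: "'a measure \<Rightarrow> ('a \<Rightarrow> real) \<Rightarrow> real" where
  "l2n \<mu> f = sqrt (\<integral>x. (f x)\<^sup>2 \<partial>\<mu>)"

lemma sqint_meas: "sqint \<mu> f \<Longrightarrow> f \<in> borel_measurable \<mu>"
  by (simp add: sqint_def)

lemma sqint_sq: "sqint \<mu> f \<Longrightarrow> integrable \<mu> (\<lambda>x. (f x)\<^sup>2)"
  by (simp add: sqint_def)

lemma l2n_nonneg [simp]: "0 \<le> l2n \<mu> f"
  by (simp add: l2n_def)

lemma l2n_sq: "(l2n \<mu> f)\<^sup>2 = (\<integral>x. (f x)\<^sup>2 \<partial>\<mu>)"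
  by (simp add: l2n_def)

lemma l2n_mono:
  assumes "f \<in> borel_measurable \<mu>" "sqint \<mu> g" "AE x in \<mu>. \<bar>f x\<bar> \<le> \<bar>g x\<bar>"
  shows "sqint \<mu> f" "l2n \<mu> f \<le> l2n \<mu> g"
proof -
  have ae: "AE x in \<mu>. (f x)\<^sup>2 \<le> (g x)\<^sup>2"
    using assms(3) by eventually_elim (simp add: abs_le_square_iff)
  have "integrable \<mu> (\<lambda>x. (f x)\<^sup>2)"
    by (rule Bochner_Integration.integrable_bound[OF sqint_sq[OF assms(2)]])
      (use assms(1) ae in \<open>auto\<close>)
  then show sq: "sqint \<mu> f"
    using assms(1) by (simp add: sqint_def)
  show "l2n \<mu> f \<le> l2n \<mu> g"
    unfolding l2n_def
    by (intro real_sqrt_le_mono integral_mono_AE sqint_sq sq assms(2) ae)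
qed

lemma l2n_cong:
  assumes "f \<in> borel_measurable \<mu>" "sqint \<mu> g" "AE x in \<mu>. f x = g x"
  shows "sqint \<mu> f" "l2n \<mu> f = l2n \<mu> g"
proof -
  show sq: "sqint \<mu> f"
    by (rule l2n_mono(1)[OF assms(1,2)]) (use assms(3) in auto)
  have "l2n \<mu> f \<le> l2n \<mu> g"
    by (rule l2n_mono(2)[OF assms(1,2)]) (use assms(3) in auto)
  moreover have "l2n \<mu> g \<le> l2n \<mu> f"
    by (rule l2n_mono(2)[OF sqint_meas[OF assms(2)] sq]) (use assms(3) in auto)
  ultimately show "l2n \<mu> f = l2n \<mu> g" by simp
qed

lemma sqint_mult:
  assumes "sqint \<mu> f" "sqint \<mu> g"
  shows "integrable \<mu> (\<lambda>x. f x * g x)"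
proof (rule Bochner_Integration.integrable_bound)
  show "integrable \<mu> (\<lambda>x. (f x)\<^sup>2 + (g x)\<^sup>2)"
    using assms by (simp add: sqint_def)
  show "(\<lambda>x. f x * g x) \<in> borel_measurable \<mu>"
    using assms[THEN sqint_meas] by simp
  show "AE x in \<mu>. norm (f x * g x) \<le> norm ((f x)\<^sup>2 + (g x)\<^sup>2)"
  proof (intro AE_I2)
    fix x
    have "2 * (\<bar>f x\<bar> * \<bar>g x\<bar>) \<le> (f x)\<^sup>2 + (g x)\<^sup>2"
      using sum_squares_bound[of "\<bar>f x\<bar>" "\<bar>g x\<bar>"] by simp
    moreover have "0 \<le> \<bar>f x\<bar> * \<bar>g x\<bar>" by simp
    ultimately have "\<bar>f x\<bar> * \<bar>g x\<bar> \<le> (f x)\<^sup>2 + (g x)\<^sup>2" by linarith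
    then show "norm (f x * g x) \<le> norm ((f x)\<^sup>2 + (g x)\<^sup>2)"
      by (simp add: abs_mult)
  qed
qed

lemma sqint_lin:
  assumes "sqint \<mu> f" "sqint \<mu> g"
  shows "sqint \<mu> (\<lambda>x. a * f x + b * g x)"
proof -
  have "(\<lambda>x. (a * f x + b * g x)\<^sup>2) = (\<lambda>x. a\<^sup>2 * (f x)\<^sup>2 + (2*a*b) * (f x * g x) + b\<^sup>2 * (g x)\<^sup>2)"
    by (simp add: fun_eq_iff power2_eq_square algebra_simps)
  moreover have "integrable \<mu> (\<lambda>x. a\<^sup>2 * (f x)\<^sup>2 + (2*a*b) * (f x * g x) + b\<^sup>2 * (g x)\<^sup>2)"
    using sqint_mult[OF assms] assms[THEN sqint_sq] by simp
  ultimately show ?thesis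
    using assms[THEN sqint_meas] by (simp add: sqint_def)
qed

lemma sqint_add: "sqint \<mu> f \<Longrightarrow> sqint \<mu> g \<Longrightarrow> sqint \<mu> (\<lambda>x. f x + g x)"
  using sqint_lin[of \<mu> f g 1 1] by simp

lemma sqint_diff: "sqint \<mu> f \<Longrightarrow> sqint \<mu> g \<Longrightarrow> sqint \<mu> (\<lambda>x. f x - g x)"
  using sqint_lin[of \<mu> f g 1 "-1"] by simp

lemma sqint_scale: "sqint \<mu> f \<Longrightarrow> sqint \<mu> (\<lambda>x. a * f x)"
  using sqint_lin[of \<mu> f f a 0] by simp

lemma sqint_abs: "sqint \<mu> f \<Longrightarrow> sqint \<mu> (\<lambda>x. \<bar>f x\<bar>)"
  by (auto simp: sqint_def)

lemma l2n_scale: "l2n \<mu> (\<lambda>x. a * f x) = \<bar>a\<bar> * l2n \<mu> f"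
  by (simp add: l2n_def power_mult_distrib real_sqrt_mult)

lemma l2n_eq_0:
  assumes "sqint \<mu> f"
  shows "l2n \<mu> f = 0 \<longleftrightarrow> (AE x in \<mu>. f x = 0)"
  using integral_nonneg_eq_0_iff_AE[OF sqint_sq[OF assms]] by (simp add: l2n_def)

lemma l2n_Cauchy_Schwarz:
  assumes f: "sqint \<mu> f" and g: "sqint \<mu> g"
  shows "\<bar>\<integral>x. f x * g x \<partial>\<mu>\<bar> \<le> l2n \<mu> f * l2n \<mu> g"
proof (cases "l2n \<mu> g = 0")
  case True
  then have "AE x in \<mu>. g x = 0" using l2n_eq_0[OF g] by simp
  then have "AE x in \<mu>. f x * g x = 0" by eventually_elim simp
  then have "(\<integral>x. f x * g x \<partial>\<mu>) = 0"
    by (intro integral_eq_zero_AE)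
  then show ?thesis by simp
next
  case False
  define I where "I = (\<integral>x. f x * g x \<partial>\<mu>)"
  define G where "G = (l2n \<mu> g)\<^sup>2"
  have G: "G > 0" using False by (simp add: G_def)
  define a where "a = I / G"
  have "0 \<le> (\<integral>x. (f x - a * g x)\<^sup>2 \<partial>\<mu>)"
    by simp
  also have "(\<lambda>x. (f x - a * g x)\<^sup>2) = (\<lambda>x. (f x)\<^sup>2 - (2*a) * (f x * g x) + a\<^sup>2 * (g x)\<^sup>2)"
    by (simp add: fun_eq_iff power2_eq_square algebra_simps)
  also have "(\<integral>x. (f x)\<^sup>2 - (2*a) * (f x * g x) + a\<^sup>2 * (g x)\<^sup>2 \<partial>\<mu>) = (l2n \<mu> f)\<^sup>2 - 2*a*I + a\<^sup>2 * G"
    using sqint_mult[OF f g] f g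
    by (simp add: sqint_def l2n_sq I_def G_def)
  also have "\<dots> = (l2n \<mu> f)\<^sup>2 - I\<^sup>2 / G"
    using G by (simp add: a_def power2_eq_square field_simps)
  finally have "I\<^sup>2 \<le> (l2n \<mu> f)\<^sup>2 * G"
    using G by (simp add: field_simps)
  then have "I\<^sup>2 \<le> (l2n \<mu> f * l2n \<mu> g)\<^sup>2"
    by (simp add: G_def power_mult_distrib)
  then show ?thesis
    unfolding I_def by (simp add: abs_le_square_iff[symmetric])
qed

lemma l2n_lin:
  assumes f: "sqint \<mu> f" and g: "sqint \<mu> g"
  shows "l2n \<mu> (\<lambda>x. f x + g x) \<le> l2n \<mu> f + l2n \<mu> g"
proof -
  have "(l2n \<mu> (\<lambda>x. f x + g x))\<^sup>2 = (\<integral>x. (f x)\<^sup>2 + 2 * (f x * g x) + (g x)\<^sup>2 \<partial>\<mu>)"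
    unfolding l2n_sq by (intro Bochner_Integration.integral_cong) (simp_all add: power2_sum)
  also have "\<dots> = (l2n \<mu> f)\<^sup>2 + 2 * (\<integral>x. f x * g x \<partial>\<mu>) + (l2n \<mu> g)\<^sup>2"
    using sqint_mult[OF f g] f g by (simp add: sqint_def l2n_sq)
  also have "\<dots> \<le> (l2n \<mu> f + l2n \<mu> g)\<^sup>2"
    using l2n_Cauchy_Schwarz[OF f g] by (simp add: power2_sum)
  finally show ?thesis
    by (rule power2_le_imp_le) simp
qed

lemma l2n_triangle_diff:
  assumes "sqint \<mu> f" "sqint \<mu> g"
  shows "l2n \<mu> f \<le> l2n \<mu> g + l2n \<mu> (\<lambda>x. f x - g x)"
  using l2n_lin[OF assms(2) sqint_diff[OF assms]] by simp

lemma sqint_restrict: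
  assumes "sqint \<mu> f" "B \<in> sets \<mu>"
  shows "sqint \<mu> (\<lambda>x. indicator B x * f x)" "l2n \<mu> (\<lambda>x. indicator B x * f x) \<le> l2n \<mu> f"
proof -
  have [measurable]: "B \<in> sets \<mu>" "f \<in> borel_measurable \<mu>" using assms by (auto dest: sqint_meas)
  have m: "(\<lambda>x. indicator B x * f x) \<in> borel_measurable \<mu>" by measurable
  have a: "AE x in \<mu>. \<bar>indicator B x * f x\<bar> \<le> \<bar>f x\<bar>" by (auto split: split_indicator)
  show "sqint \<mu> (\<lambda>x. indicator B x * f x)" "l2n \<mu> (\<lambda>x. indicator B x * f x) \<le> l2n \<mu> f"
    by (rule l2n_mono[OF m assms(1) a])+
qed

section \<open>Bounded positive operators and a Jentzsch theorem\<close>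

text \<open>
  Bounded positive linear operators on the real \<open>L\<^sup>2\<close> space, in terms of representatives: linearity and
  positivity hold almost everywhere. That such operators respect equality almost everywhere follows.
\<close>

definition pos_op :: "'a measure \<Rightarrow> (('a \<Rightarrow> real) \<Rightarrow> 'a \<Rightarrow> real) \<Rightarrow> bool" where
  "pos_op \<mu> T \<longleftrightarrow>
     (\<forall>f. sqint \<mu> f \<longrightarrow> sqint \<mu> (T f)) \<and>
     (\<forall>f g a b. sqint \<mu> f \<longrightarrow> sqint \<mu> g \<longrightarrow>
        (AE x in \<mu>. T (\<lambda>x. a * f x + b * g x) x = a * T f x + b * T g x)) \<and>
     (\<exists>M. \<forall>f. sqint \<mu> f \<longrightarrow> l2n \<mu> (T f) \<le> M * l2n \<mu> f) \<and>
     (\<forall>f. sqint \<mu> f \<longrightarrow> (AE x in \<mu>. 0 \<le> f x) \<longrightarrow> (AE x in \<mu>. 0 \<le> T f x))"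

lemma pos_op_sqint: "pos_op \<mu> T \<Longrightarrow> sqint \<mu> f \<Longrightarrow> sqint \<mu> (T f)"
  by (simp add: pos_op_def)

lemma pos_op_lin:
  "pos_op \<mu> T \<Longrightarrow> sqint \<mu> f \<Longrightarrow> sqint \<mu> g \<Longrightarrow>
    AE x in \<mu>. T (\<lambda>x. a * f x + b * g x) x = a * T f x + b * T g x"
  by (simp add: pos_op_def)

lemma pos_op_add:
  "pos_op \<mu> T \<Longrightarrow> sqint \<mu> f \<Longrightarrow> sqint \<mu> g \<Longrightarrow> AE x in \<mu>. T (\<lambda>x. f x + g x) x = T f x + T g x"
  using pos_op_lin[of \<mu> T f g 1 1] by simp

lemma pos_op_diff:
  "pos_op \<mu> T \<Longrightarrow> sqint \<mu> f \<Longrightarrow> sqint \<mu> g \<Longrightarrow> AE x in \<mu>. T (\<lambda>x. f x - g x) x = T f x - T g x"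
  using pos_op_lin[of \<mu> T f g 1 "-1"] by simp

lemma pos_op_scale:
  "pos_op \<mu> T \<Longrightarrow> sqint \<mu> f \<Longrightarrow> AE x in \<mu>. T (\<lambda>x. a * f x) x = a * T f x"
  using pos_op_lin[of \<mu> T f f a 0] by simp

lemma pos_op_pos:
  "pos_op \<mu> T \<Longrightarrow> sqint \<mu> f \<Longrightarrow> AE x in \<mu>. 0 \<le> f x \<Longrightarrow> AE x in \<mu>. 0 \<le> T f x"
  by (simp add: pos_op_def)

lemma pos_op_bound:
  assumes "pos_op \<mu> T"
  obtains M where "M \<ge> 0" "\<And>f. sqint \<mu> f \<Longrightarrow> l2n \<mu> (T f) \<le> M * l2n \<mu> f"
proof -
  obtain M where M: "\<And>f. sqint \<mu> f \<Longrightarrow> l2n \<mu> (T f) \<le> M * l2n \<mu> f"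
    using assms by (auto simp: pos_op_def)
  have "l2n \<mu> (T f) \<le> \<bar>M\<bar> * l2n \<mu> f" if "sqint \<mu> f" for f
    using M[OF that] mult_right_mono[OF abs_ge_self[of M] l2n_nonneg[of \<mu> f]] by linarith
  then show ?thesis using that[of "\<bar>M\<bar>"] by simp
qed

lemma pos_op_mono:
  assumes T: "pos_op \<mu> T" and f: "sqint \<mu> f" and g: "sqint \<mu> g" and le: "AE x in \<mu>. f x \<le> g x"
  shows "AE x in \<mu>. T f x \<le> T g x"
proof -
  have "AE x in \<mu>. 0 \<le> T (\<lambda>x. g x - f x) x"
    by (rule pos_op_pos[OF T sqint_diff[OF g f]]) (use le in auto)
  with pos_op_diff[OF T g f] show ?thesis by eventually_elim simp
qed

lemma pos_op_cong:
  assumes T: "pos_op \<mu> T" and f: "sqint \<mu> f" and g: "sqint \<mu> g" and le: "AE x in \<mu>. f x = g x"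
  shows "AE x in \<mu>. T f x = T g x"
proof -
  have "AE x in \<mu>. T f x \<le> T g x"
    by (rule pos_op_mono[OF T f g]) (use le in auto)
  moreover have "AE x in \<mu>. T g x \<le> T f x"
    by (rule pos_op_mono[OF T g f]) (use le in auto)
  ultimately show ?thesis by eventually_elim simp
qed

lemma pos_op_abs_le:
  assumes T: "pos_op \<mu> T" and f: "sqint \<mu> f" and g: "sqint \<mu> g" and le: "AE x in \<mu>. \<bar>f x\<bar> \<le> g x"
  shows "AE x in \<mu>. \<bar>T f x\<bar> \<le> T g x"
proof -
  have "AE x in \<mu>. T f x \<le> T g x"
    by (rule pos_op_mono[OF T f g]) (use le in auto)
  moreover have "AE x in \<mu>. T (\<lambda>x. -1 * f x) x \<le> T g x"
    by (rule pos_op_mono[OF T sqint_scale[OF f] g]) (use le in auto)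
  moreover have "AE x in \<mu>. T (\<lambda>x. -1 * f x) x = -1 * T f x"
    by (rule pos_op_scale[OF T f])
  ultimately show ?thesis by eventually_elim simp
qed

lemma pos_op_comp:
  assumes T: "pos_op \<mu> T" and R: "pos_op \<mu> R"
  shows "pos_op \<mu> (\<lambda>f. T (R f))"
  unfolding pos_op_def
proof (intro conjI allI impI)
  fix f assume f: "sqint \<mu> f"
  show "sqint \<mu> (T (R f))" by (intro pos_op_sqint[OF T] pos_op_sqint[OF R] f)
  assume "AE x in \<mu>. 0 \<le> f x"
  then show "AE x in \<mu>. 0 \<le> T (R f) x"
    by (intro pos_op_pos[OF T] pos_op_sqint[OF R] f) (rule pos_op_pos[OF R f])
next
  fix f g and a b :: real assume f: "sqint \<mu> f" and g: "sqint \<mu> g"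
  have Rf: "sqint \<mu> (R f)" and Rg: "sqint \<mu> (R g)"
    by (auto intro: pos_op_sqint[OF R] f g)
  have "AE x in \<mu>. T (R (\<lambda>x. a * f x + b * g x)) x = T (\<lambda>x. a * R f x + b * R g x) x"
    by (rule pos_op_cong[OF T pos_op_sqint[OF R sqint_lin[OF f g]] sqint_lin[OF Rf Rg]
          pos_op_lin[OF R f g]])
  with pos_op_lin[OF T Rf Rg, of a b]
  show "AE x in \<mu>. T (R (\<lambda>x. a * f x + b * g x)) x = a * T (R f) x + b * T (R g) x"
    by eventually_elim simp
next
  obtain M where M: "M \<ge> 0" "\<And>f. sqint \<mu> f \<Longrightarrow> l2n \<mu> (T f) \<le> M * l2n \<mu> f"
    using pos_op_bound[OF T] by blast
  obtain L where L: "L \<ge> 0" "\<And>f. sqint \<mu> f \<Longrightarrow> l2n \<mu> (R f) \<le> L * l2n \<mu> f"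
    using pos_op_bound[OF R] by blast
  have "l2n \<mu> (T (R f)) \<le> (M * L) * l2n \<mu> f" if f: "sqint \<mu> f" for f
    using M(2)[OF pos_op_sqint[OF R f]] mult_left_mono[OF L(2)[OF f] M(1)] by (simp add: mult.assoc)
  then show "\<exists>M. \<forall>f. sqint \<mu> f \<longrightarrow> l2n \<mu> (T (R f)) \<le> M * l2n \<mu> f"
    by blast
qed

lemma pos_op_id: "pos_op \<mu> (\<lambda>f. f)"
  unfolding pos_op_def by (auto intro!: exI[of _ 1])

lemma pos_op_funpow: "pos_op \<mu> T \<Longrightarrow> pos_op \<mu> (T ^^ n)"
proof (induction n)
  case 0 then show ?case using pos_op_id[of \<mu>] by (simp add: id_def)
next
  case (Suc n)
  have "T ^^ Suc n = (\<lambda>f. T ((T ^^ n) f))" by (simp add: fun_eq_iff)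
  then show ?case using pos_op_comp[OF Suc.prems Suc.IH[OF Suc.prems]] by simp
qed

lemma pos_op_indicator:
  assumes D: "D \<in> sets \<mu>"
  shows "pos_op \<mu> (\<lambda>f x. indicator D x * f x)"
  unfolding pos_op_def
proof (intro conjI allI impI)
  show "\<exists>M. \<forall>f. sqint \<mu> f \<longrightarrow> l2n \<mu> (\<lambda>x. indicator D x * f x) \<le> M * l2n \<mu> f"
    by (intro exI[of _ 1]) (simp add: sqint_restrict(2)[OF _ D])
  show "AE x in \<mu>. 0 \<le> indicator D x * f x" if "AE x in \<mu>. 0 \<le> f x" for f :: "'a \<Rightarrow> real"
    using that by eventually_elim simp
qed (simp_all only: sqint_restrict(1)[OF _ D], simp add: algebra_simps)

text \<open>
  Arguments by contradiction from the failure of an operator norm estimate start with a witness \<open>F\<close>;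
  this rescales it into the unit ball, as compactness and the gliding hump argument require.
\<close>

lemma pos_op_normalize:
  assumes T: "pos_op \<mu> T" and F: "sqint \<mu> F" and big: "c * l2n \<mu> F < l2n \<mu> (T F)"
  shows "\<exists>a. l2n \<mu> (\<lambda>x. a * F x) \<le> 1 \<and> c < l2n \<mu> (T (\<lambda>x. a * F x))"
proof -
  obtain M where M: "\<And>f. sqint \<mu> f \<Longrightarrow> l2n \<mu> (T f) \<le> M * l2n \<mu> f"
    using pos_op_bound[OF T] by blast
  have pos: "l2n \<mu> F > 0"
  proof (rule ccontr)
    assume "\<not> l2n \<mu> F > 0"
    then have "l2n \<mu> F = 0" using l2n_nonneg[of \<mu> F] by linarith
    then show False using big M[OF F] by simp
  qed
  let ?a = "1 / l2n \<mu> F"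
  have "l2n \<mu> (T (\<lambda>x. ?a * F x)) = l2n \<mu> (\<lambda>x. ?a * T F x)"
    by (rule l2n_cong(2)[OF sqint_meas[OF pos_op_sqint[OF T sqint_scale[OF F]]]
          sqint_scale[OF pos_op_sqint[OF T F]] pos_op_scale[OF T F]])
  also have "\<dots> = ?a * l2n \<mu> (T F)"
    by (subst l2n_scale) (use pos in simp)
  finally have "c < l2n \<mu> (T (\<lambda>x. ?a * F x))"
    using big pos by (simp only: mult_1 times_divide_eq_left pos_less_divide_eq)
  moreover have "l2n \<mu> (\<lambda>x. ?a * F x) \<le> 1"
    by (subst l2n_scale) (use pos in simp)
  ultimately show ?thesis by blast
qed

lemma l2n_tendsto_0_bound:
  assumes "\<And>n. l2n \<mu> (f n) \<le> b n" "b \<longlonglongrightarrow> 0"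
  shows "(\<lambda>n. l2n \<mu> (f n)) \<longlonglongrightarrow> 0"
proof (rule tendsto_sandwich[OF _ _ tendsto_const assms(2)])
  show "\<forall>\<^sub>F n in sequentially. 0 \<le> l2n \<mu> (f n)" by simp
  show "\<forall>\<^sub>F n in sequentially. l2n \<mu> (f n) \<le> b n" using assms(1) by simp
qed

lemma pos_op_l2n_tendsto:
  assumes T: "pos_op \<mu> T" and f: "\<And>n. sqint \<mu> (f n)" and g: "sqint \<mu> g"
    and lim: "(\<lambda>n. l2n \<mu> (\<lambda>x. f n x - g x)) \<longlonglongrightarrow> 0"
  shows "(\<lambda>n. l2n \<mu> (\<lambda>x. T (f n) x - T g x)) \<longlonglongrightarrow> 0"
proof -
  obtain M where M: "M \<ge> 0" "\<And>f. sqint \<mu> f \<Longrightarrow> l2n \<mu> (T f) \<le> M * l2n \<mu> f"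
    using pos_op_bound[OF T] by blast
  have "l2n \<mu> (\<lambda>x. T (f n) x - T g x) \<le> M * l2n \<mu> (\<lambda>x. f n x - g x)" for n
  proof -
    have "l2n \<mu> (\<lambda>x. T (f n) x - T g x) = l2n \<mu> (T (\<lambda>x. f n x - g x))"
      by (rule l2n_cong(2)[symmetric])
        (use pos_op_diff[OF T f g] in \<open>auto intro!: sqint_meas sqint_diff pos_op_sqint[OF T] f g\<close>)
    then show ?thesis using M(2)[OF sqint_diff[OF f g]] by simp
  qed
  moreover have "(\<lambda>n. M * l2n \<mu> (\<lambda>x. f n x - g x)) \<longlonglongrightarrow> 0"
    using tendsto_mult_right_zero[OF lim] by simp
  ultimately show ?thesis
    by (rule l2n_tendsto_0_bound)
qed

text \<open>
  A compact, positivity improving operator that maps \<open>L\<^sup>2\<close> boundedly to \<open>L\<^sup>\<infinity>\<close> and has a strictly positive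
  fixed point \<open>p\<close>; its adjoint fixes the strictly positive \<open>q\<close>. The powers of the operator converge in norm to the rank one
  projection onto \<open>p\<close> along \<open>q\<close>.
\<close>

locale jentzsch =
  fixes \<mu> :: "'a measure" and A :: "('a \<Rightarrow> real) \<Rightarrow> 'a \<Rightarrow> real" and p q :: "'a \<Rightarrow> real" and C :: real
  assumes A: "pos_op \<mu> A"
    and improving: "\<And>f. sqint \<mu> f \<Longrightarrow> AE x in \<mu>. 0 \<le> f x \<Longrightarrow> \<not> (AE x in \<mu>. f x = 0) \<Longrightarrow> AE x in \<mu>. 0 < A f x"
    and compactness: "\<And>f B. (\<And>n::nat. sqint \<mu> (f n)) \<Longrightarrow> (\<And>n. l2n \<mu> (f n) \<le> B) \<Longrightarrow>
      \<exists>g r. sqint \<mu> g \<and> strict_mono r \<and> (\<lambda>n. l2n \<mu> (\<lambda>x. A (f (r n)) x - g x)) \<longlonglongrightarrow> 0"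
    and ultracontractive: "\<And>f. sqint \<mu> f \<Longrightarrow> AE x in \<mu>. \<bar>A f x\<bar> \<le> C * l2n \<mu> f"
    and p: "sqint \<mu> p" "AE x in \<mu>. 0 < p x" "AE x in \<mu>. A p x = p x"
    and q: "sqint \<mu> q" "AE x in \<mu>. 0 < q x" "\<And>f. sqint \<mu> f \<Longrightarrow> (\<integral>x. A f x * q x \<partial>\<mu>) = (\<integral>x. f x * q x \<partial>\<mu>)"
    and pq: "0 < (\<integral>x. p x * q x \<partial>\<mu>)"
begin

lemma C_nonneg: "0 \<le> C"
proof (rule ccontr)
  assume "\<not> 0 \<le> C"
  then have le: "C * l2n \<mu> p \<le> 0" by (simp add: mult_le_0_iff)
  have "AE x in \<mu>. p x * q x = 0"
    using ultracontractive[OF p(1)] p(2,3) by eventually_elim (use le in linarith)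
  then have "(\<integral>x. p x * q x \<partial>\<mu>) = 0" by (rule integral_eq_zero_AE)
  with pq show False by simp
qed

lemma sqA: "sqint \<mu> f \<Longrightarrow> sqint \<mu> (A f)"
  by (rule pos_op_sqint[OF A])

lemma An: "pos_op \<mu> (A ^^ n)"
  by (rule pos_op_funpow[OF A])

lemma sqAn: "sqint \<mu> f \<Longrightarrow> sqint \<mu> ((A ^^ n) f)"
  by (rule pos_op_sqint[OF An])

lemma An_p: "AE x in \<mu>. (A ^^ n) p x = p x"
proof (induction n)
  case (Suc n)
  have "AE x in \<mu>. A ((A ^^ n) p) x = A p x"
    by (rule pos_op_cong[OF A sqAn[OF p(1)] p(1) Suc])
  with p(3) show ?case by eventually_elim simp
qed simp

lemma An_q: "sqint \<mu> f \<Longrightarrow> (\<integral>x. (A ^^ n) f x * q x \<partial>\<mu>) = (\<integral>x. f x * q x \<partial>\<mu>)"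
  by (induction n) (simp_all add: q(3) sqAn)

text \<open>
  The sets \<open>{p < \<delta>}\<close> decrease to a null set, and a compact operator followed by restriction to such sets
  tends to zero in norm: otherwise there would be \<open>G\<^sub>n\<close> in the unit ball with \<open>A G\<^sub>n\<close> large on these sets; but
  along a subsequence \<open>A G\<^sub>n\<close> converges in \<open>L\<^sup>2\<close>, and the mass of the limit on these sets tends to zero.
\<close>

lemma small_tail:
  "\<exists>\<delta>>0. \<forall>f. sqint \<mu> f \<longrightarrow> l2n \<mu> (\<lambda>x. indicator {x\<in>space \<mu>. p x < \<delta>} x * A f x) \<le> 1/2 * l2n \<mu> f"
proof (rule ccontr)
  let ?B = "\<lambda>n::nat. {x\<in>space \<mu>. p x < 1 / Suc n}"
  note [measurable] = sqint_meas[OF p(1)]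
  have B [measurable]: "?B n \<in> sets \<mu>" for n by measurable
  assume "\<not> ?thesis"
  then have "\<not> (\<forall>f. sqint \<mu> f \<longrightarrow> l2n \<mu> (\<lambda>x. indicator (?B n) x * A f x) \<le> 1/2 * l2n \<mu> f)" for n
    using zero_less_divide_1_iff[of "real (Suc n)"] of_nat_0_less_iff[of "Suc n"] by blast
  then have F: "\<exists>f. sqint \<mu> f \<and> 1/2 * l2n \<mu> f < l2n \<mu> (\<lambda>x. indicator (?B n) x * A f x)" for n
    by (simp add: not_le)
  have "\<exists>G. sqint \<mu> G \<and> l2n \<mu> G \<le> 1 \<and> 1/2 < l2n \<mu> (\<lambda>x. indicator (?B n) x * A G x)" for n
  proof -
    obtain f where f: "sqint \<mu> f" "1/2 * l2n \<mu> f < l2n \<mu> (\<lambda>x. indicator (?B n) x * A f x)"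
      using F by blast
    show ?thesis
      using pos_op_normalize[OF pos_op_comp[OF pos_op_indicator[OF B] A] f] sqint_scale[OF f(1)] by blast
  qed
  then obtain G where G: "\<And>n. sqint \<mu> (G n)" "\<And>n. l2n \<mu> (G n) \<le> 1"
    and big: "\<And>n. 1/2 < l2n \<mu> (\<lambda>x. indicator (?B n) x * A (G n) x)" by metis
  obtain g r where g: "sqint \<mu> g" and r: "strict_mono r"
    and lim: "(\<lambda>n. l2n \<mu> (\<lambda>x. A (G (r n)) x - g x)) \<longlonglongrightarrow> 0"
    using compactness[of G 1, OF G] by (elim exE conjE) (rule that)
  have tail: "(\<lambda>n. l2n \<mu> (\<lambda>x. indicator (?B (r n)) x * g x)) \<longlonglongrightarrow> 0"
  proof -
    have "(\<lambda>n. \<integral>x. (indicator (?B n) x * g x)\<^sup>2 \<partial>\<mu>) \<longlonglongrightarrow> (\<integral>x. 0 \<partial>\<mu>)"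
    proof (rule integral_dominated_convergence[where w="\<lambda>x. (g x)\<^sup>2"])
      show "AE x in \<mu>. (\<lambda>n. (indicator (?B n) x * g x)\<^sup>2) \<longlonglongrightarrow> 0"
        using p(2)
      proof eventually_elim
        case (elim x)
        have "\<forall>\<^sub>F n in sequentially. 1 / Suc n < p x"
          using order_tendstoD(2)[OF LIMSEQ_inverse_real_of_nat elim] by (simp add: inverse_eq_divide)
        then have "\<forall>\<^sub>F n in sequentially. (indicator (?B n) x * g x)\<^sup>2 = 0"
          by eventually_elim (auto split: split_indicator)
        then show ?case by (rule tendsto_eventually)
      qed
      show "\<And>n. AE x in \<mu>. norm ((indicator (?B n) x * g x)\<^sup>2) \<le> (g x)\<^sup>2"
        by (auto split: split_indicator)
    qed (use g in \<open>auto simp: sqint_def\<close>)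
    then have "(\<lambda>n. l2n \<mu> (\<lambda>x. indicator (?B n) x * g x)) \<longlonglongrightarrow> 0"
      unfolding l2n_def using tendsto_real_sqrt by fastforce
    from LIMSEQ_subseq_LIMSEQ[OF this r] show ?thesis by (simp add: o_def)
  qed
  have "1/2 \<le> l2n \<mu> (\<lambda>x. A (G (r n)) x - g x) + l2n \<mu> (\<lambda>x. indicator (?B (r n)) x * g x)" for n
  proof -
    let ?b = "indicator (?B (r n)) :: 'a \<Rightarrow> real"
    have d: "sqint \<mu> (\<lambda>x. A (G (r n)) x - g x)" by (intro sqint_diff sqA G g)
    have "l2n \<mu> (\<lambda>x. ?b x * A (G (r n)) x) = l2n \<mu> (\<lambda>x. ?b x * (A (G (r n)) x - g x) + ?b x * g x)"
      by (simp add: algebra_simps)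
    also have "\<dots> \<le> l2n \<mu> (\<lambda>x. ?b x * (A (G (r n)) x - g x)) + l2n \<mu> (\<lambda>x. ?b x * g x)"
      by (intro l2n_lin sqint_restrict d g B)
    also have "l2n \<mu> (\<lambda>x. ?b x * (A (G (r n)) x - g x)) \<le> l2n \<mu> (\<lambda>x. A (G (r n)) x - g x)"
      by (rule sqint_restrict[OF d B])
    finally show ?thesis using big[of "r n"] by simp
  qed
  moreover have "(\<lambda>n. l2n \<mu> (\<lambda>x. A (G (r n)) x - g x) + l2n \<mu> (\<lambda>x. indicator (?B (r n)) x * g x)) \<longlonglongrightarrow> 0 + 0"
    by (rule tendsto_add[OF lim tail])
  ultimately have "1/2 \<le> (0 + 0::real)"
    by (intro LIMSEQ_le_const) auto
  then show False by simp
qed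

text \<open>
  Where \<open>p \<ge> \<delta>\<close>, ultracontractivity gives \<open>\<bar>A f\<bar> \<le> (C / \<delta>) \<parallel>f\<parallel> p\<close>, a bound that every power of \<open>A\<close>
  preserves since \<open>A p = p\<close>. The remaining part of \<open>A f\<close> has at most half the norm of \<open>f\<close>. So the norms \<open>m\<^sub>n\<close> of the
  powers satisfy \<open>m\<^sub>n\<^sub>+\<^sub>1 \<le> m\<^sub>n / 2 + L\<close>.
\<close>

lemma power_bounded: "\<exists>M\<ge>0. \<forall>n f. sqint \<mu> f \<longrightarrow> l2n \<mu> ((A ^^ n) f) \<le> M * l2n \<mu> f"
proof -
  obtain \<delta> where \<delta>: "\<delta> > 0"
    and tail: "\<And>f. sqint \<mu> f \<Longrightarrow> l2n \<mu> (\<lambda>x. indicator {x\<in>space \<mu>. p x < \<delta>} x * A f x) \<le> 1/2 * l2n \<mu> f"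
    using small_tail by blast
  note [measurable] = sqint_meas[OF p(1)]
  let ?b = "indicator {x\<in>space \<mu>. p x < \<delta>} :: 'a \<Rightarrow> real"
  let ?c = "indicator {x\<in>space \<mu>. \<not> p x < \<delta>} :: 'a \<Rightarrow> real"
  define L where "L = C / \<delta> * l2n \<mu> p"
  \<comment> \<open>\<open>2 * L\<close> is the fixed point of \<open>m \<mapsto> m / 2 + L\<close>; the identity, the power zero, needs \<open>1\<close>.\<close>
  define M where "M = max 1 (2 * L)"
  have "l2n \<mu> ((A ^^ n) f) \<le> M * l2n \<mu> f" if "sqint \<mu> f" for n f
    using that
  proof (induction n arbitrary: f)
    case 0
    have "1 * l2n \<mu> f \<le> M * l2n \<mu> f" by (rule mult_right_mono) (auto simp: M_def)
    then show ?case by simp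
  next
    case (Suc n)
    note f = Suc.prems
    define g where "g = (\<lambda>x. ?b x * A f x)"
    define h where "h = (\<lambda>x. ?c x * A f x)"
    have g: "sqint \<mu> g" and h: "sqint \<mu> h"
      unfolding g_def h_def by (intro sqint_restrict sqA f; measurable)+
    define K where "K = C / \<delta> * l2n \<mu> f"
    have hp: "AE x in \<mu>. \<bar>h x\<bar> \<le> K * p x"
      using ultracontractive[OF f] p(2) AE_space
    proof eventually_elim
      case (elim x)
      show ?case
      proof (cases "p x < \<delta>")
        case True then show ?thesis using elim \<delta> C_nonneg by (simp add: h_def K_def)
      next
        case False
        have "\<bar>h x\<bar> \<le> C * l2n \<mu> f" using False elim by (simp add: h_def)
        also have "\<dots> = K * \<delta>" using \<delta> by (simp add: K_def)
        also have "\<dots> \<le> K * p x"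
          using False C_nonneg \<delta> by (intro mult_left_mono) (auto simp: K_def)
        finally show ?thesis .
      qed
    qed
    have "AE x in \<mu>. \<bar>(A ^^ n) h x\<bar> \<le> (A ^^ n) (\<lambda>x. K * p x) x"
      by (rule pos_op_abs_le[OF An h sqint_scale[OF p(1)] hp])
    with pos_op_scale[OF An p(1), of n K] An_p[of n]
    have "AE x in \<mu>. \<bar>(A ^^ n) h x\<bar> \<le> \<bar>K * p x\<bar>"
      by eventually_elim simp
    then have "l2n \<mu> ((A ^^ n) h) \<le> l2n \<mu> (\<lambda>x. K * p x)"
      by (intro l2n_mono(2) sqint_meas[OF sqAn[OF h]] sqint_scale p)
    also have "\<dots> = L * l2n \<mu> f"
      using \<delta> C_nonneg by (subst l2n_scale) (simp add: L_def K_def abs_mult)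
    finally have 1: "l2n \<mu> ((A ^^ n) h) \<le> L * l2n \<mu> f" .
    have "l2n \<mu> ((A ^^ n) g) \<le> M * l2n \<mu> g" by (rule Suc.IH[OF g])
    also have "\<dots> \<le> M * (1/2 * l2n \<mu> f)"
      using tail[OF f] by (intro mult_left_mono) (auto simp: g_def M_def)
    finally have 2: "l2n \<mu> ((A ^^ n) g) \<le> M / 2 * l2n \<mu> f" by simp
    have Af: "AE x in \<mu>. A f x = g x + h x"
      using AE_space by eventually_elim (auto simp: g_def h_def split: split_indicator)
    have "AE x in \<mu>. (A ^^ n) (A f) x = (A ^^ n) (\<lambda>x. g x + h x) x"
      by (rule pos_op_cong[OF An sqA[OF f] sqint_add[OF g h] Af])
    with pos_op_add[OF An g h] have "AE x in \<mu>. (A ^^ Suc n) f x = (A ^^ n) g x + (A ^^ n) h x"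
      unfolding funpow_Suc_right o_def by eventually_elim simp
    then have "l2n \<mu> ((A ^^ Suc n) f) = l2n \<mu> (\<lambda>x. (A ^^ n) g x + (A ^^ n) h x)"
      by (intro l2n_cong(2) sqint_add sqAn g h sqint_meas[OF sqAn[OF f]])
    also have "\<dots> \<le> l2n \<mu> ((A ^^ n) g) + l2n \<mu> ((A ^^ n) h)"
      by (intro l2n_lin sqAn g h)
    also have "\<dots> \<le> (M / 2 + L) * l2n \<mu> f"
      using 1 2 by (simp add: algebra_simps)
    also have "\<dots> \<le> M * l2n \<mu> f"
      by (intro mult_right_mono) (auto simp: M_def)
    finally show ?case .
  qed
  moreover have "M \<ge> 0" by (simp add: M_def)
  ultimately show ?thesis by blast
qed

end

context jentzsch begin

text \<open>
  Since \<open>q\<close> is invariant, \<open>A\<close> contracts the weighted norm \<open>\<integral> \<bar>f\<bar> q\<close>; this norm serves as a Lyapunov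
  function for the orbits of \<open>A\<close>.
\<close>

lemma L1_contraction:
  assumes f: "sqint \<mu> f"
  shows "(\<integral>x. \<bar>A f x\<bar> * q x \<partial>\<mu>) \<le> (\<integral>x. \<bar>f x\<bar> * q x \<partial>\<mu>)"
proof -
  have "AE x in \<mu>. \<bar>A f x\<bar> \<le> A (\<lambda>x. \<bar>f x\<bar>) x"
    by (rule pos_op_abs_le[OF A f sqint_abs[OF f]]) simp
  then have "AE x in \<mu>. \<bar>A f x\<bar> * q x \<le> A (\<lambda>x. \<bar>f x\<bar>) x * q x"
    using q(2) by eventually_elim (simp add: mult_right_mono)
  then have "(\<integral>x. \<bar>A f x\<bar> * q x \<partial>\<mu>) \<le> (\<integral>x. A (\<lambda>x. \<bar>f x\<bar>) x * q x \<partial>\<mu>)"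
    by (intro integral_mono_AE sqint_mult sqint_abs sqA f q)
  also have "\<dots> = (\<integral>x. \<bar>f x\<bar> * q x \<partial>\<mu>)" by (rule q(3)[OF sqint_abs[OF f]])
  finally show ?thesis .
qed

lemma L1_dist_le:
  assumes f: "sqint \<mu> f" and g: "sqint \<mu> g"
  shows "\<bar>(\<integral>x. \<bar>f x\<bar> * q x \<partial>\<mu>) - (\<integral>x. \<bar>g x\<bar> * q x \<partial>\<mu>)\<bar> \<le> l2n \<mu> (\<lambda>x. f x - g x) * l2n \<mu> q"
proof -
  have "(\<integral>x. \<bar>f x\<bar> * q x \<partial>\<mu>) - (\<integral>x. \<bar>g x\<bar> * q x \<partial>\<mu>) = (\<integral>x. (\<bar>f x\<bar> - \<bar>g x\<bar>) * q x \<partial>\<mu>)"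
    using sqint_mult[OF sqint_abs[OF f] q(1)] sqint_mult[OF sqint_abs[OF g] q(1)]
    by (simp add: left_diff_distrib)
  also have "\<bar>\<dots>\<bar> \<le> l2n \<mu> (\<lambda>x. \<bar>f x\<bar> - \<bar>g x\<bar>) * l2n \<mu> q"
    by (intro l2n_Cauchy_Schwarz sqint_diff sqint_abs f g q)
  also have "\<dots> \<le> l2n \<mu> (\<lambda>x. f x - g x) * l2n \<mu> q"
    by (intro mult_right_mono l2n_mono(2) sqint_meas[OF sqint_diff] sqint_diff sqint_abs f g) auto
  finally show ?thesis .
qed

text \<open>
  Equality of the weighted norms forces \<open>\<bar>A h\<bar> = A \<bar>h\<bar>\<close>, so at almost every point one of \<open>A h\<^sup>+\<close>, \<open>A h\<^sup>-\<close>
  vanishes. As \<open>A\<close> is positivity improving, one of \<open>h\<^sup>+\<close>, \<open>h\<^sup>-\<close> is zero, and then the vanishing mean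
  leaves only \<open>h = 0\<close>.
\<close>

lemma extremal_zero:
  assumes h: "sqint \<mu> h" and mean: "(\<integral>x. h x * q x \<partial>\<mu>) = 0"
    and eq: "(\<integral>x. \<bar>A h x\<bar> * q x \<partial>\<mu>) = (\<integral>x. \<bar>h x\<bar> * q x \<partial>\<mu>)"
  shows "AE x in \<mu>. h x = 0"
proof -
  define hp where "hp x = max (h x) 0" for x
  define hm where "hm x = max (- h x) 0" for x
  have hp: "sqint \<mu> hp"
    unfolding hp_def[abs_def] by (rule l2n_mono(1)[OF _ h]) (use sqint_meas[OF h] in auto)
  have hm: "sqint \<mu> hm"
    unfolding hm_def[abs_def] by (rule l2n_mono(1)[OF _ h]) (use sqint_meas[OF h] in auto)
  have Ah: "AE x in \<mu>. A h x = A hp x - A hm x"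
  proof -
    have "h = (\<lambda>x. hp x - hm x)"
      by (auto simp: hp_def hm_def fun_eq_iff)
    then show ?thesis using pos_op_diff[OF A hp hm] by simp
  qed
  have Aabs: "AE x in \<mu>. A (\<lambda>x. \<bar>h x\<bar>) x = A hp x + A hm x"
  proof -
    have "(\<lambda>x. \<bar>h x\<bar>) = (\<lambda>x. hp x + hm x)"
      by (auto simp: hp_def hm_def fun_eq_iff)
    then show ?thesis using pos_op_add[OF A hp hm] by simp
  qed
  have "0 = (\<integral>x. (A (\<lambda>x. \<bar>h x\<bar>) x - \<bar>A h x\<bar>) * q x \<partial>\<mu>)"
    using eq q(3)[OF sqint_abs[OF h]] sqint_mult[OF sqint_abs[OF sqA[OF h]] q(1)]
      sqint_mult[OF sqA[OF sqint_abs[OF h]] q(1)]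
    by (simp add: left_diff_distrib)
  moreover have "AE x in \<mu>. 0 \<le> (A (\<lambda>x. \<bar>h x\<bar>) x - \<bar>A h x\<bar>) * q x"
  proof -
    have "AE x in \<mu>. \<bar>A h x\<bar> \<le> A (\<lambda>x. \<bar>h x\<bar>) x"
      by (rule pos_op_abs_le[OF A h sqint_abs[OF h]]) simp
    then show ?thesis using q(2) by eventually_elim simp
  qed
  ultimately have "AE x in \<mu>. (A (\<lambda>x. \<bar>h x\<bar>) x - \<bar>A h x\<bar>) * q x = 0"
    using integral_nonneg_eq_0_iff_AE[OF sqint_mult[OF sqint_diff[OF sqA[OF sqint_abs[OF h]] sqint_abs[OF sqA[OF h]]] q(1)]]
    by simp
  then have disj: "AE x in \<mu>. A hp x \<le> 0 \<or> A hm x \<le> 0"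
    using q(2) Ah Aabs by eventually_elim (auto simp: abs_if split: if_splits)
  have signed: "(AE x in \<mu>. hp x = 0) \<or> (AE x in \<mu>. hm x = 0)"
  proof (rule ccontr)
    assume "\<not> ?thesis"
    then have nz: "\<not> (AE x in \<mu>. hp x = 0)" "\<not> (AE x in \<mu>. hm x = 0)" by auto
    have "AE x in \<mu>. 0 < A hp x" by (rule improving[OF hp _ nz(1)]) (simp add: hp_def)
    moreover have "AE x in \<mu>. 0 < A hm x" by (rule improving[OF hm _ nz(2)]) (simp add: hm_def)
    ultimately have "AE x in \<mu>. hp x = 0" using disj by eventually_elim auto
    with nz show False by simp
  qed
  have "(\<integral>x. \<bar>h x\<bar> * q x \<partial>\<mu>) = 0"
    using signed
  proof
    assume "AE x in \<mu>. hp x = 0"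
    then have "AE x in \<mu>. \<bar>h x\<bar> * q x = - (h x * q x)"
      by eventually_elim (simp add: hp_def max_def split: if_splits)
    then have "(\<integral>x. \<bar>h x\<bar> * q x \<partial>\<mu>) = (\<integral>x. - (h x * q x) \<partial>\<mu>)"
      by (intro integral_cong_AE) (use sqint_meas[OF h] sqint_meas[OF q(1)] in auto)
    then show ?thesis using mean by simp
  next
    assume "AE x in \<mu>. hm x = 0"
    then have "AE x in \<mu>. \<bar>h x\<bar> * q x = h x * q x"
      by eventually_elim (simp add: hm_def max_def split: if_splits)
    then have "(\<integral>x. \<bar>h x\<bar> * q x \<partial>\<mu>) = (\<integral>x. h x * q x \<partial>\<mu>)"
      by (intro integral_cong_AE) (use sqint_meas[OF h] sqint_meas[OF q(1)] in auto)
    then show ?thesis using mean by simp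
  qed
  moreover have "AE x in \<mu>. 0 \<le> \<bar>h x\<bar> * q x" using q(2) by eventually_elim simp
  ultimately have "AE x in \<mu>. \<bar>h x\<bar> * q x = 0"
    using integral_nonneg_eq_0_iff_AE[OF sqint_mult[OF sqint_abs[OF h] q(1)]] by simp
  then show ?thesis using q(2) by eventually_elim simp
qed

text \<open>
  By compactness an orbit that does not tend to zero has a nonzero limit point \<open>h\<close>. Along the orbit the
  weighted norm decreases to some \<open>c\<close>, hence \<open>h\<close> and \<open>A h\<close> both have weighted norm \<open>c\<close>, and
  \<open>extremal_zero\<close> gives \<open>h = 0\<close>.
\<close>

lemma strong_convergence:
  assumes g: "sqint \<mu> g" and mean: "(\<integral>x. g x * q x \<partial>\<mu>) = 0"
  shows "(\<lambda>n. l2n \<mu> ((A ^^ n) g)) \<longlonglongrightarrow> 0"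
proof (rule ccontr)
  let ?N = "\<lambda>f. \<integral>x. \<bar>f x\<bar> * q x \<partial>\<mu>"
  define a where "a n = ?N ((A ^^ n) g)" for n
  obtain M where M: "M \<ge> 0" "\<And>n f. sqint \<mu> f \<Longrightarrow> l2n \<mu> ((A ^^ n) f) \<le> M * l2n \<mu> f"
    using power_bounded by blast
  assume "\<not> ?thesis"
  then obtain \<epsilon> where \<epsilon>: "\<epsilon> > 0" and "\<forall>N. \<exists>n\<ge>N. \<epsilon> \<le> l2n \<mu> ((A ^^ n) g)"
    unfolding LIMSEQ_iff by (auto simp: not_less)
  then have "\<exists>n. \<epsilon> \<le> l2n \<mu> ((A ^^ Suc n) g) \<and> N \<le> n" for N
    by (metis Suc_le_D Suc_le_mono)
  then obtain s where s: "\<And>k. \<epsilon> \<le> l2n \<mu> ((A ^^ Suc (s k)) g)" "\<And>k. k \<le> s k" by metis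
  obtain h r where h: "sqint \<mu> h" and r: "strict_mono r"
    and lim: "(\<lambda>n. l2n \<mu> (\<lambda>x. A ((A ^^ s (r n)) g) x - h x)) \<longlonglongrightarrow> 0"
    using compactness[of "\<lambda>k. (A ^^ s k) g" "M * l2n \<mu> g", OF sqAn[OF g] M(2)[OF g]]
    by (elim exE conjE) (rule that)
  define m where "m n = Suc (s (r n))" for n
  have lim: "(\<lambda>n. l2n \<mu> (\<lambda>x. (A ^^ m n) g x - h x)) \<longlonglongrightarrow> 0"
    using lim by (simp add: m_def)
  have m: "filterlim m at_top sequentially"
  proof (rule filterlim_at_top_mono[OF filterlim_ident], intro always_eventually allI)
    fix n show "n \<le> m n"
      using s(2)[of "r n"] seq_suble[OF r, of n] by (simp add: m_def)
  qed
  have "decseq a"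
    unfolding a_def by (intro decseq_SucI) (simp add: L1_contraction[OF sqAn[OF g]])
  moreover have "0 \<le> a n" for n
  proof -
    have "AE x in \<mu>. 0 \<le> \<bar>(A ^^ n) g x\<bar> * q x" using q(2) by eventually_elim simp
    then show ?thesis unfolding a_def by (rule integral_nonneg_AE)
  qed
  ultimately obtain l where l: "a \<longlonglongrightarrow> l"
    using decseq_convergent[of a 0] by blast
  have N_lim: "(\<lambda>n. ?N (f n)) \<longlonglongrightarrow> ?N f'"
    if "\<And>n. sqint \<mu> (f n)" "sqint \<mu> f'" "(\<lambda>n. l2n \<mu> (\<lambda>x. f n x - f' x)) \<longlonglongrightarrow> 0" for f :: "nat \<Rightarrow> 'a \<Rightarrow> real" and f'
  proof -
    have "(\<lambda>n. l2n \<mu> (\<lambda>x. f n x - f' x) * l2n \<mu> q) \<longlonglongrightarrow> 0"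
      using tendsto_mult_left_zero[OF that(3)] .
    then have "(\<lambda>n. ?N (f n) - ?N f') \<longlonglongrightarrow> 0"
      by (rule Lim_null_comparison[rotated]) (use L1_dist_le[OF that(1,2)] in simp)
    then show ?thesis by (simp add: LIM_zero_iff)
  qed
  have "(\<lambda>n. ?N ((A ^^ m n) g)) \<longlonglongrightarrow> ?N h"
    by (rule N_lim[OF sqAn[OF g] h lim])
  moreover have "(\<lambda>n. ?N ((A ^^ m n) g)) \<longlonglongrightarrow> l"
    using filterlim_compose[OF l m] by (simp add: a_def)
  ultimately have 1: "?N h = l" by (rule LIMSEQ_unique)
  have "(\<lambda>n. l2n \<mu> (\<lambda>x. A ((A ^^ m n) g) x - A h x)) \<longlonglongrightarrow> 0"
    by (rule pos_op_l2n_tendsto[OF A sqAn[OF g] h lim])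
  then have "(\<lambda>n. ?N (A ((A ^^ m n) g))) \<longlonglongrightarrow> ?N (A h)"
    by (rule N_lim[OF sqA[OF sqAn[OF g]] sqA[OF h]])
  moreover have "(\<lambda>n. ?N (A ((A ^^ m n) g))) \<longlonglongrightarrow> l"
    using filterlim_compose[OF LIMSEQ_Suc[OF l] m] by (simp add: a_def)
  ultimately have 2: "?N (A h) = l" by (rule LIMSEQ_unique)
  have "(\<lambda>n. l2n \<mu> (\<lambda>x. (A ^^ m n) g x - h x) * l2n \<mu> q) \<longlonglongrightarrow> 0"
    using tendsto_mult_left_zero[OF lim] .
  moreover have "\<bar>\<integral>x. h x * q x \<partial>\<mu>\<bar> \<le> l2n \<mu> (\<lambda>x. (A ^^ m n) g x - h x) * l2n \<mu> q" for n
  proof -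
    have "(\<integral>x. ((A ^^ m n) g x - h x) * q x \<partial>\<mu>) = - (\<integral>x. h x * q x \<partial>\<mu>)"
      using An_q[OF g, of "m n"] mean sqint_mult[OF sqAn[OF g] q(1), of "m n"] sqint_mult[OF h q(1)]
      by (simp add: left_diff_distrib)
    with l2n_Cauchy_Schwarz[OF sqint_diff[OF sqAn[OF g] h] q(1), of "m n"] show ?thesis by simp
  qed
  ultimately have "\<bar>\<integral>x. h x * q x \<partial>\<mu>\<bar> \<le> 0"
    by (intro LIMSEQ_le_const) auto
  then have "AE x in \<mu>. h x = 0"
    using extremal_zero[OF h] 1 2 by simp
  then have "l2n \<mu> h = 0" using l2n_eq_0[OF h] by simp
  have "\<epsilon> \<le> l2n \<mu> (\<lambda>x. (A ^^ m n) g x - h x)" for n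
    using s(1)[of "r n"] l2n_triangle_diff[OF sqAn[OF g, of "m n"] h] \<open>l2n \<mu> h = 0\<close>
    by (simp add: m_def)
  then have "\<epsilon> \<le> 0" by (intro LIMSEQ_le_const[OF lim]) auto
  with \<epsilon> show False by simp
qed

text \<open>
  Strong convergence of a bounded sequence of operators is uniform on relatively compact sets, in
  particular on the image of the unit ball under \<open>A\<close>.
\<close>

lemma uniform_convergence_mean_zero:
  assumes \<epsilon>: "\<epsilon> > 0"
  shows "\<exists>N. \<forall>n\<ge>N. \<forall>f. sqint \<mu> f \<longrightarrow> (\<integral>x. f x * q x \<partial>\<mu>) = 0 \<longrightarrow> l2n \<mu> ((A ^^ n) f) \<le> \<epsilon> * l2n \<mu> f"
proof (rule ccontr)
  obtain M where M: "M \<ge> 0" "\<And>n f. sqint \<mu> f \<Longrightarrow> l2n \<mu> ((A ^^ n) f) \<le> M * l2n \<mu> f"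
    using power_bounded by blast
  assume "\<not> ?thesis"
  then have not: "\<not> (\<forall>n\<ge>N. \<forall>f. sqint \<mu> f \<longrightarrow> (\<integral>x. f x * q x \<partial>\<mu>) = 0 \<longrightarrow> l2n \<mu> ((A ^^ n) f) \<le> \<epsilon> * l2n \<mu> f)" for N
    by blast
  have F: "\<exists>n f. k \<le> n \<and> sqint \<mu> f \<and> (\<integral>x. f x * q x \<partial>\<mu>) = 0 \<and> \<epsilon> * l2n \<mu> f < l2n \<mu> ((A ^^ Suc n) f)" for k
  proof -
    obtain n f where n: "Suc k \<le> n" and f: "sqint \<mu> f" "(\<integral>x. f x * q x \<partial>\<mu>) = 0" "\<epsilon> * l2n \<mu> f < l2n \<mu> ((A ^^ n) f)"
      using not[of "Suc k"] by (auto simp: not_le)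
    obtain m where "n = Suc m" using n by (cases n) auto
    then show ?thesis using n f by (intro exI[of _ m] exI[of _ f]) simp
  qed
  have "\<exists>n G. k \<le> n \<and> sqint \<mu> G \<and> l2n \<mu> G \<le> 1 \<and> (\<integral>x. G x * q x \<partial>\<mu>) = 0 \<and> \<epsilon> < l2n \<mu> ((A ^^ Suc n) G)" for k
  proof -
    obtain n f where f: "k \<le> n" "sqint \<mu> f" "(\<integral>x. f x * q x \<partial>\<mu>) = 0" "\<epsilon> * l2n \<mu> f < l2n \<mu> ((A ^^ Suc n) f)"
      using F by blast
    obtain a where a: "l2n \<mu> (\<lambda>x. a * f x) \<le> 1" "\<epsilon> < l2n \<mu> ((A ^^ Suc n) (\<lambda>x. a * f x))"
      using pos_op_normalize[OF An f(2,4)] by blast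
    have "(\<integral>x. a * f x * q x \<partial>\<mu>) = 0" using f(3) by (simp add: mult.assoc)
    then show ?thesis using a f(1) sqint_scale[OF f(2), of a] by blast
  qed
  then obtain s G where s: "\<And>k. k \<le> s k" and G: "\<And>k. sqint \<mu> (G k)" "\<And>k. l2n \<mu> (G k) \<le> 1"
    and G_mean: "\<And>k. (\<integral>x. G k x * q x \<partial>\<mu>) = 0" and G_big: "\<And>k. \<epsilon> < l2n \<mu> ((A ^^ Suc (s k)) (G k))"
    by metis
  obtain g r where g: "sqint \<mu> g" and r: "strict_mono r"
    and lim: "(\<lambda>n. l2n \<mu> (\<lambda>x. A (G (r n)) x - g x)) \<longlonglongrightarrow> 0"
    using compactness[of G 1, OF G] by (elim exE conjE) (rule that)
  have "(\<lambda>n. l2n \<mu> (\<lambda>x. A (G (r n)) x - g x) * l2n \<mu> q) \<longlonglongrightarrow> 0"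
    using tendsto_mult_left_zero[OF lim] .
  moreover have "\<bar>\<integral>x. g x * q x \<partial>\<mu>\<bar> \<le> l2n \<mu> (\<lambda>x. A (G (r n)) x - g x) * l2n \<mu> q" for n
  proof -
    have "(\<integral>x. (A (G (r n)) x - g x) * q x \<partial>\<mu>) = - (\<integral>x. g x * q x \<partial>\<mu>)"
      using q(3)[OF G(1), of "r n"] G_mean[of "r n"] sqint_mult[OF sqA[OF G(1)] q(1), of "r n"] sqint_mult[OF g q(1)]
      by (simp add: left_diff_distrib)
    with l2n_Cauchy_Schwarz[OF sqint_diff[OF sqA[OF G(1)] g] q(1), of "r n"] show ?thesis by simp
  qed
  ultimately have "\<bar>\<integral>x. g x * q x \<partial>\<mu>\<bar> \<le> 0"
    by (intro LIMSEQ_le_const) auto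
  then have g_lim: "(\<lambda>n. l2n \<mu> ((A ^^ n) g)) \<longlonglongrightarrow> 0"
    using strong_convergence[OF g] by simp
  have sr: "filterlim (\<lambda>n. s (r n)) at_top sequentially"
  proof (rule filterlim_at_top_mono[OF filterlim_ident], intro always_eventually allI)
    fix n show "n \<le> s (r n)"
      using s[of "r n"] seq_suble[OF r, of n] by simp
  qed
  have "\<epsilon> \<le> l2n \<mu> ((A ^^ s (r n)) g) + M * l2n \<mu> (\<lambda>x. A (G (r n)) x - g x)" for n
  proof -
    let ?T = "A ^^ s (r n)"
    have AG: "sqint \<mu> (A (G (r n)))" by (rule sqA[OF G(1)])
    have "\<epsilon> \<le> l2n \<mu> (?T (A (G (r n))))"
      using G_big[of "r n"] by (simp add: funpow_swap1)
    also have "\<dots> \<le> l2n \<mu> (?T g) + l2n \<mu> (\<lambda>x. ?T (A (G (r n))) x - ?T g x)"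
      by (intro l2n_triangle_diff sqAn AG g)
    also have "l2n \<mu> (\<lambda>x. ?T (A (G (r n))) x - ?T g x) = l2n \<mu> (?T (\<lambda>x. A (G (r n)) x - g x))"
      by (rule l2n_cong(2)[symmetric, OF sqint_meas[OF sqAn[OF sqint_diff[OF AG g]]]
            sqint_diff[OF sqAn[OF AG] sqAn[OF g]] pos_op_diff[OF An AG g]])
    also have "\<dots> \<le> M * l2n \<mu> (\<lambda>x. A (G (r n)) x - g x)"
      by (rule M(2)[OF sqint_diff[OF AG g]])
    finally show ?thesis by simp
  qed
  moreover have "(\<lambda>n. l2n \<mu> ((A ^^ s (r n)) g) + M * l2n \<mu> (\<lambda>x. A (G (r n)) x - g x)) \<longlonglongrightarrow> 0 + M * 0"
    by (intro tendsto_intros lim filterlim_compose[OF g_lim sr])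
  ultimately have "\<epsilon> \<le> 0 + M * 0"
    by (intro LIMSEQ_le_const) auto
  with \<epsilon> show False by simp
qed

text \<open>
  Subtracting the projection \<open>P f = (\<integral> f q / \<integral> p q) p\<close> reduces to functions of mean zero, because every power of
  \<open>A\<close> fixes \<open>P f\<close>.
\<close>

theorem uniform_convergence:
  assumes \<epsilon>: "\<epsilon> > 0"
  shows "\<exists>N. \<forall>n\<ge>N. \<forall>f. sqint \<mu> f \<longrightarrow>
    l2n \<mu> (\<lambda>x. (A ^^ n) f x - (\<integral>x. f x * q x \<partial>\<mu>) / (\<integral>x. p x * q x \<partial>\<mu>) * p x) \<le> \<epsilon> * l2n \<mu> f"
proof -
  define \<gamma> where "\<gamma> = (\<integral>x. p x * q x \<partial>\<mu>)"
  have \<gamma>: "\<gamma> > 0" using pq by (simp add: \<gamma>_def)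
  define L where "L = 1 + l2n \<mu> q / \<gamma> * l2n \<mu> p"
  have L: "L > 0" using \<gamma> unfolding L_def by (intro add_pos_nonneg mult_nonneg_nonneg divide_nonneg_pos) simp_all
  obtain N where N: "\<And>n f. n \<ge> N \<Longrightarrow> sqint \<mu> f \<Longrightarrow> (\<integral>x. f x * q x \<partial>\<mu>) = 0 \<Longrightarrow>
      l2n \<mu> ((A ^^ n) f) \<le> \<epsilon> / L * l2n \<mu> f"
    using uniform_convergence_mean_zero[of "\<epsilon> / L"] \<epsilon> L by auto
  have "l2n \<mu> (\<lambda>x. (A ^^ n) f x - (\<integral>x. f x * q x \<partial>\<mu>) / \<gamma> * p x) \<le> \<epsilon> * l2n \<mu> f"
    if n: "n \<ge> N" and f: "sqint \<mu> f" for n f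
  proof -
    let ?c = "(\<integral>x. f x * q x \<partial>\<mu>) / \<gamma>"
    define D where "D = (\<lambda>x. f x - ?c * p x)"
    have D: "sqint \<mu> D" unfolding D_def by (intro sqint_diff f sqint_scale p)
    have "(\<integral>x. D x * q x \<partial>\<mu>) = (\<integral>x. f x * q x - ?c * (p x * q x) \<partial>\<mu>)"
      by (simp add: D_def algebra_simps)
    also have "\<dots> = (\<integral>x. f x * q x \<partial>\<mu>) - ?c * \<gamma>"
      using sqint_mult[OF f q(1)] sqint_mult[OF p(1) q(1)] by (simp add: \<gamma>_def)
    finally have mean: "(\<integral>x. D x * q x \<partial>\<mu>) = 0" using \<gamma> by simp
    have "l2n \<mu> D \<le> l2n \<mu> f + l2n \<mu> (\<lambda>x. - ?c * p x)"
      using l2n_lin[OF f sqint_scale[OF p(1)], of "- ?c"] by (simp add: D_def)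
    also have "l2n \<mu> (\<lambda>x. - ?c * p x) = \<bar>?c\<bar> * l2n \<mu> p"
      by (subst l2n_scale) simp
    also have "\<bar>?c\<bar> * l2n \<mu> p \<le> l2n \<mu> f * l2n \<mu> q / \<gamma> * l2n \<mu> p"
      using l2n_Cauchy_Schwarz[OF f q(1)] \<gamma>
      by (intro mult_right_mono) (auto simp: abs_div divide_right_mono)
    finally have bound: "l2n \<mu> D \<le> L * l2n \<mu> f" by (simp add: L_def algebra_simps)
    have "l2n \<mu> (\<lambda>x. (A ^^ n) f x - ?c * p x) = l2n \<mu> ((A ^^ n) D)"
    proof (rule l2n_cong(2)[symmetric])
      show "(A ^^ n) D \<in> borel_measurable \<mu>" by (rule sqint_meas[OF sqAn[OF D]])
      show "sqint \<mu> (\<lambda>x. (A ^^ n) f x - ?c * p x)" by (intro sqint_diff sqAn f sqint_scale p)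
      show "AE x in \<mu>. (A ^^ n) D x = (A ^^ n) f x - ?c * p x"
        using pos_op_lin[OF An f p(1), of n 1 "- ?c"] An_p[of n] unfolding D_def
        by eventually_elim simp
    qed
    also have "\<dots> \<le> \<epsilon> / L * l2n \<mu> D" by (rule N[OF n D mean])
    also have "\<dots> \<le> \<epsilon> / L * (L * l2n \<mu> f)" using bound \<epsilon> L by (intro mult_left_mono) simp_all
    also have "\<dots> = \<epsilon> * l2n \<mu> f" using L by simp
    finally show ?thesis .
  qed
  then show ?thesis unfolding \<gamma>_def by blast
qed

end

section \<open>Semigroups of positive operators: boundedness near time zero and eigenfunctions of the generator\<close>

lemma pos_op_smult:
  assumes T: "pos_op \<mu> T" and c: "0 \<le> c"
  shows "pos_op \<mu> (\<lambda>f x. c * T f x)"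
  unfolding pos_op_def
proof (intro conjI allI impI)
  fix f assume f: "sqint \<mu> f"
  show "sqint \<mu> (\<lambda>x. c * T f x)" by (intro sqint_scale pos_op_sqint[OF T] f)
  assume "AE x in \<mu>. 0 \<le> f x"
  from pos_op_pos[OF T f this] show "AE x in \<mu>. 0 \<le> c * T f x"
    by eventually_elim (simp add: c)
next
  fix f g and a b :: real assume f: "sqint \<mu> f" and g: "sqint \<mu> g"
  show "AE x in \<mu>. c * T (\<lambda>x. a * f x + b * g x) x = a * (c * T f x) + b * (c * T g x)"
    using pos_op_lin[OF T f g, of a b] by eventually_elim (simp add: algebra_simps)
next
  obtain M where M: "M \<ge> 0" "\<And>f. sqint \<mu> f \<Longrightarrow> l2n \<mu> (T f) \<le> M * l2n \<mu> f"
    using pos_op_bound[OF T] by blast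
  have "l2n \<mu> (\<lambda>x. c * T f x) \<le> (c * M) * l2n \<mu> f" if f: "sqint \<mu> f" for f
    using mult_left_mono[OF M(2)[OF f] c] c by (subst l2n_scale) simp
  then show "\<exists>M. \<forall>f. sqint \<mu> f \<longrightarrow> l2n \<mu> (\<lambda>x. c * T f x) \<le> M * l2n \<mu> f" by blast
qed

text \<open>
  The function \<open>H = sqrt (\<Sum>n. 2\<^sup>-\<^sup>n G\<^sub>n\<^sup>2)\<close> is square integrable, because \<open>\<integral> H\<^sup>2\<close> is the sum of the integrals
  \<open>2\<^sup>-\<^sup>n \<integral> G\<^sub>n\<^sup>2\<close> by monotone convergence.
\<close>

lemma sqint_dominating:
  assumes G: "\<And>n::nat. sqint \<mu> (G n)" "\<And>n. l2n \<mu> (G n) \<le> 1"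
  shows "\<exists>H. sqint \<mu> H \<and> (\<forall>n. AE x in \<mu>. \<bar>G n x\<bar> \<le> 2 ^ n * H x)"
proof -
  \<comment> \<open>Summing in the extended reals postpones the question of convergence.\<close>
  define E where "E x = (\<Sum>n. ennreal ((1/2) ^ n * (G n x)\<^sup>2))" for x
  have [measurable]: "G n \<in> borel_measurable \<mu>" for n by (rule sqint_meas[OF G(1)])
  have E_meas [measurable]: "E \<in> borel_measurable \<mu>" unfolding E_def[abs_def] by measurable
  have "(\<integral>\<^sup>+x. E x \<partial>\<mu>) = (\<Sum>n. \<integral>\<^sup>+x. ennreal ((1/2) ^ n * (G n x)\<^sup>2) \<partial>\<mu>)"
    unfolding E_def by (intro nn_integral_suminf) measurable
  also have "\<dots> \<le> (\<Sum>n. ennreal ((1/2) ^ n))"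
  proof (intro suminf_le summableI)
    fix n
    have "(\<integral>\<^sup>+x. ennreal ((1/2) ^ n * (G n x)\<^sup>2) \<partial>\<mu>) = ennreal (\<integral>x. (1/2) ^ n * (G n x)\<^sup>2 \<partial>\<mu>)"
      using sqint_sq[OF G(1)[of n]] by (intro nn_integral_eq_integral) auto
    also have "(\<integral>x. (1/2) ^ n * (G n x)\<^sup>2 \<partial>\<mu>) = (1/2) ^ n * (l2n \<mu> (G n))\<^sup>2"
      by (simp add: l2n_sq)
    also have "\<dots> \<le> (1/2) ^ n"
      using G(2)[of n] power_le_one[of "l2n \<mu> (G n)" 2] by (simp add: mult_left_le)
    finally show "(\<integral>\<^sup>+x. ennreal ((1/2) ^ n * (G n x)\<^sup>2) \<partial>\<mu>) \<le> ennreal ((1/2) ^ n)"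
      by (simp add: ennreal_leI)
  qed
  also have "\<dots> = ennreal (\<Sum>n. (1/2) ^ n)"
    by (intro suminf_ennreal2) (auto intro: summable_geometric)
  finally have fin: "(\<integral>\<^sup>+x. E x \<partial>\<mu>) < \<infinity>" by (simp add: le_less_trans)
  then have ae: "AE x in \<mu>. E x \<noteq> \<infinity>"
    by (intro nn_integral_noteq_infinite) auto
  define H where "H x = sqrt (enn2real (E x))" for x
  have "integrable \<mu> (\<lambda>x. enn2real (E x))"
  proof (rule integrableI_nonneg)
    have "(\<integral>\<^sup>+x. ennreal (enn2real (E x)) \<partial>\<mu>) \<le> (\<integral>\<^sup>+x. E x \<partial>\<mu>)"
      by (intro nn_integral_mono ennreal_enn2real_if[THEN eq_refl, THEN order_trans]) simp
    then show "(\<integral>\<^sup>+x. ennreal (enn2real (E x)) \<partial>\<mu>) < \<infinity>" using fin by simp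
  qed (use E_meas in auto)
  then have "sqint \<mu> H" unfolding sqint_def H_def by simp
  moreover have "AE x in \<mu>. \<bar>G n x\<bar> \<le> 2 ^ n * H x" for n
    using ae
  proof eventually_elim
    case (elim x)
    have "ennreal ((1/2) ^ n * (G n x)\<^sup>2) \<le> E x"
    proof -
      let ?e = "\<lambda>n. ennreal ((1/2) ^ n * (G n x)\<^sup>2)"
      have "sum ?e {n} \<le> suminf ?e" by (rule sum_le_suminf) auto
      then show ?thesis by (simp add: E_def)
    qed
    then have "(1/2) ^ n * (G n x)\<^sup>2 \<le> enn2real (E x)"
      using enn2real_mono[of "ennreal ((1/2) ^ n * (G n x)\<^sup>2)" "E x"] elim
      by (simp add: less_top[symmetric])
    then have "(1/2) ^ n * (G n x)\<^sup>2 \<le> (H x)\<^sup>2" by (simp add: H_def)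
    then have "(G n x)\<^sup>2 \<le> 2 ^ n * (H x)\<^sup>2" by (simp add: field_simps)
    also have "\<dots> \<le> (2 ^ n)\<^sup>2 * (H x)\<^sup>2"
      by (intro mult_right_mono self_le_power) auto
    finally have "\<bar>G n x\<bar> \<le> \<bar>2 ^ n * H x\<bar>"
      by (simp add: abs_le_square_iff power_mult_distrib)
    also have "\<dots> = 2 ^ n * H x" by (simp add: H_def)
    finally show ?case .
  qed
  ultimately show ?thesis by blast
qed

text \<open>
  A substitute for the uniform boundedness principle that exploits positivity. If the norms were
  unbounded near zero, there would be times \<open>\<tau>\<^sub>n \<rightarrow> 0\<close> and \<open>G\<^sub>n\<close> in the unit ball with
  \<open>\<parallel>S G\<^sub>n\<parallel> > 4\<^sup>n\<close> at time \<open>\<tau>\<^sub>n\<close>. A single function \<open>H\<close> with \<open>\<bar>G\<^sub>n\<bar> \<le> 2\<^sup>n H\<close> then has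
  \<open>\<parallel>S H\<parallel> \<ge> 2\<^sup>n\<close> at time \<open>\<tau>\<^sub>n\<close>, contradicting strong continuity at \<open>H\<close>.
\<close>

lemma bounded_near_0:
  fixes S :: "real \<Rightarrow> ('a \<Rightarrow> real) \<Rightarrow> 'a \<Rightarrow> real"
  assumes S: "\<And>t. t > 0 \<Longrightarrow> pos_op \<mu> (S t)"
    and sc: "\<And>f. sqint \<mu> f \<Longrightarrow> ((\<lambda>t. l2n \<mu> (\<lambda>x. S t f x - f x)) \<longlongrightarrow> 0) (at_right 0)"
  shows "\<exists>M \<delta>. 0 < \<delta> \<and> (\<forall>t f. 0 < t \<longrightarrow> t < \<delta> \<longrightarrow> sqint \<mu> f \<longrightarrow> l2n \<mu> (S t f) \<le> M * l2n \<mu> f)"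
proof (rule ccontr)
  assume "\<not> ?thesis"
  then have H: "\<not> (\<forall>t f. 0 < t \<longrightarrow> t < 1 / real (Suc n) \<longrightarrow> sqint \<mu> f \<longrightarrow> l2n \<mu> (S t f) \<le> 4 ^ n * l2n \<mu> f)" for n
    using zero_less_divide_1_iff[of "real (Suc n)"] of_nat_0_less_iff[of "Suc n"] by blast
  have "\<exists>t f. 0 < t \<and> t < 1 / real (Suc n) \<and> sqint \<mu> f \<and> 4 ^ n * l2n \<mu> f < l2n \<mu> (S t f)" for n
    using H[of n] by (simp add: not_le)
  then have F: "\<exists>t f. 0 < t \<and> t < 1 / real (Suc n) \<and> sqint \<mu> f \<and> 4 ^ n * l2n \<mu> f < l2n \<mu> (S t f)" for n .
  have "\<exists>t G. 0 < t \<and> t < 1 / real (Suc n) \<and> sqint \<mu> G \<and> l2n \<mu> G \<le> 1 \<and> 4 ^ n < l2n \<mu> (S t G)" for n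
  proof -
    obtain t f where f: "0 < t" "t < 1 / real (Suc n)" "sqint \<mu> f" "4 ^ n * l2n \<mu> f < l2n \<mu> (S t f)"
      using F by blast
    show ?thesis using pos_op_normalize[OF S[OF f(1)] f(3,4)] f(1,2) sqint_scale[OF f(3)] by blast
  qed
  then obtain \<tau> G where \<tau>: "\<And>n. 0 < \<tau> n" "\<And>n. \<tau> n < 1 / real (Suc n)"
    and G: "\<And>n. sqint \<mu> (G n)" "\<And>n. l2n \<mu> (G n) \<le> 1" and SG: "\<And>n. 4 ^ n < l2n \<mu> (S (\<tau> n) (G n))"
    by metis
  obtain H where H: "sqint \<mu> H" and GH: "\<And>n. AE x in \<mu>. \<bar>G n x\<bar> \<le> 2 ^ n * H x"
    using sqint_dominating[of \<mu> G, OF G] by blast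
  have large: "2 ^ n \<le> l2n \<mu> (S (\<tau> n) H)" for n
  proof -
    note T = S[OF \<tau>(1), of n]
    have "AE x in \<mu>. \<bar>S (\<tau> n) (G n) x\<bar> \<le> S (\<tau> n) (\<lambda>x. 2 ^ n * H x) x"
      by (rule pos_op_abs_le[OF T G(1) sqint_scale[OF H] GH])
    with pos_op_scale[OF T H, of "2 ^ n"]
    have "AE x in \<mu>. \<bar>S (\<tau> n) (G n) x\<bar> \<le> \<bar>2 ^ n * S (\<tau> n) H x\<bar>"
      by eventually_elim linarith
    then have "l2n \<mu> (S (\<tau> n) (G n)) \<le> l2n \<mu> (\<lambda>x. 2 ^ n * S (\<tau> n) H x)"
      by (intro l2n_mono(2) sqint_meas[OF pos_op_sqint[OF T G(1)]] sqint_scale pos_op_sqint[OF T H])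
    also have "\<dots> = 2 ^ n * l2n \<mu> (S (\<tau> n) H)" by (subst l2n_scale) simp
    finally have "(2 ^ n :: real) * 2 ^ n \<le> 2 ^ n * l2n \<mu> (S (\<tau> n) H)"
      using SG[of n] by (simp add: power_mult_distrib[symmetric])
    then show ?thesis by simp
  qed
  have "\<tau> \<longlonglongrightarrow> 0"
  proof (rule tendsto_sandwich[OF _ _ tendsto_const LIMSEQ_inverse_real_of_nat])
    show "\<forall>\<^sub>F n in sequentially. 0 \<le> \<tau> n" using \<tau>(1) by (simp add: less_imp_le)
    show "\<forall>\<^sub>F n in sequentially. \<tau> n \<le> inverse (real (Suc n))"
      using \<tau>(2) by (intro always_eventually allI) (simp add: less_imp_le inverse_eq_divide)
  qed
  then have "filterlim \<tau> (at_right 0) sequentially"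
    using \<tau>(1) by (auto simp: filterlim_at order_less_imp_not_eq2)
  from filterlim_compose[OF sc[OF H] this]
  have "(\<lambda>n. l2n \<mu> (\<lambda>x. S (\<tau> n) H x - H x)) \<longlonglongrightarrow> 0" .
  then have "\<forall>\<^sub>F n in sequentially. l2n \<mu> (\<lambda>x. S (\<tau> n) H x - H x) < 1"
    by (rule order_tendstoD) simp
  moreover have "\<forall>\<^sub>F n in sequentially. l2n \<mu> H + 1 < 2 ^ n"
  proof -
    obtain N where N: "l2n \<mu> H + 1 < 2 ^ N" using real_arch_pow[of 2 "l2n \<mu> H + 1"] by auto
    have "l2n \<mu> H + 1 < 2 ^ n" if "n \<ge> N" for n
      by (rule less_le_trans[OF N]) (use that in \<open>simp add: power_increasing\<close>)
    then show ?thesis by (auto simp: eventually_sequentially)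
  qed
  ultimately have "\<forall>\<^sub>F n in sequentially. False"
  proof eventually_elim
    case (elim n)
    then show ?case
      using large[of n] l2n_triangle_diff[OF pos_op_sqint[OF S[OF \<tau>(1)] H] H, of n] by linarith
  qed
  then show False by simp
qed

lemma bounded_on_bounded_times:
  fixes S :: "real \<Rightarrow> ('a \<Rightarrow> real) \<Rightarrow> 'a \<Rightarrow> real"
  assumes S: "\<And>t. t > 0 \<Longrightarrow> pos_op \<mu> (S t)"
    and semigroup: "\<And>s t f. s > 0 \<Longrightarrow> t > 0 \<Longrightarrow> sqint \<mu> f \<Longrightarrow> AE x in \<mu>. S (s + t) f x = S s (S t f) x"
    and \<delta>: "0 < \<delta>"
    and bound: "\<And>t f. 0 < t \<Longrightarrow> t < \<delta> \<Longrightarrow> sqint \<mu> f \<Longrightarrow> l2n \<mu> (S t f) \<le> M * l2n \<mu> f"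
  shows "\<exists>L\<ge>1. \<forall>t f. 0 < t \<longrightarrow> t \<le> T \<longrightarrow> sqint \<mu> f \<longrightarrow> l2n \<mu> (S t f) \<le> L * l2n \<mu> f"
proof -
  define M1 where "M1 = max M 1"
  have M1: "M1 \<ge> 1" by (simp add: M1_def)
  have bound1: "l2n \<mu> (S t f) \<le> M1 * l2n \<mu> f" if "0 < t" "t < \<delta>" "sqint \<mu> f" for t f
    using bound[OF that] mult_right_mono[of M M1 "l2n \<mu> f"] by (simp add: M1_def)
  have main: "l2n \<mu> (S t f) \<le> M1 ^ Suc n * l2n \<mu> f" if "0 < t" "t \<le> n * (\<delta> / 2)" "sqint \<mu> f" for n t f
    using that
  proof (induction n arbitrary: t f)
    case 0 then show ?case by simp
  next
    case (Suc n)
    show ?case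
    proof (cases "t < \<delta>")
      case True
      have "M1 * l2n \<mu> f \<le> M1 ^ Suc (Suc n) * l2n \<mu> f"
        using M1 by (intro mult_right_mono self_le_power) auto
      with bound1[OF Suc.prems(1) True Suc.prems(3)] show ?thesis by simp
    next
      case False
      have h: "0 < \<delta> / 2" "\<delta> / 2 < \<delta>" "0 < t - \<delta> / 2" "t - \<delta> / 2 \<le> n * (\<delta> / 2)"
        using False \<delta> Suc.prems(1,2) by (auto simp: algebra_simps)
      have f: "sqint \<mu> f" by fact
      have Sf: "sqint \<mu> (S (t - \<delta> / 2) f)" by (rule pos_op_sqint[OF S[OF h(3)] f])
      have "l2n \<mu> (S t f) = l2n \<mu> (S (\<delta> / 2) (S (t - \<delta> / 2) f))"
        by (rule l2n_cong(2)[OF sqint_meas[OF pos_op_sqint[OF S[OF Suc.prems(1)] f]] pos_op_sqint[OF S[OF h(1)] Sf]])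
          (use semigroup[OF h(1,3) f] in simp)
      also have "\<dots> \<le> M1 * l2n \<mu> (S (t - \<delta> / 2) f)" by (rule bound1[OF h(1,2) Sf])
      also have "\<dots> \<le> M1 * (M1 ^ Suc n * l2n \<mu> f)"
        using M1 by (intro mult_left_mono Suc.IH[OF h(3,4) f]) auto
      finally show ?thesis by simp
    qed
  qed
  obtain n :: nat where n: "T / (\<delta> / 2) \<le> n" using real_arch_simple by blast
  have n': "T \<le> n * (\<delta> / 2)" using n \<delta> by (simp add: field_simps)
  show ?thesis
  proof (intro exI[of _ "M1 ^ Suc n"] conjI allI impI)
    show "1 \<le> M1 ^ Suc n" by (rule one_le_power[OF M1])
    show "l2n \<mu> (S t f) \<le> M1 ^ Suc n * l2n \<mu> f" if "0 < t" "t \<le> T" "sqint \<mu> f" for t f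
      by (rule main) (use that n' in auto)
  qed
qed

text \<open>
  Divide \<open>[0, t]\<close> into \<open>n\<close> steps of length \<open>h\<close>. Each step moves \<open>f\<close> by at most \<open>\<epsilon> h\<close>, and by the bound \<open>L\<close> on
  the operator norms the telescoping sum is at most \<open>L \<epsilon> t\<close>. Resting on boundedness near zero, which adjoints inherit,
  the argument applies to the semigroup and to its adjoint alike.
\<close>

lemma fixed_of_small_o:
  fixes S :: "real \<Rightarrow> ('a \<Rightarrow> real) \<Rightarrow> 'a \<Rightarrow> real"
  assumes S: "\<And>t. t > 0 \<Longrightarrow> pos_op \<mu> (S t)"
    and semigroup: "\<And>s t f. s > 0 \<Longrightarrow> t > 0 \<Longrightarrow> sqint \<mu> f \<Longrightarrow> AE x in \<mu>. S (s + t) f x = S s (S t f) x"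
    and \<delta>: "0 < \<delta>"
    and bound: "\<And>t f. 0 < t \<Longrightarrow> t < \<delta> \<Longrightarrow> sqint \<mu> f \<Longrightarrow> l2n \<mu> (S t f) \<le> M * l2n \<mu> f"
    and f: "sqint \<mu> f"
    and deriv: "((\<lambda>h. l2n \<mu> (\<lambda>x. S h f x - f x) / h) \<longlongrightarrow> 0) (at_right 0)"
    and t: "t > 0"
  shows "AE x in \<mu>. S t f x = f x"
proof -
  obtain L where L: "L \<ge> 1" and Lb: "\<And>s g. 0 < s \<Longrightarrow> s \<le> t \<Longrightarrow> sqint \<mu> g \<Longrightarrow> l2n \<mu> (S s g) \<le> L * l2n \<mu> g"
    using bounded_on_bounded_times[where S=S and T=t, OF S semigroup \<delta> bound] by blast
  have Sf: "sqint \<mu> (S s f)" if "s > 0" for s by (rule pos_op_sqint[OF S[OF that] f])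
  have d: "sqint \<mu> (\<lambda>x. S s f x - f x)" if "s > 0" for s by (intro sqint_diff Sf that f)
  have est: "l2n \<mu> (\<lambda>x. S t f x - f x) \<le> L * \<epsilon> * t" if \<epsilon>: "\<epsilon> > 0" for \<epsilon>
  proof -
    have "\<forall>\<^sub>F h in at_right 0. l2n \<mu> (\<lambda>x. S h f x - f x) / h < \<epsilon>"
      using deriv \<epsilon> by (rule order_tendstoD)
    then obtain b where b: "b > 0" "\<And>h. 0 < h \<Longrightarrow> h < b \<Longrightarrow> l2n \<mu> (\<lambda>x. S h f x - f x) / h < \<epsilon>"
      by (auto simp: eventually_at_right_field)
    obtain n :: nat where n: "t / b < n" using reals_Archimedean2 by blast
    have n0: "n > 0" using n t b(1) by (metis divide_pos_pos less_trans of_nat_0_less_iff)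
    define h where "h = t / n"
    have h: "0 < h" "h < b" "n * h = t"
      using t b(1) n n0 by (auto simp: h_def field_simps)
    have step: "l2n \<mu> (\<lambda>x. S h f x - f x) \<le> \<epsilon> * h"
      using b(2)[OF h(1,2)] h(1) by (simp add: field_simps)
    have "l2n \<mu> (\<lambda>x. S (Suc k * h) f x - f x) \<le> Suc k * (L * \<epsilon> * h)" if "Suc k \<le> n" for k
      using that
    proof (induction k)
      case 0
      have "\<epsilon> * h \<le> L * (\<epsilon> * h)" using L \<epsilon> h(1) mult_right_mono[OF L, of "\<epsilon> * h"] by simp
      with step show ?case by (simp add: mult.assoc)
    next
      case (Suc k)
      let ?s = "Suc k * h"
      have s0: "0 < ?s" by (rule mult_pos_pos) (simp_all add: h(1) del: of_nat_Suc)
      have "?s \<le> n * h" using h(1) Suc.prems by (intro mult_right_mono) simp_all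
      then have s: "0 < ?s" "?s \<le> t" using s0 unfolding h(3) by blast+
      have "Suc (Suc k) * h = ?s + h" by (simp add: algebra_simps)
      then have "AE x in \<mu>. S (Suc (Suc k) * h) f x = S ?s (S h f) x"
        using semigroup[OF s(1) h(1) f] by simp
      with pos_op_diff[OF S[OF s(1)] Sf[OF h(1)] f]
      have "AE x in \<mu>. S (Suc (Suc k) * h) f x - f x = S ?s (\<lambda>x. S h f x - f x) x + (S ?s f x - f x)"
        by eventually_elim simp
      then have "l2n \<mu> (\<lambda>x. S (Suc (Suc k) * h) f x - f x)
          = l2n \<mu> (\<lambda>x. S ?s (\<lambda>x. S h f x - f x) x + (S ?s f x - f x))"
        using h(1) s(1)
        by (intro l2n_cong(2) sqint_meas[OF d] sqint_add d pos_op_sqint[OF S]) auto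
      also have "\<dots> \<le> l2n \<mu> (S ?s (\<lambda>x. S h f x - f x)) + l2n \<mu> (\<lambda>x. S ?s f x - f x)"
        using h(1) s(1) by (intro l2n_lin d pos_op_sqint[OF S]) auto
      also have "l2n \<mu> (S ?s (\<lambda>x. S h f x - f x)) \<le> L * (\<epsilon> * h)"
        using Lb[OF s d[OF h(1)]] mult_left_mono[OF step, of L] L by linarith
      also have "l2n \<mu> (\<lambda>x. S ?s f x - f x) \<le> Suc k * (L * \<epsilon> * h)"
        using Suc by simp
      finally show ?case by (simp add: algebra_simps)
    qed
    from this[of "n - 1"] n0 h(3) show ?thesis by (simp add: algebra_simps)
  qed
  have "l2n \<mu> (\<lambda>x. S t f x - f x) \<le> 0 + e" if e: "e > 0" for e
    using est[of "e / (L * t)"] e L t by (simp add: field_simps)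
  then have "l2n \<mu> (\<lambda>x. S t f x - f x) \<le> 0"
    by (rule field_le_epsilon)
  then have "l2n \<mu> (\<lambda>x. S t f x - f x) = 0" using l2n_nonneg by (rule order_antisym)
  then show ?thesis using l2n_eq_0[OF d[OF t]] by simp
qed

text \<open>
  For the rescaled semigroup \<open>exp (l t) S\<^sub>t\<close> the eigenvalue equation says that \<open>f\<close> moves by \<open>o(h)\<close> in time
  \<open>h\<close>.
\<close>

lemma generator_eigenfunction:
  fixes S :: "real \<Rightarrow> ('a \<Rightarrow> real) \<Rightarrow> 'a \<Rightarrow> real"
  assumes S: "\<And>t. t > 0 \<Longrightarrow> pos_op \<mu> (S t)"
    and semigroup: "\<And>s t f. s > 0 \<Longrightarrow> t > 0 \<Longrightarrow> sqint \<mu> f \<Longrightarrow> AE x in \<mu>. S (s + t) f x = S s (S t f) x"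
    and \<delta>: "0 < \<delta>"
    and bound: "\<And>t f. 0 < t \<Longrightarrow> t < \<delta> \<Longrightarrow> sqint \<mu> f \<Longrightarrow> l2n \<mu> (S t f) \<le> M * l2n \<mu> f"
    and f: "sqint \<mu> f"
    and deriv: "((\<lambda>h. l2n \<mu> (\<lambda>x. (S h f x - f x) / h + l * f x)) \<longlongrightarrow> 0) (at_right 0)"
    and t: "t > 0"
  shows "AE x in \<mu>. S t f x = exp (- l * t) * f x"
proof -
  let ?V = "\<lambda>t f x. exp (l * t) * S t f x"
  have V: "pos_op \<mu> (?V t)" if "t > 0" for t by (intro pos_op_smult S that) simp
  have "AE x in \<mu>. ?V t f x = f x"
  proof (rule fixed_of_small_o[where S="?V" and M="exp (\<bar>l\<bar> * \<delta>) * \<bar>M\<bar>", OF V _ \<delta> _ f _ t])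
    fix s t g assume s: "s > (0::real)" and t: "t > (0::real)" and g: "sqint \<mu> g"
    show "AE x in \<mu>. ?V (s + t) g x = ?V s (?V t g) x"
      using semigroup[OF s t g] pos_op_scale[OF S[OF s] pos_op_sqint[OF S[OF t] g], of "exp (l * t)"]
      by eventually_elim (simp add: distrib_left exp_add)
  next
    fix t g assume t: "0 < t" "t < \<delta>" and g: "sqint \<mu> g"
    have "l2n \<mu> (?V t g) = exp (l * t) * l2n \<mu> (S t g)" by (subst l2n_scale) simp
    also have "\<dots> \<le> exp (\<bar>l\<bar> * \<delta>) * (\<bar>M\<bar> * l2n \<mu> g)"
    proof (intro mult_mono)
      have "l * t \<le> \<bar>l\<bar> * \<delta>" using t by (intro mult_mono) auto
      then show "exp (l * t) \<le> exp (\<bar>l\<bar> * \<delta>)" by simp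
      show "l2n \<mu> (S t g) \<le> \<bar>M\<bar> * l2n \<mu> g"
        using bound[OF t g] mult_right_mono[OF abs_ge_self[of M] l2n_nonneg[of \<mu> g]] by linarith
    qed auto
    finally show "l2n \<mu> (?V t g) \<le> exp (\<bar>l\<bar> * \<delta>) * \<bar>M\<bar> * l2n \<mu> g" by simp
  next
    let ?g = "\<lambda>h. exp (l * h) * (1 - h * l)"
    let ?b = "\<lambda>h. exp (l * h) * l2n \<mu> (\<lambda>x. (S h f x - f x) / h + l * f x) + \<bar>(?g h - 1) / h\<bar> * l2n \<mu> f"
    have "(?g has_real_derivative 0) (at 0)"
      by (auto intro!: derivative_eq_intros)
    then have "((\<lambda>h. (?g h - 1) / h) \<longlongrightarrow> 0) (at 0)"
      by (simp add: DERIV_def)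
    then have g: "((\<lambda>h. (?g h - 1) / h) \<longlongrightarrow> 0) (at_right 0)"
      by (rule filterlim_mono) (auto simp: at_le)
    have lim: "(?b \<longlongrightarrow> exp (l * 0) * 0 + \<bar>0\<bar> * l2n \<mu> f) (at_right 0)"
      by (intro tendsto_intros deriv g)
    have le: "\<forall>\<^sub>F h in at_right 0. l2n \<mu> (\<lambda>x. ?V h f x - f x) / h \<le> ?b h"
      using eventually_at_right_less[of "0::real"]
    proof eventually_elim
      case (elim h)
      let ?D = "\<lambda>x. (S h f x - f x) / h + l * f x"
      have Sf: "sqint \<mu> (S h f)" by (rule pos_op_sqint[OF S[OF elim] f])
      have D: "sqint \<mu> ?D"
        using sqint_lin[OF Sf f, of "1/h" "l - 1/h"] by (simp add: algebra_simps diff_divide_distrib)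
      have "(\<lambda>x. ?V h f x - f x) = (\<lambda>x. (h * exp (l * h)) * ?D x + (?g h - 1) * f x)"
        using elim by (simp add: fun_eq_iff field_simps)
      then have "l2n \<mu> (\<lambda>x. ?V h f x - f x) \<le> l2n \<mu> (\<lambda>x. (h * exp (l * h)) * ?D x) + l2n \<mu> (\<lambda>x. (?g h - 1) * f x)"
        using l2n_lin[OF sqint_scale[OF D] sqint_scale[OF f]] by simp
      also have "\<dots> = h * ?b h"
        using elim by (subst (1 2) l2n_scale) (simp add: abs_mult abs_divide distrib_left)
      finally show ?case using elim by (simp add: pos_divide_le_eq mult.commute)
    qed
    have ge: "\<forall>\<^sub>F h in at_right 0. 0 \<le> l2n \<mu> (\<lambda>x. ?V h f x - f x) / h"
      using eventually_at_right_less[of "0::real"] by eventually_elim simp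
    have "(?b \<longlongrightarrow> 0) (at_right 0)" using lim by simp
    then show "((\<lambda>h. l2n \<mu> (\<lambda>x. ?V h f x - f x) / h) \<longlongrightarrow> 0) (at_right 0)"
      by (rule tendsto_sandwich[OF ge le tendsto_const])
  qed
  then show ?thesis
  proof eventually_elim
    case (elim x)
    have "S t f x = exp (- l * t) * (exp (l * t) * S t f x)"
      by (simp add: mult.assoc[symmetric] exp_add[symmetric])
    then show ?case using elim by simp
  qed
qed

section \<open>Kernel operators on essentially bounded functions\<close>

definition kop :: "'a measure \<Rightarrow> ('a \<Rightarrow> 'a \<Rightarrow> real) \<Rightarrow> ('a \<Rightarrow> real) \<Rightarrow> 'a \<Rightarrow> real" where
  "kop \<mu> k f x = (\<integral>y. k x y * f y \<partial>\<mu>)"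

definition ess_bdd :: "'a measure \<Rightarrow> real \<Rightarrow> ('a \<Rightarrow> real) \<Rightarrow> bool" where
  "ess_bdd \<mu> C f \<longleftrightarrow> f \<in> borel_measurable \<mu> \<and> (AE x in \<mu>. \<bar>f x\<bar> \<le> C)"

lemma ess_bdd_meas: "ess_bdd \<mu> C f \<Longrightarrow> f \<in> borel_measurable \<mu>"
  by (simp add: ess_bdd_def)

lemma ess_bdd_const: "ess_bdd \<mu> \<bar>c\<bar> (\<lambda>_. c)"
  by (simp add: ess_bdd_def)

lemma ess_bdd_lin:
  assumes "ess_bdd \<mu> C f" "ess_bdd \<mu> D g"
  shows "ess_bdd \<mu> (\<bar>a\<bar> * C + \<bar>b\<bar> * D) (\<lambda>x. a * f x + b * g x)"
proof -
  have "AE x in \<mu>. \<bar>a * f x + b * g x\<bar> \<le> \<bar>a\<bar> * C + \<bar>b\<bar> * D"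
    using assms[unfolded ess_bdd_def, THEN conjunct2]
  proof eventually_elim
    case (elim x)
    have "\<bar>a * f x + b * g x\<bar> \<le> \<bar>a\<bar> * \<bar>f x\<bar> + \<bar>b\<bar> * \<bar>g x\<bar>"
      using abs_triangle_ineq[of "a * f x" "b * g x"] by (simp add: abs_mult)
    also have "\<dots> \<le> \<bar>a\<bar> * C + \<bar>b\<bar> * D"
      by (intro add_mono mult_left_mono elim) auto
    finally show ?case .
  qed
  moreover have "(\<lambda>x. a * f x + b * g x) \<in> borel_measurable \<mu>"
    using assms by (intro borel_measurable_add borel_measurable_times borel_measurable_const ess_bdd_meas)
  ultimately show ?thesis unfolding ess_bdd_def by blast
qed

lemma ess_bdd_Linf: "ess_bdd \<mu> C f \<Longrightarrow> (\<lambda>x. complex_of_real (f x)) \<in> Linf \<mu>"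
  by (auto simp: ess_bdd_def Linf_def)

text \<open>
  Full support makes inequalities between continuous functions that hold almost everywhere hold
  everywhere; local finiteness and a countable base make the measure \<open>\<sigma>\<close>-finite.
\<close>

locale full_support_measure =
  fixes \<mu> :: "'a::polish_space measure"
  assumes sets_mu: "sets \<mu> = sets borel"
    and loc_fin: "locally_finite_measure \<mu>"
    and full_support: "topological_support \<mu> = UNIV"
begin

lemma space_mu [simp]: "space \<mu> = UNIV"
  using sets_eq_imp_space_eq[OF sets_mu] by simp

lemma null_open_empty:
  assumes "open V" "AE x in \<mu>. x \<notin> V"
  shows "V = {}"
proof (rule ccontr)
  assume "V \<noteq> {}"
  then have "emeasure \<mu> V > 0"
    using full_support assms(1) unfolding topological_support_def by blast
  moreover have "emeasure \<mu> V = 0"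
    using assms AE_iff_measurable[of V \<mu> "\<lambda>x. x \<notin> V"] sets_mu by auto
  ultimately show False by simp
qed

lemma AE_le_everywhere:
  fixes f g :: "'a \<Rightarrow> real"
  assumes "continuous_on UNIV f" "continuous_on UNIV g" "AE x in \<mu>. f x \<le> g x"
  shows "f x \<le> g x"
proof -
  have "open {x. g x < f x}" by (intro open_Collect_less assms)
  moreover have "AE x in \<mu>. x \<notin> {x. g x < f x}" using assms(3) by eventually_elim auto
  ultimately have "{x. g x < f x} = {}" by (rule null_open_empty)
  then show ?thesis by (auto simp: not_less)
qed

lemma AE_eq_everywhere:
  fixes f g :: "'a \<Rightarrow> 'b::t2_space"
  assumes "continuous_on UNIV f" "continuous_on UNIV g" "AE x in \<mu>. f x = g x"
  shows "f = g"
proof -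
  have "open {x. f x \<noteq> g x}" by (intro open_Collect_neq assms)
  moreover have "AE x in \<mu>. x \<notin> {x. f x \<noteq> g x}" using assms(3) by eventually_elim auto
  ultimately have "{x. f x \<noteq> g x} = {}" by (rule null_open_empty)
  then show ?thesis by auto
qed

lemma AE_witness:
  assumes "AE x in \<mu>. P x"
  shows "\<exists>x. P x"
proof (rule ccontr)
  assume "\<not> ?thesis"
  with assms have "AE x in \<mu>. x \<notin> UNIV" by simp
  then show False using null_open_empty[of UNIV] by simp
qed

lemma sigma_finite: "sigma_finite_measure \<mu>"
proof
  define F where "F = {V. open V \<and> emeasure \<mu> V < \<infinity>}"
  obtain F' where F': "F' \<subseteq> F" "countable F'" "\<Union>F' = \<Union>F"
    using Lindelof[of F] unfolding F_def by blast
  have "\<Union>F = UNIV"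
    using loc_fin unfolding locally_finite_measure_def F_def by blast
  then have U: "\<Union>F' = space \<mu>" using F'(3) by simp
  have F_sets: "V \<in> sets \<mu>" "emeasure \<mu> V \<noteq> \<infinity>" if "V \<in> F'" for V
  proof -
    have "V \<in> F" using F'(1) that by blast
    then show "V \<in> sets \<mu>" "emeasure \<mu> V \<noteq> \<infinity>"
      unfolding F_def sets_mu by (simp_all add: less_top[symmetric])
  qed
  show "\<exists>A. countable A \<and> A \<subseteq> sets \<mu> \<and> \<Union>A = space \<mu> \<and> (\<forall>a\<in>A. emeasure \<mu> a \<noteq> \<infinity>)"
  proof (rule exI[of _ F'], intro conjI ballI)
    show "F' \<subseteq> sets \<mu>" by (rule subsetI) (rule F_sets(1))
  qed (fact F'(2) U F_sets(2))+
qed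

text \<open>
  A fixed exhaustion by sets of finite measure. Truncating an essentially bounded function to \<open>B n\<close> gives
  square integrable functions, through which properties of the \<open>L\<^sup>2\<close> operators pass to \<open>L\<^sup>\<infinity>\<close>.
\<close>

definition B :: "nat \<Rightarrow> 'a set" where
  "B = (SOME B. range B \<subseteq> sets \<mu> \<and> (\<Union>i. B i) = UNIV \<and> (\<forall>i. emeasure \<mu> (B i) \<noteq> \<infinity>) \<and> incseq B)"

lemma B: "B n \<in> sets \<mu>" "(\<Union>i. B i) = UNIV" "emeasure \<mu> (B n) \<noteq> \<infinity>" "incseq B"
proof -
  obtain A :: "nat \<Rightarrow> 'a set" where A: "range A \<subseteq> sets \<mu>" "(\<Union>i. A i) = space \<mu>"
      "\<And>i. emeasure \<mu> (A i) \<noteq> \<infinity>" "incseq A"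
    by (rule sigma_finite_measure.sigma_finite_incseq[OF sigma_finite]) (rule that)
  have "\<exists>B. range B \<subseteq> sets \<mu> \<and> (\<Union>i. B i) = UNIV \<and> (\<forall>i. emeasure \<mu> (B i) \<noteq> \<infinity>) \<and> incseq B"
  proof (rule exI[of _ A], intro conjI allI)
    show "\<Union> (range A) = UNIV" using A(2) by (simp only: space_mu)
  qed (fact A)+
  from someI_ex[OF this] have *: "range B \<subseteq> sets \<mu> \<and> (\<Union>i. B i) = UNIV \<and> (\<forall>i. emeasure \<mu> (B i) \<noteq> \<infinity>) \<and> incseq B"
    unfolding B_def[symmetric] .
  show "B n \<in> sets \<mu>" using * by (simp add: image_subset_iff)
  show "(\<Union>i. B i) = UNIV" "emeasure \<mu> (B n) \<noteq> \<infinity>" "incseq B" using * by blast+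
qed

lemma eventually_in_B: "\<forall>\<^sub>F n in sequentially. x \<in> B n"
proof -
  obtain N where "x \<in> B N" using B(2) by blast
  then have "x \<in> B n" if "n \<ge> N" for n using incseqD[OF B(4) that] by blast
  then show ?thesis by (auto simp: eventually_sequentially)
qed

end

lemma kop_measurable:
  assumes \<mu>: "sigma_finite_measure \<mu>"
    and k: "(\<lambda>(x, y). k x y) \<in> borel_measurable (\<mu> \<Otimes>\<^sub>M \<mu>)" and f: "f \<in> borel_measurable \<mu>"
  shows "kop \<mu> k f \<in> borel_measurable \<mu>"
proof -
  interpret sigma_finite_measure \<mu> by (rule \<mu>)
  have "(\<lambda>z. k (fst z) (snd z) * f (snd z)) \<in> borel_measurable (\<mu> \<Otimes>\<^sub>M \<mu>)"
    using k measurable_compose[OF measurable_snd f]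
    by (intro borel_measurable_times) (simp_all add: case_prod_beta')
  then have "(\<lambda>(x, y). k x y * f y) \<in> borel_measurable (\<mu> \<Otimes>\<^sub>M \<mu>)"
    by (simp add: case_prod_beta')
  then show ?thesis unfolding kop_def[abs_def] by (rule borel_measurable_lebesgue_integral)
qed

lemma kop_lin:
  assumes "AE x in \<mu>. integrable \<mu> (\<lambda>y. k x y * f y)" "AE x in \<mu>. integrable \<mu> (\<lambda>y. k x y * g y)"
  shows "AE x in \<mu>. kop \<mu> k (\<lambda>y. a * f y + b * g y) x = a * kop \<mu> k f x + b * kop \<mu> k g x"
  using assms
proof eventually_elim
  case (elim x)
  have "(\<lambda>y. k x y * (a * f y + b * g y)) = (\<lambda>y. a * (k x y * f y) + b * (k x y * g y))"
    by (simp add: fun_eq_iff algebra_simps)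
  then show ?case using elim by (simp add: kop_def)
qed

lemma kernel_op_of_real:
  "kernel_op \<mu> k (\<lambda>y. complex_of_real (f y)) x = complex_of_real (kop \<mu> k f x)"
  unfolding kernel_op_def kop_def by (simp flip: of_real_mult)

locale kernel_semigroup = full_support_measure \<mu>
  for \<mu> :: "'a::polish_space measure" +
  fixes k :: "real \<Rightarrow> 'a \<Rightarrow> 'a \<Rightarrow> real"
  assumes k_meas: "\<And>t. t > 0 \<Longrightarrow> (\<lambda>(x, y). k t x y) \<in> borel_measurable (\<mu> \<Otimes>\<^sub>M \<mu>)"
    and k_int: "\<And>t f. t > 0 \<Longrightarrow> sqint \<mu> f \<Longrightarrow> AE x in \<mu>. integrable \<mu> (\<lambda>y. k t x y * f y)"
    and k_pos: "\<And>t. t > 0 \<Longrightarrow> pos_op \<mu> (kop \<mu> (k t))"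
    and k_semigroup: "\<And>s t f. s > 0 \<Longrightarrow> t > 0 \<Longrightarrow> sqint \<mu> f \<Longrightarrow>
      AE x in \<mu>. kop \<mu> (k (s + t)) f x = kop \<mu> (k s) (kop \<mu> (k t) f) x"
    and feller: "strong_feller \<mu> k"
begin

abbreviation S :: "real \<Rightarrow> ('a \<Rightarrow> real) \<Rightarrow> 'a \<Rightarrow> real" where
  "S t \<equiv> kop \<mu> (k t)"

text \<open>
  The continuous representative of \<open>S t f\<close>; see \<open>T_rep\<close>.
\<close>

definition T :: "real \<Rightarrow> ('a \<Rightarrow> real) \<Rightarrow> 'a \<Rightarrow> real" where
  "T t f x = Re (Linf_op \<mu> (k t) (\<lambda>y. complex_of_real (f y)) x)"

lemma sqint_finite_support:
  assumes f: "ess_bdd \<mu> C f" and D: "D \<in> sets \<mu>" "emeasure \<mu> D \<noteq> \<infinity>"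
  shows "sqint \<mu> (\<lambda>x. indicator D x * f x)"
    "l2n \<mu> (\<lambda>x. indicator D x * f x) \<le> \<bar>C\<bar> * sqrt (measure \<mu> D)"
proof -
  have [measurable]: "f \<in> borel_measurable \<mu>" "D \<in> sets \<mu>" using f D by (auto simp: ess_bdd_def)
  have sq: "sqint \<mu> (\<lambda>x. \<bar>C\<bar> * indicator D x)"
  proof -
    have "(\<lambda>x. (\<bar>C\<bar> * indicator D x)\<^sup>2) = (\<lambda>x. C\<^sup>2 * indicator D x :: real)"
      by (auto simp: fun_eq_iff split: split_indicator)
    then show ?thesis using D by (simp add: sqint_def less_top)
  qed
  have m: "(\<lambda>x. indicator D x * f x) \<in> borel_measurable \<mu>" by simp
  have ae: "AE x in \<mu>. \<bar>indicator D x * f x\<bar> \<le> \<bar>\<bar>C\<bar> * indicator D x\<bar>"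
    using f[unfolded ess_bdd_def, THEN conjunct2] by eventually_elim (auto split: split_indicator)
  show "sqint \<mu> (\<lambda>x. indicator D x * f x)" by (rule l2n_mono(1)[OF m sq ae])
  have "l2n \<mu> (\<lambda>x. indicator D x * f x) \<le> l2n \<mu> (\<lambda>x. \<bar>C\<bar> * indicator D x)"
    by (rule l2n_mono(2)[OF m sq ae])
  also have "\<dots> = \<bar>C\<bar> * l2n \<mu> (indicator D)" by (subst l2n_scale) simp
  also have "l2n \<mu> (indicator D) = sqrt (measure \<mu> D)"
  proof -
    have "(\<lambda>x. (indicator D x)\<^sup>2) = (indicator D :: 'a \<Rightarrow> real)"
      by (auto simp: fun_eq_iff split: split_indicator)
    then show ?thesis by (simp add: l2n_def)
  qed
  finally show "l2n \<mu> (\<lambda>x. indicator D x * f x) \<le> \<bar>C\<bar> * sqrt (measure \<mu> D)" .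
qed

lemma ess_bdd_restrict:
  assumes f: "ess_bdd \<mu> C f" and D: "D \<in> sets \<mu>"
  shows "ess_bdd \<mu> C (\<lambda>x. indicator D x * f x)"
proof -
  have "AE x in \<mu>. \<bar>indicator D x * f x\<bar> \<le> C"
    using f[unfolded ess_bdd_def, THEN conjunct2] by eventually_elim (auto split: split_indicator)
  then show ?thesis using assms by (auto simp: ess_bdd_def)
qed

lemma S_meas: "t > 0 \<Longrightarrow> f \<in> borel_measurable \<mu> \<Longrightarrow> S t f \<in> borel_measurable \<mu>"
  by (rule kop_measurable[OF sigma_finite k_meas])

lemma S_int:
  assumes t: "t > 0" and f: "ess_bdd \<mu> C f"
  shows "AE x in \<mu>. integrable \<mu> (\<lambda>y. k t x y * f y)"
proof -
  have "AE x in \<mu>. integrable \<mu> (\<lambda>y. complex_of_real (k t x y) * complex_of_real (f y))"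
    using feller[unfolded strong_feller_def, rule_format, OF t ess_bdd_Linf[OF f]] by (rule conjunct1)
  then have "AE x in \<mu>. integrable \<mu> (\<lambda>y. complex_of_real (k t x y * f y))"
    by simp
  then show ?thesis
    by (simp only: complex_of_real_integrable_eq)
qed

lemmas S_lin = kop_lin[where k="k t" for t]

text \<open>
  The strong Feller property for the constant \<open>1\<close> says that the sections \<open>k t x\<close> are integrable for almost
  every \<open>x\<close>, and they dominate. This continuity carries
  positivity and the semigroup law from \<open>L\<^sup>2\<close> to \<open>L\<^sup>\<infinity>\<close>.
\<close>

lemma S_bounded_limit:
  assumes t: "t > 0" and f: "\<And>n::nat. ess_bdd \<mu> C (f n)" and g: "g \<in> borel_measurable \<mu>"
    and lim: "AE x in \<mu>. (\<lambda>n. f n x) \<longlonglongrightarrow> g x"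
  shows "AE x in \<mu>. (\<lambda>n. S t (f n) x) \<longlonglongrightarrow> S t g x"
  using S_int[OF t ess_bdd_const[of \<mu> 1]]
proof eventually_elim
  case (elim x)
  have km: "(\<lambda>y. k t x y) \<in> borel_measurable \<mu>"
    using measurable_compose_Pair1[OF _ k_meas[OF t], of x] by simp
  show ?case unfolding kop_def
  proof (rule integral_dominated_convergence[where w="\<lambda>y. C * \<bar>k t x y\<bar>"])
    show "integrable \<mu> (\<lambda>y. C * \<bar>k t x y\<bar>)" using elim by simp
    show "AE y in \<mu>. (\<lambda>n. k t x y * f n y) \<longlonglongrightarrow> k t x y * g y"
      using lim by eventually_elim (intro tendsto_intros)
    fix n show "AE y in \<mu>. norm (k t x y * f n y) \<le> C * \<bar>k t x y\<bar>"
      using f[of n, unfolded ess_bdd_def, THEN conjunct2]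
      by eventually_elim (simp add: abs_mult mult.commute mult_right_mono)
    show "(\<lambda>y. k t x y * f n y) \<in> borel_measurable \<mu>"
      using km ess_bdd_meas[OF f] by simp
  qed (use km g in simp)
qed

lemma trunc_limit: "AE x in \<mu>. (\<lambda>n. indicator (B n) x * f x) \<longlonglongrightarrow> (f x :: real)"
proof (intro AE_I2 tendsto_eventually)
  fix x show "\<forall>\<^sub>F n in sequentially. indicator (B n) x * f x = f x"
    using eventually_in_B[of x] by eventually_elim simp
qed

lemma S_nonneg:
  assumes t: "t > 0" and f: "ess_bdd \<mu> C f" and pos: "AE x in \<mu>. 0 \<le> f x"
  shows "AE x in \<mu>. 0 \<le> S t f x"
proof -
  have "AE x in \<mu>. 0 \<le> S t (\<lambda>y. indicator (B n) y * f y) x" for n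
    by (rule pos_op_pos[OF k_pos[OF t] sqint_finite_support(1)[OF f B(1,3)]])
      (use pos in \<open>eventually_elim, simp\<close>)
  then have "AE x in \<mu>. \<forall>n. 0 \<le> S t (\<lambda>y. indicator (B n) y * f y) x"
    by (simp add: AE_all_countable)
  with S_bounded_limit[OF t ess_bdd_restrict[OF f B(1)] ess_bdd_meas[OF f] trunc_limit]
  show ?thesis by eventually_elim (auto intro: LIMSEQ_le_const)
qed

lemma S_mono:
  assumes t: "t > 0" and f: "ess_bdd \<mu> C f" and g: "ess_bdd \<mu> D g" and le: "AE x in \<mu>. f x \<le> g x"
  shows "AE x in \<mu>. S t f x \<le> S t g x"
proof -
  have "AE x in \<mu>. 0 \<le> S t (\<lambda>x. 1 * g x + (-1) * f x) x"
    by (rule S_nonneg[OF t ess_bdd_lin[OF g f]]) (use le in auto)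
  with S_lin[OF S_int[OF t g] S_int[OF t f], of 1 "-1"] show ?thesis
    by eventually_elim simp
qed

lemma S_abs_le:
  assumes t: "t > 0" and f: "ess_bdd \<mu> C f" and g: "ess_bdd \<mu> D g" and le: "AE x in \<mu>. \<bar>f x\<bar> \<le> g x"
  shows "AE x in \<mu>. \<bar>S t f x\<bar> \<le> S t g x"
proof -
  have 0: "ess_bdd \<mu> C (\<lambda>x. (-1) * f x + 0 * f x)"
    using f by (simp add: ess_bdd_def)
  have "AE x in \<mu>. S t f x \<le> S t g x"
    by (rule S_mono[OF t f g]) (use le in auto)
  moreover have "AE x in \<mu>. S t (\<lambda>x. (-1) * f x + 0 * f x) x \<le> S t g x"
    by (rule S_mono[OF t 0 g]) (use le in auto)
  moreover have "AE x in \<mu>. S t (\<lambda>x. (-1) * f x + 0 * f x) x = (-1) * S t f x + 0 * S t f x"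
    by (rule S_lin[OF S_int[OF t f] S_int[OF t f]])
  ultimately show ?thesis by eventually_elim simp
qed

lemma T_rep:
  assumes t: "t > 0" and f: "ess_bdd \<mu> C f"
  shows "Linf_op \<mu> (k t) (\<lambda>y. complex_of_real (f y)) = (\<lambda>x. complex_of_real (T t f x))"
    and "continuous_on UNIV (T t f)" and "\<exists>D. \<forall>x. \<bar>T t f x\<bar> \<le> D"
    and "AE x in \<mu>. T t f x = S t f x"
proof -
  note kf = kernel_op_of_real[of \<mu> "k t" f]
  obtain g where g: "g \<in> Cb" "AE x in \<mu>. g x = complex_of_real (S t f x)"
    using feller[unfolded strong_feller_def, rule_format, OF t ess_bdd_Linf[OF f]]
    unfolding kf by (elim conjE bexE) (rule that)
  have L: "Linf_op \<mu> (k t) (\<lambda>y. complex_of_real (f y)) = g"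
    unfolding Linf_op_def kf
  proof (rule the_equality)
    fix h assume h: "h \<in> Cb \<and> (AE x in \<mu>. h x = complex_of_real (S t f x))"
    show "h = g"
    proof (rule AE_eq_everywhere)
      show "AE x in \<mu>. h x = g x" using h[THEN conjunct2] g(2) by eventually_elim simp
    qed (use h g in \<open>auto simp: Cb_def\<close>)
  qed (use g in simp)
  have T: "T t f = (\<lambda>x. Re (g x))" by (simp add: T_def[abs_def] L)
  have cg: "continuous_on UNIV g" "bounded (range g)" using g(1) by (auto simp: Cb_def)
  have "g = (\<lambda>x. complex_of_real (Re (g x)))"
    by (rule AE_eq_everywhere[OF cg(1)]) (use g(2) in \<open>auto intro!: continuous_intros cg\<close>)
  then show "Linf_op \<mu> (k t) (\<lambda>y. complex_of_real (f y)) = (\<lambda>x. complex_of_real (T t f x))"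
    unfolding L T .
  show "continuous_on UNIV (T t f)" unfolding T by (intro continuous_intros cg)
  obtain D where "\<And>x. cmod (g x) \<le> D" using cg(2) by (auto simp: bounded_iff)
  then show "\<exists>D. \<forall>x. \<bar>T t f x\<bar> \<le> D"
    unfolding T by (meson abs_Re_le_cmod order_trans)
  show "AE x in \<mu>. T t f x = S t f x"
    using g(2) by eventually_elim (simp add: T)
qed

lemma ess_bdd_S:
  assumes t: "t > 0" and f: "ess_bdd \<mu> C f"
  obtains D where "ess_bdd \<mu> D (S t f)"
proof -
  obtain D where D: "\<forall>x. \<bar>T t f x\<bar> \<le> D" using T_rep(3)[OF t f] by blast
  have "AE x in \<mu>. \<bar>S t f x\<bar> \<le> D"
    using T_rep(4)[OF t f]
  proof eventually_elim
    case (elim x) then show ?case using D[rule_format, of x] by simp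
  qed
  then have "ess_bdd \<mu> D (S t f)"
    unfolding ess_bdd_def using S_meas[OF t ess_bdd_meas[OF f]] by blast
  then show ?thesis by (rule that)
qed

lemma Linf_op_complex:
  assumes t: "t > 0" and f: "f \<in> Linf \<mu>" and r: "ess_bdd \<mu> C (\<lambda>x. Re (f x))" and i: "ess_bdd \<mu> D (\<lambda>x. Im (f x))"
  shows "Linf_op \<mu> (k t) f x = Complex (T t (\<lambda>x. Re (f x)) x) (T t (\<lambda>x. Im (f x)) x)"
proof -
  let ?r = "\<lambda>x. Re (f x)" and ?i = "\<lambda>x. Im (f x)"
  let ?g = "\<lambda>x. Complex (T t ?r x) (T t ?i x)"
  have ae: "AE x in \<mu>. ?g x = kernel_op \<mu> (k t) f x"
    using T_rep(4)[OF t r] T_rep(4)[OF t i] S_int[OF t r] S_int[OF t i]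
  proof eventually_elim
    case (elim x)
    have "(\<lambda>y. complex_of_real (k t x y) * f y)
        = (\<lambda>y. complex_of_real (k t x y * ?r y) + \<i> * complex_of_real (k t x y * ?i y))"
      by (auto simp: fun_eq_iff complex_eq_iff)
    then have "kernel_op \<mu> (k t) f x = complex_of_real (S t ?r x) + \<i> * complex_of_real (S t ?i x)"
      using elim(3,4) by (simp add: kernel_op_def kop_def complex_of_real_integrable_eq del: of_real_mult)
    then show ?case using elim(1,2) by (simp add: complex_eq_iff)
  qed
  have cg: "continuous_on UNIV ?g"
    unfolding Complex_eq by (intro continuous_intros T_rep(2)[OF t r] T_rep(2)[OF t i])
  have bg: "bounded (range ?g)"
  proof -
    obtain C1 C2 where C: "\<And>x. \<bar>T t ?r x\<bar> \<le> C1" "\<And>x. \<bar>T t ?i x\<bar> \<le> C2"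
      using T_rep(3)[OF t r] T_rep(3)[OF t i] by blast
    have "cmod (?g x) \<le> C1 + C2" for x
    proof -
      have "cmod (?g x) \<le> \<bar>T t ?r x\<bar> + \<bar>T t ?i x\<bar>"
        using cmod_le[of "?g x"] by (simp only: complex.sel)
      then show ?thesis using C(1)[of x] C(2)[of x] by linarith
    qed
    then show ?thesis by (auto simp: bounded_iff)
  qed
  have "Linf_op \<mu> (k t) f = ?g"
    unfolding Linf_op_def
  proof (rule the_equality)
    fix h assume h: "h \<in> Cb \<and> (AE x in \<mu>. h x = kernel_op \<mu> (k t) f x)"
    show "h = ?g"
    proof (rule AE_eq_everywhere[OF _ cg])
      show "AE x in \<mu>. h x = ?g x" using h[THEN conjunct2] ae by eventually_elim simp
    qed (use h in \<open>auto simp: Cb_def\<close>)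
  qed (use cg bg ae in \<open>auto simp: Cb_def\<close>)
  then show ?thesis by simp
qed

lemma S_semigroup:
  assumes s: "s > 0" and t: "t > 0" and f: "ess_bdd \<mu> C f"
  shows "AE x in \<mu>. S (s + t) f x = S s (S t f) x"
proof -
  let ?f = "\<lambda>n y. indicator (B n) y * f y"
  have st: "s + t > 0" using s t by simp
  obtain D where D: "\<forall>x. \<bar>T t (\<lambda>_. \<bar>C\<bar>) x\<bar> \<le> D"
    using T_rep(3)[OF t ess_bdd_const] by blast
  have fn: "ess_bdd \<mu> C (?f n)" for n by (rule ess_bdd_restrict[OF f B(1)])
  have Sfn: "ess_bdd \<mu> D (S t (?f n))" for n
  proof -
    have "AE x in \<mu>. \<bar>S t (?f n) x\<bar> \<le> S t (\<lambda>_. \<bar>C\<bar>) x"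
      by (rule S_abs_le[OF t fn ess_bdd_const])
        (use fn[of n, unfolded ess_bdd_def, THEN conjunct2] in auto)
    with T_rep(4)[OF t ess_bdd_const[of \<mu> "\<bar>C\<bar>"]] have "AE x in \<mu>. \<bar>S t (?f n) x\<bar> \<le> D"
    proof eventually_elim
      case (elim x) then show ?case using D[rule_format, of x] by linarith
    qed
    then show ?thesis using S_meas[OF t ess_bdd_meas[OF fn]] by (simp add: ess_bdd_def)
  qed
  have 1: "AE x in \<mu>. (\<lambda>n. S (s + t) (?f n) x) \<longlonglongrightarrow> S (s + t) f x"
    by (rule S_bounded_limit[OF st fn ess_bdd_meas[OF f] trunc_limit])
  have "AE x in \<mu>. (\<lambda>n. S t (?f n) x) \<longlonglongrightarrow> S t f x"
    by (rule S_bounded_limit[OF t fn ess_bdd_meas[OF f] trunc_limit])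
  then have 2: "AE x in \<mu>. (\<lambda>n. S s (S t (?f n)) x) \<longlonglongrightarrow> S s (S t f) x"
    by (rule S_bounded_limit[OF s Sfn S_meas[OF t ess_bdd_meas[OF f]]])
  have "AE x in \<mu>. \<forall>n. S (s + t) (?f n) x = S s (S t (?f n)) x"
    unfolding AE_all_countable
    by (intro allI k_semigroup s t sqint_finite_support(1)[OF f B(1,3)])
  with 1 2 show ?thesis
  proof eventually_elim
    case (elim x)
    show ?case
      by (rule LIMSEQ_unique[OF elim(1)]) (use elim(2,3) in simp)
  qed
qed

end

section \<open>Progressive ground state domination implies progressive uniform convergence\<close>

lemma exhausting_mono:
  assumes "exhausting_family t\<^sub>1 K" "t\<^sub>1 \<le> t" "t \<le> s"
  shows "K t \<subseteq> K s"
proof (cases "t = s")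
  case False
  then have "t\<^sub>1 \<le> t \<and> t < s" using assms by simp
  then show ?thesis using assms(1) unfolding exhausting_family_def by simp
qed simp

lemma exhausting_compact:
  assumes "exhausting_family t\<^sub>1 K" "compact L"
  shows "\<exists>s\<ge>t\<^sub>1. L \<subseteq> K s"
  using assms unfolding exhausting_family_def by simp

lemma exhausting_point:
  assumes "exhausting_family t\<^sub>1 K"
  shows "\<exists>s\<ge>t\<^sub>1. x \<in> K s"
  using exhausting_compact[OF assms compact_sing[of x]] by simp

text \<open>
  One half of a dual pair: \<open>p\<close> is the ground state of the semigroup and \<open>q\<close> that of its adjoint, which
  enters through the invariance of \<open>f \<mapsto> \<integral> f q\<close>. The convergence in operator norm is an assumption here,
  since the two semigroups obtain it in different ways.
\<close>

locale ground_state_semigroup = kernel_semigroup \<mu> k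
  for \<mu> :: "'a::polish_space measure" and k +
  fixes l t\<^sub>0 :: real and p q :: "'a \<Rightarrow> real"
  assumes p_cont: "continuous_on UNIV p" and p_bdd: "\<exists>D. \<forall>x. p x \<le> D"
    and p_nonneg: "\<And>x. 0 \<le> p x" and p_pos: "AE x in \<mu>. 0 < p x" and p_sq: "sqint \<mu> p"
    and q_nonneg: "\<And>x. 0 \<le> q x" and q_pos: "AE x in \<mu>. 0 < q x" and q_sq: "sqint \<mu> q"
    and eig: "\<And>t. t > 0 \<Longrightarrow> AE x in \<mu>. S t p x = exp (- l * t) * p x"
    and inv: "\<And>t f. t > 0 \<Longrightarrow> sqint \<mu> f \<Longrightarrow>
      (\<integral>x. S t f x * q x \<partial>\<mu>) = exp (- l * t) * (\<integral>x. f x * q x \<partial>\<mu>)"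
    and t0: "t\<^sub>0 > 0"
    and ult: "\<exists>C. \<forall>f. sqint \<mu> f \<longrightarrow> (AE x in \<mu>. \<bar>S t\<^sub>0 f x\<bar> \<le> C * l2n \<mu> f)"
    and decay: "\<And>\<epsilon>. \<epsilon> > 0 \<Longrightarrow> \<exists>K. compact K \<and> (\<forall>x\<in>- K. T t\<^sub>0 (\<lambda>_. 1) x \<le> \<epsilon>)"
    and pq_pos: "0 < (\<integral>x. p x * q x \<partial>\<mu>)"
    and conv: "\<And>\<epsilon>. \<epsilon> > 0 \<Longrightarrow> \<exists>N. \<forall>n\<ge>N. \<forall>f. sqint \<mu> f \<longrightarrow>
      l2n \<mu> (\<lambda>x. exp (l * (real n * t\<^sub>0)) * S (real n * t\<^sub>0) f x
        - (\<integral>x. f x * q x \<partial>\<mu>) / (\<integral>x. p x * q x \<partial>\<mu>) * p x) \<le> \<epsilon> * l2n \<mu> f"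
begin

text \<open>
  The coefficient of the ground state projection: \<open>P f = w f * p\<close>.
\<close>

definition w :: "('a \<Rightarrow> real) \<Rightarrow> real" where
  "w f = (\<integral>x. f x * q x \<partial>\<mu>) / (\<integral>x. p x * q x \<partial>\<mu>)"

definition V :: "nat \<Rightarrow> ('a \<Rightarrow> real) \<Rightarrow> 'a \<Rightarrow> real" where
  "V n f x = exp (l * (real n * t\<^sub>0)) * S (real n * t\<^sub>0) f x"

lemma S_sq: "t > 0 \<Longrightarrow> sqint \<mu> f \<Longrightarrow> sqint \<mu> (S t f)"
  by (rule pos_op_sqint[OF k_pos])

lemma nt0: "n \<ge> 1 \<Longrightarrow> 0 < real n * t\<^sub>0"
  using t0 by simp

text \<open>
  The last step of the semigroup, of length \<open>t\<^sub>0\<close>, is spent on mapping \<open>L\<^sup>2\<close> to \<open>L\<^sup>\<infinity>\<close>; the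
  steps before it converge in the \<open>L\<^sup>2\<close> operator norm.
\<close>

lemma V_bound_L2_Linf:
  assumes \<epsilon>: "\<epsilon> > 0"
  shows "\<exists>N\<ge>1. \<forall>n\<ge>N. \<forall>f. sqint \<mu> f \<longrightarrow> (AE x in \<mu>. \<bar>V n f x - w f * p x\<bar> \<le> \<epsilon> * l2n \<mu> f)"
proof -
  obtain C where C: "\<And>f. sqint \<mu> f \<Longrightarrow> AE x in \<mu>. \<bar>S t\<^sub>0 f x\<bar> \<le> C * l2n \<mu> f"
    using ult by blast
  define E where "E = exp (l * t\<^sub>0) * \<bar>C\<bar> + 1"
  have E: "E > 0" unfolding E_def by (intro add_nonneg_pos mult_nonneg_nonneg) simp_all
  define \<delta> where "\<delta> = \<epsilon> / E"
  have \<delta>: "\<delta> > 0" using \<epsilon> E by (simp add: \<delta>_def)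
  obtain N where N: "\<And>n f. n \<ge> N \<Longrightarrow> sqint \<mu> f \<Longrightarrow> l2n \<mu> (\<lambda>x. V n f x - w f * p x) \<le> \<delta> * l2n \<mu> f"
    using conv[OF \<delta>] unfolding V_def w_def by blast
  have "AE x in \<mu>. \<bar>V n f x - w f * p x\<bar> \<le> \<epsilon> * l2n \<mu> f" if n: "n \<ge> N + 2" and f: "sqint \<mu> f" for n f
  proof -
    \<comment> \<open>The kernels exist for positive times only, so \<open>m\<close> must be positive, whence \<open>N + 2\<close>.\<close>
    define m where "m = n - 1"
    have m: "m \<ge> N" "m \<ge> 1" "n = Suc m" using n by (simp_all add: m_def)
    note mt = nt0[OF m(2)]
    define g where "g = (\<lambda>x. V m f x - w f * p x)"
    have Smf: "sqint \<mu> (S (real m * t\<^sub>0) f)" by (rule S_sq[OF mt f])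
    have g: "sqint \<mu> g" unfolding g_def V_def by (intro sqint_diff sqint_scale Smf p_sq)
    have gn: "l2n \<mu> g \<le> \<delta> * l2n \<mu> f" unfolding g_def by (rule N[OF m(1) f])
    have 1: "AE x in \<mu>. S t\<^sub>0 g x = exp (l * (real m * t\<^sub>0)) * S t\<^sub>0 (S (real m * t\<^sub>0) f) x - w f * S t\<^sub>0 p x"
      using pos_op_lin[OF k_pos[OF t0] Smf p_sq, of "exp (l * (real m * t\<^sub>0))" "- w f"]
      unfolding g_def V_def by simp
    have 2: "AE x in \<mu>. S (t\<^sub>0 + real m * t\<^sub>0) f x = S t\<^sub>0 (S (real m * t\<^sub>0) f) x"
      by (rule k_semigroup[OF t0 mt f])
    have nn: "real n * t\<^sub>0 = t\<^sub>0 + real m * t\<^sub>0" using m(3) by (simp add: algebra_simps)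
    show ?thesis
      using 1 2 eig[OF t0] C[OF g]
    proof eventually_elim
      case (elim x)
      have e1: "exp (l * t\<^sub>0) * exp (l * (real m * t\<^sub>0)) = exp (l * (real n * t\<^sub>0))"
        unfolding nn by (simp add: distrib_left exp_add)
      have e2: "exp (l * t\<^sub>0) * exp (- l * t\<^sub>0) = 1" by (simp flip: exp_add)
      have "V n f x - w f * p x = exp (l * t\<^sub>0) * exp (l * (real m * t\<^sub>0)) * S t\<^sub>0 (S (real m * t\<^sub>0) f) x
          - w f * (exp (l * t\<^sub>0) * exp (- l * t\<^sub>0)) * p x"
        unfolding V_def e1 e2 nn elim(2) by simp
      also have "\<dots> = exp (l * t\<^sub>0) * S t\<^sub>0 g x"
        unfolding elim(1) elim(3) by (simp add: algebra_simps)
      finally have "\<bar>V n f x - w f * p x\<bar> = exp (l * t\<^sub>0) * \<bar>S t\<^sub>0 g x\<bar>"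
        by (simp add: abs_mult)
      also have "\<dots> \<le> exp (l * t\<^sub>0) * (\<bar>C\<bar> * l2n \<mu> g)"
        using elim(4) mult_right_mono[OF abs_ge_self[of C] l2n_nonneg[of \<mu> g]]
        by (intro mult_left_mono) (linarith | simp)+
      also have "\<dots> \<le> E * l2n \<mu> g"
        unfolding E_def using l2n_nonneg[of \<mu> g] by (simp add: distrib_right)
      also have "\<dots> \<le> E * (\<delta> * l2n \<mu> f)" using E gn by simp
      also have "\<dots> = \<epsilon> * l2n \<mu> f" using E by (simp add: \<delta>_def)
      finally show ?case .
    qed
  qed
  then show ?thesis by (intro exI[of _ "N + 2"]) simp
qed

lemma q_integrable_on_B:
  "integrable \<mu> (\<lambda>x. indicator (B j) x * q x)"
  using sqint_mult[OF sqint_finite_support(1)[OF ess_bdd_const[of \<mu> 1] B(1,3)] q_sq, of j] by simp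

text \<open>
  For a set \<open>B j\<close> of finite measure, \<open>V n\<close> applied to its indicator converges to
  \<open>w (indicator (B j)) * p\<close>. At a point with \<open>p > 0\<close> the domination keeps it below \<open>C * p\<close>. Hence
  \<open>w (indicator (B j)) \<le> C\<close> for all \<open>j\<close>, and monotone convergence applies.
\<close>

lemma q_integrable:
  assumes exh: "exhausting_family t\<^sub>1 K" and C: "C > 0"
    and dom: "\<And>t x. t \<ge> t\<^sub>1 \<Longrightarrow> x \<in> K t \<Longrightarrow> T t (\<lambda>_. 1) x \<le> C * exp (- l * t) * p x"
  shows "integrable \<mu> q"
proof -
  let ?\<gamma> = "\<integral>x. p x * q x \<partial>\<mu>"
  have one: "ess_bdd \<mu> 1 (\<lambda>_. 1)" using ess_bdd_const[of \<mu> 1] by simp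
  have bound: "(\<integral>x. indicator (B j) x * q x \<partial>\<mu>) \<le> C * ?\<gamma>" for j
  proof -
    define f where "f = (\<lambda>x. indicator (B j) x * (1::real))"
    have f_sq: "sqint \<mu> f" unfolding f_def by (rule sqint_finite_support(1)[OF one B(1,3)])
    have f_bdd: "ess_bdd \<mu> 1 f" unfolding f_def by (rule ess_bdd_restrict[OF one B(1)])
    have "\<forall>i. \<exists>N\<ge>1. \<forall>n\<ge>N. AE x in \<mu>. \<bar>V n f x - w f * p x\<bar> \<le> 1 / real (Suc i) * l2n \<mu> f"
    proof
      fix i
      have "0 < 1 / real (Suc i)" by simp
      from V_bound_L2_Linf[OF this] f_sq
      show "\<exists>N\<ge>1. \<forall>n\<ge>N. AE x in \<mu>. \<bar>V n f x - w f * p x\<bar> \<le> 1 / real (Suc i) * l2n \<mu> f" by blast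
    qed
    then obtain N where N: "\<And>i. N i \<ge> 1"
      "\<And>i n. n \<ge> N i \<Longrightarrow> AE x in \<mu>. \<bar>V n f x - w f * p x\<bar> \<le> 1 / real (Suc i) * l2n \<mu> f"
      by metis
    have 1: "AE x in \<mu>. \<forall>i n. n \<ge> N i \<longrightarrow> \<bar>V n f x - w f * p x\<bar> \<le> 1 / real (Suc i) * l2n \<mu> f"
      using N(2) by (simp add: AE_all_countable)
    have 2: "AE x in \<mu>. \<forall>n. n \<ge> 1 \<longrightarrow> S (real n * t\<^sub>0) f x \<le> T (real n * t\<^sub>0) (\<lambda>_. 1) x"
      unfolding AE_all_countable
    proof (intro allI AE_impI)
      fix n :: nat assume n: "n \<ge> 1"
      have "AE x in \<mu>. S (real n * t\<^sub>0) f x \<le> S (real n * t\<^sub>0) (\<lambda>_. 1) x"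
        by (rule S_mono[OF nt0[OF n] f_bdd one]) (simp add: f_def split: split_indicator)
      with T_rep(4)[OF nt0[OF n] one]
      show "AE x in \<mu>. S (real n * t\<^sub>0) f x \<le> T (real n * t\<^sub>0) (\<lambda>_. 1) x"
        by eventually_elim simp
    qed
    obtain x where x: "\<And>i n. n \<ge> N i \<Longrightarrow> \<bar>V n f x - w f * p x\<bar> \<le> 1 / real (Suc i) * l2n \<mu> f"
      "\<And>n. n \<ge> 1 \<Longrightarrow> S (real n * t\<^sub>0) f x \<le> T (real n * t\<^sub>0) (\<lambda>_. 1) x" "0 < p x"
    proof -
      have "AE x in \<mu>. (\<forall>i n. n \<ge> N i \<longrightarrow> \<bar>V n f x - w f * p x\<bar> \<le> 1 / real (Suc i) * l2n \<mu> f) \<and>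
        (\<forall>n. n \<ge> 1 \<longrightarrow> S (real n * t\<^sub>0) f x \<le> T (real n * t\<^sub>0) (\<lambda>_. 1) x) \<and> 0 < p x"
        using 1 2 p_pos by eventually_elim (intro conjI; assumption)
      from AE_witness[OF this] obtain x where "(\<forall>i n. n \<ge> N i \<longrightarrow> \<bar>V n f x - w f * p x\<bar> \<le> 1 / real (Suc i) * l2n \<mu> f) \<and>
        (\<forall>n. n \<ge> 1 \<longrightarrow> S (real n * t\<^sub>0) f x \<le> T (real n * t\<^sub>0) (\<lambda>_. 1) x) \<and> 0 < p x" ..
      then show ?thesis by (intro that[of x]) simp_all
    qed
    obtain s where s: "s \<ge> t\<^sub>1" "x \<in> K s"
      using exhausting_point[OF exh, of x] by (elim exE conjE) (rule that)
    have le: "w f * p x \<le> C * p x + 1 / real (Suc i) * l2n \<mu> f" for i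
    proof -
      obtain n0 :: nat where n0: "s / t\<^sub>0 < n0" using reals_Archimedean2 by blast
      define n where "n = max n0 (N i)"
      have n: "n \<ge> N i" "n \<ge> 1" using N(1)[of i] by (simp_all add: n_def)
      have "s / t\<^sub>0 < real n" using n0 by (simp add: n_def)
      then have st: "s < real n * t\<^sub>0" using t0 by (simp add: pos_divide_less_eq)
      have xK: "x \<in> K (real n * t\<^sub>0)"
        using exhausting_mono[OF exh s(1) less_imp_le[OF st]] s(2) by (rule subsetD)
      have "S (real n * t\<^sub>0) f x \<le> C * exp (- l * (real n * t\<^sub>0)) * p x"
        using x(2)[OF n(2)] dom[OF _ xK] s(1) st by linarith
      then have "V n f x \<le> exp (l * (real n * t\<^sub>0)) * (C * exp (- l * (real n * t\<^sub>0)) * p x)"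
        unfolding V_def by (intro mult_left_mono) simp_all
      also have "\<dots> = (exp (l * (real n * t\<^sub>0)) * exp (- l * (real n * t\<^sub>0))) * (C * p x)" by simp
      also have "exp (l * (real n * t\<^sub>0)) * exp (- l * (real n * t\<^sub>0)) = 1" by (simp flip: exp_add)
      finally show ?thesis using x(1)[OF n(1)] by linarith
    qed
    have "(\<lambda>i. C * p x + 1 / real (Suc i) * l2n \<mu> f) \<longlonglongrightarrow> C * p x + 0 * l2n \<mu> f"
      using LIMSEQ_inverse_real_of_nat by (intro tendsto_intros) (simp add: inverse_eq_divide)
    then have "w f * p x \<le> C * p x + 0 * l2n \<mu> f"
      by (rule LIMSEQ_le_const) (use le in blast)
    then have "w f \<le> C" using x(3) by simp
    then show ?thesis using pq_pos by (simp add: w_def f_def pos_divide_le_eq)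
  qed
  have qm: "q \<in> borel_measurable \<mu>" by (rule sqint_meas[OF q_sq])
  let ?D = "density \<mu> (\<lambda>x. ennreal (q x))"
  have "(\<integral>\<^sup>+x. ennreal (q x) \<partial>\<mu>) = emeasure ?D UNIV"
    using qm by (subst emeasure_density) (simp_all add: sets.top[of \<mu>, simplified])
  also have "\<dots> = (SUP j. emeasure ?D (B j))"
    unfolding B(2)[symmetric] using B(1,4) by (intro SUP_emeasure_incseq[symmetric]) auto
  also have "\<dots> \<le> ennreal (C * ?\<gamma>)"
  proof (rule SUP_least)
    fix j
    have "emeasure ?D (B j) = (\<integral>\<^sup>+x. ennreal (indicator (B j) x * q x) \<partial>\<mu>)"
      using qm B(1)[of j] by (subst emeasure_density)
        (auto intro!: nn_integral_cong split: split_indicator)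
    also have "\<dots> = ennreal (\<integral>x. indicator (B j) x * q x \<partial>\<mu>)"
      using q_nonneg by (intro nn_integral_eq_integral q_integrable_on_B) simp
    also have "\<dots> \<le> ennreal (C * ?\<gamma>)" by (intro ennreal_leI bound)
    finally show "emeasure ?D (B j) \<le> ennreal (C * ?\<gamma>)" .
  qed
  finally have "(\<integral>\<^sup>+x. ennreal (q x) \<partial>\<mu>) < \<infinity>" by (simp add: le_less_trans)
  then show ?thesis
    using qm q_nonneg by (intro integrableI_nonneg) simp_all
qed

lemma ess_bdd_q_int:
  assumes q: "integrable \<mu> q" and f: "ess_bdd \<mu> C f"
  shows "integrable \<mu> (\<lambda>x. f x * q x)" "\<bar>\<integral>x. f x * q x \<partial>\<mu>\<bar> \<le> C * (\<integral>x. q x \<partial>\<mu>)"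
proof -
  have Cq: "integrable \<mu> (\<lambda>x. C * q x)" using q by simp
  have ae: "AE x in \<mu>. \<bar>f x * q x\<bar> \<le> C * q x"
    using f[unfolded ess_bdd_def, THEN conjunct2]
    by eventually_elim (simp add: abs_mult q_nonneg mult_right_mono)
  have "AE x in \<mu>. norm (f x * q x) \<le> norm (C * q x)"
    using ae by eventually_elim simp
  then show I: "integrable \<mu> (\<lambda>x. f x * q x)"
    using ess_bdd_meas[OF f] sqint_meas[OF q_sq]
    by (intro Bochner_Integration.integrable_bound[OF Cq]) simp_all
  have "\<bar>\<integral>x. f x * q x \<partial>\<mu>\<bar> \<le> (\<integral>x. \<bar>f x * q x\<bar> \<partial>\<mu>)" by (rule integral_abs_bound)
  also have "\<dots> \<le> (\<integral>x. C * q x \<partial>\<mu>)" by (rule integral_mono_AE[OF _ Cq ae]) (use I in simp)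
  finally show "\<bar>\<integral>x. f x * q x \<partial>\<mu>\<bar> \<le> C * (\<integral>x. q x \<partial>\<mu>)" by simp
qed

lemma inv_ess_bdd:
  assumes q: "integrable \<mu> q" and t: "t > 0" and f: "ess_bdd \<mu> C f"
  shows "(\<integral>x. S t f x * q x \<partial>\<mu>) = exp (- l * t) * (\<integral>x. f x * q x \<partial>\<mu>)"
proof -
  let ?f = "\<lambda>n x. indicator (B n) x * f x"
  have fn: "ess_bdd \<mu> C (?f n)" for n by (rule ess_bdd_restrict[OF f B(1)])
  have C1: "ess_bdd \<mu> \<bar>\<bar>C\<bar>\<bar> (\<lambda>_. \<bar>C\<bar>)" by (rule ess_bdd_const)
  obtain D where D: "ess_bdd \<mu> D (S t (\<lambda>_. \<bar>C\<bar>))" using ess_bdd_S[OF t C1] .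
  have Sfn: "AE x in \<mu>. \<bar>S t (?f n) x\<bar> \<le> D" for n
  proof -
    have "AE x in \<mu>. \<bar>S t (?f n) x\<bar> \<le> S t (\<lambda>_. \<bar>C\<bar>) x"
    proof (rule S_abs_le[OF t fn C1])
      show "AE x in \<mu>. \<bar>?f n x\<bar> \<le> \<bar>C\<bar>"
        using fn[of n, unfolded ess_bdd_def, THEN conjunct2] by eventually_elim linarith
    qed
    with D[unfolded ess_bdd_def, THEN conjunct2] show ?thesis by eventually_elim linarith
  qed
  have qm: "q \<in> borel_measurable \<mu>" by (rule sqint_meas[OF q_sq])
  have fm: "f \<in> borel_measurable \<mu>" by (rule ess_bdd_meas[OF f])
  have "(\<lambda>n. \<integral>x. S t (?f n) x * q x \<partial>\<mu>) \<longlonglongrightarrow> (\<integral>x. S t f x * q x \<partial>\<mu>)"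
  proof (rule integral_dominated_convergence[where w="\<lambda>x. D * q x"])
    show "(\<lambda>x. S t f x * q x) \<in> borel_measurable \<mu>"
      by (intro borel_measurable_times S_meas[OF t fm] qm)
    show "(\<lambda>x. S t (?f n) x * q x) \<in> borel_measurable \<mu>" for n
      by (intro borel_measurable_times S_meas[OF t ess_bdd_meas[OF fn]] qm)
    show "integrable \<mu> (\<lambda>x. D * q x)" using q by simp
    show "AE x in \<mu>. (\<lambda>n. S t (?f n) x * q x) \<longlonglongrightarrow> S t f x * q x"
      using S_bounded_limit[OF t fn fm trunc_limit] by eventually_elim (intro tendsto_intros)
    show "AE x in \<mu>. norm (S t (?f n) x * q x) \<le> D * q x" for n
      using Sfn[of n] by eventually_elim (simp add: abs_mult q_nonneg mult_right_mono)
  qed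
  moreover have "(\<lambda>n. \<integral>x. ?f n x * q x \<partial>\<mu>) \<longlonglongrightarrow> (\<integral>x. f x * q x \<partial>\<mu>)"
  proof (rule integral_dominated_convergence[where w="\<lambda>x. \<bar>f x * q x\<bar>"])
    show "(\<lambda>x. f x * q x) \<in> borel_measurable \<mu>" by (intro borel_measurable_times fm qm)
    show "(\<lambda>x. ?f n x * q x) \<in> borel_measurable \<mu>" for n
      by (intro borel_measurable_times ess_bdd_meas[OF fn] qm)
    show "integrable \<mu> (\<lambda>x. \<bar>f x * q x\<bar>)" using ess_bdd_q_int(1)[OF q f] by simp
    show "AE x in \<mu>. (\<lambda>n. ?f n x * q x) \<longlonglongrightarrow> f x * q x"
      using trunc_limit[of f] by eventually_elim (intro tendsto_intros)
    show "AE x in \<mu>. norm (?f n x * q x) \<le> \<bar>f x * q x\<bar>" for n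
      by (simp split: split_indicator)
  qed
  then have "(\<lambda>n. exp (- l * t) * (\<integral>x. ?f n x * q x \<partial>\<mu>)) \<longlonglongrightarrow> exp (- l * t) * (\<integral>x. f x * q x \<partial>\<mu>)"
    by (intro tendsto_intros)
  then have "(\<lambda>n. \<integral>x. S t (?f n) x * q x \<partial>\<mu>) \<longlonglongrightarrow> exp (- l * t) * (\<integral>x. f x * q x \<partial>\<mu>)"
    using inv[OF t sqint_finite_support(1)[OF f B(1,3)]] by simp
  ultimately show ?thesis by (rule LIMSEQ_unique)
qed

lemma compact_finite:
  assumes "compact K"
  shows "K \<in> sets \<mu>" "emeasure \<mu> K \<noteq> \<infinity>"
proof -
  show K: "K \<in> sets \<mu>" unfolding sets_mu using compact_imp_closed[OF assms] by (rule borel_closed)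
  have "\<exists>W. \<forall>x. open (W x) \<and> x \<in> W x \<and> emeasure \<mu> (W x) < \<infinity>"
    using loc_fin unfolding locally_finite_measure_def by (intro choice) blast
  then obtain W where W: "\<And>x. open (W x)" "\<And>x. x \<in> W x" "\<And>x. emeasure \<mu> (W x) < \<infinity>" by blast
  obtain F where F: "finite F" "K \<subseteq> (\<Union>x\<in>F. W x)"
    by (rule compactE_image[OF assms, of K W]) (use W in auto)
  have Ws: "W x \<in> sets \<mu>" for x unfolding sets_mu by (rule borel_open[OF W(1)])
  have "emeasure \<mu> K \<le> emeasure \<mu> (\<Union>x\<in>F. W x)"
    by (rule emeasure_mono[OF F(2)]) (intro sets.finite_UN F Ws)
  also have "\<dots> \<le> (\<Sum>x\<in>F. emeasure \<mu> (W x))"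
    by (rule emeasure_subadditive_finite[OF F(1)]) (use Ws in blast)
  also have "\<dots> < \<infinity>" using F(1) W(3) by simp
  finally show "emeasure \<mu> K \<noteq> \<infinity>" by simp
qed

text \<open>
  \<open>r\<close> bounds the distance of \<open>V n\<close> from the ground state projection as operators on \<open>L\<^sup>\<infinity>\<close>.
\<close>

definition error_le :: "nat \<Rightarrow> real \<Rightarrow> bool" where
  "error_le n r \<longleftrightarrow> (\<forall>f. ess_bdd \<mu> 1 f \<longrightarrow> (AE x in \<mu>. \<bar>V n f x - w f * p x\<bar> \<le> r))"

lemma w_lin:
  assumes "integrable \<mu> (\<lambda>x. f x * q x)" "integrable \<mu> (\<lambda>x. g x * q x)"
  shows "w (\<lambda>x. a * f x + b * g x) = a * w f + b * w g"
proof -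
  have "(\<lambda>x. (a * f x + b * g x) * q x) = (\<lambda>x. a * (f x * q x) + b * (g x * q x))"
    by (simp add: fun_eq_iff algebra_simps)
  then have "(\<integral>x. (a * f x + b * g x) * q x \<partial>\<mu>) = a * (\<integral>x. f x * q x \<partial>\<mu>) + b * (\<integral>x. g x * q x \<partial>\<mu>)"
    using assms by simp
  then show ?thesis by (simp add: w_def add_divide_distrib)
qed

lemma error_le_exists:
  assumes q: "integrable \<mu> q" and n: "n \<ge> 1"
  shows "\<exists>r\<ge>0. error_le n r"
proof -
  note t = nt0[OF n]
  have one: "ess_bdd \<mu> 1 (\<lambda>_. 1)" using ess_bdd_const[of \<mu> 1] by simp
  obtain D where D: "ess_bdd \<mu> D (S (real n * t\<^sub>0) (\<lambda>_. 1))" using ess_bdd_S[OF t one] .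
  obtain P where P: "\<And>x. p x \<le> P" using p_bdd by blast
  let ?e = "exp (l * (real n * t\<^sub>0))"
  define W where "W = (\<integral>x. q x \<partial>\<mu>) / (\<integral>x. p x * q x \<partial>\<mu>)"
  define r where "r = \<bar>?e * D + W * P\<bar>"
  have "AE x in \<mu>. \<bar>V n f x - w f * p x\<bar> \<le> r" if f: "ess_bdd \<mu> 1 f" for f
  proof -
    have wf: "\<bar>w f\<bar> \<le> W"
      using ess_bdd_q_int(2)[OF q f] pq_pos by (simp add: w_def W_def abs_divide divide_right_mono)
    have "AE x in \<mu>. \<bar>S (real n * t\<^sub>0) f x\<bar> \<le> S (real n * t\<^sub>0) (\<lambda>_. 1) x"
      by (rule S_abs_le[OF t f one f[unfolded ess_bdd_def, THEN conjunct2]])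
    with D[unfolded ess_bdd_def, THEN conjunct2] show ?thesis
    proof eventually_elim
      case (elim x)
      have "\<bar>V n f x\<bar> = ?e * \<bar>S (real n * t\<^sub>0) f x\<bar>" by (simp add: V_def abs_mult)
      also have "\<dots> \<le> ?e * D" using elim by (intro mult_left_mono) (linarith | simp)+
      finally have 1: "\<bar>V n f x\<bar> \<le> ?e * D" .
      have "\<bar>w f * p x\<bar> = \<bar>w f\<bar> * p x" by (simp add: abs_mult p_nonneg)
      also have "\<dots> \<le> W * P" using wf P[of x] p_nonneg[of x] by (intro mult_mono) linarith+
      finally have "\<bar>w f * p x\<bar> \<le> W * P" .
      with 1 show ?case unfolding r_def by linarith
    qed
  qed
  then have "error_le n r" unfolding error_le_def by blast
  moreover have "r \<ge> 0" by (simp add: r_def)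
  ultimately show ?thesis by blast
qed

text \<open>
  For \<open>\<bar>f\<bar> \<le> 1\<close> let \<open>g = V 1 f\<close>, which has the same projection as \<open>f\<close>. The decay at infinity provides a compact \<open>K\<close>
  off which \<open>\<bar>g\<bar> \<le> 1/2\<close>; this part contributes half of the previous error. The part on \<open>K\<close> is bounded with
  support of finite measure, so the estimate from \<open>L\<^sup>2\<close> to \<open>L\<^sup>\<infinity>\<close> applies to it.
\<close>

lemma error_le_recursion:
  assumes q: "integrable \<mu> q"
  shows "\<exists>E\<ge>0. \<forall>n r e. n \<ge> 1 \<longrightarrow> e \<ge> 0 \<longrightarrow> error_le n r \<longrightarrow>
    (\<forall>f. sqint \<mu> f \<longrightarrow> (AE x in \<mu>. \<bar>V n f x - w f * p x\<bar> \<le> e * l2n \<mu> f)) \<longrightarrow> error_le (Suc n) (e * E + r / 2)"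
proof -
  have one: "ess_bdd \<mu> 1 (\<lambda>_. 1)" using ess_bdd_const[of \<mu> 1] by simp
  have "0 < exp (- l * t\<^sub>0) / 2" by simp
  from decay[OF this] obtain K where K: "compact K" "\<And>x. x \<notin> K \<Longrightarrow> T t\<^sub>0 (\<lambda>_. 1) x \<le> exp (- l * t\<^sub>0) / 2"
    by (metis ComplI)
  note Ks = compact_finite[OF K(1)]
  have Kc: "- K \<in> sets \<mu>" using Ks(1) sets.compl_sets[of K \<mu>] by (simp add: Compl_eq_Diff_UNIV)
  obtain D where D: "ess_bdd \<mu> D (S t\<^sub>0 (\<lambda>_. 1))" using ess_bdd_S[OF t0 one] .
  define G where "G = exp (l * t\<^sub>0) * D"
  define E where "E = \<bar>G\<bar> * sqrt (measure \<mu> K)"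
  have "error_le (Suc n) (e * E + r / 2)"
    if n: "n \<ge> 1" and e: "e \<ge> 0" and error_le: "error_le n r"
      and L2: "\<And>f. sqint \<mu> f \<Longrightarrow> AE x in \<mu>. \<bar>V n f x - w f * p x\<bar> \<le> e * l2n \<mu> f" for n r e
    unfolding error_le_def
  proof (intro allI impI)
    fix f assume f: "ess_bdd \<mu> 1 f"
    note nt = nt0[OF n]
    define g where "g = (\<lambda>x. exp (l * t\<^sub>0) * S t\<^sub>0 f x)"
    have Sf1: "AE x in \<mu>. \<bar>S t\<^sub>0 f x\<bar> \<le> S t\<^sub>0 (\<lambda>_. 1) x"
      by (rule S_abs_le[OF t0 f one f[unfolded ess_bdd_def, THEN conjunct2]])
    have gm: "g \<in> borel_measurable \<mu>" unfolding g_def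
      by (intro borel_measurable_times borel_measurable_const S_meas[OF t0 ess_bdd_meas[OF f]])
    have "AE x in \<mu>. \<bar>g x\<bar> \<le> G"
      using Sf1 D[unfolded ess_bdd_def, THEN conjunct2]
    proof eventually_elim
      case (elim x)
      have "\<bar>g x\<bar> = exp (l * t\<^sub>0) * \<bar>S t\<^sub>0 f x\<bar>" by (simp add: g_def abs_mult)
      also have "\<dots> \<le> exp (l * t\<^sub>0) * D" using elim by (intro mult_left_mono) (linarith | simp)+
      finally show ?case by (simp add: G_def)
    qed
    then have g: "ess_bdd \<mu> G g" using gm by (simp add: ess_bdd_def)
    define g1 where "g1 = (\<lambda>x. indicator K x * g x)"
    \<comment> \<open>The factor \<open>2\<close> scales the part off \<open>K\<close> back to the unit ball, where the previous error bound applies.\<close>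
    define g2 where "g2 = (\<lambda>x. 2 * (indicator (- K) x * g x))"
    have g1_sq: "sqint \<mu> g1" and g1_n: "l2n \<mu> g1 \<le> E"
      unfolding g1_def E_def by (rule sqint_finite_support[OF g Ks])+
    have g1: "ess_bdd \<mu> G g1" unfolding g1_def by (rule ess_bdd_restrict[OF g Ks(1)])
    have g2m: "g2 \<in> borel_measurable \<mu>" unfolding g2_def
      by (intro borel_measurable_times borel_measurable_const borel_measurable_indicator Kc gm)
    have "AE x in \<mu>. \<bar>g2 x\<bar> \<le> 1"
      using Sf1 T_rep(4)[OF t0 one]
    proof eventually_elim
      case (elim x)
      show ?case
      proof (cases "x \<in> K")
        case True then show ?thesis by (simp add: g2_def)
      next
        case False
        have "\<bar>g2 x\<bar> = 2 * (exp (l * t\<^sub>0) * \<bar>S t\<^sub>0 f x\<bar>)" using False by (simp add: g2_def g_def abs_mult)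
        also have "\<dots> \<le> 2 * (exp (l * t\<^sub>0) * (exp (- l * t\<^sub>0) / 2))"
          using elim K(2)[OF False] by (intro mult_left_mono) (linarith | simp)+
        also have "\<dots> = exp (l * t\<^sub>0) * exp (- l * t\<^sub>0)" by simp
        also have "\<dots> = 1" by (simp flip: exp_add)
        finally show ?thesis .
      qed
    qed
    then have g2: "ess_bdd \<mu> 1 g2" using g2m by (simp add: ess_bdd_def)
    have g12: "g = (\<lambda>x. 1 * g1 x + (1/2) * g2 x)"
      by (simp add: fun_eq_iff g1_def g2_def split: split_indicator)
    have wg: "w g = w f"
    proof -
      have "(\<integral>x. g x * q x \<partial>\<mu>) = exp (l * t\<^sub>0) * (\<integral>x. S t\<^sub>0 f x * q x \<partial>\<mu>)"
        by (simp add: g_def mult.assoc)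
      also have "\<dots> = (exp (l * t\<^sub>0) * exp (- l * t\<^sub>0)) * (\<integral>x. f x * q x \<partial>\<mu>)"
        unfolding inv_ess_bdd[OF q t0 f] by simp
      also have "exp (l * t\<^sub>0) * exp (- l * t\<^sub>0) = 1" by (simp flip: exp_add)
      finally show ?thesis by (simp add: w_def)
    qed
    have wg': "w g = w g1 + 1/2 * w g2"
      unfolding g12 using w_lin[OF ess_bdd_q_int(1)[OF q g1] ess_bdd_q_int(1)[OF q g2], of 1 "1/2"] by simp
    have nn: "real (Suc n) * t\<^sub>0 = real n * t\<^sub>0 + t\<^sub>0" by (simp add: algebra_simps)
    have 1: "AE x in \<mu>. S (real n * t\<^sub>0 + t\<^sub>0) f x = S (real n * t\<^sub>0) (S t\<^sub>0 f) x"
      by (rule S_semigroup[OF nt t0 f])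
    obtain D' where D': "ess_bdd \<mu> D' (S t\<^sub>0 f)" using ess_bdd_S[OF t0 f] .
    have 2: "AE x in \<mu>. S (real n * t\<^sub>0) g x = exp (l * t\<^sub>0) * S (real n * t\<^sub>0) (S t\<^sub>0 f) x"
      using S_lin[OF S_int[OF nt D'] S_int[OF nt D'], of "exp (l * t\<^sub>0)" 0] by (simp add: g_def)
    have 3: "AE x in \<mu>. S (real n * t\<^sub>0) g x = 1 * S (real n * t\<^sub>0) g1 x + (1/2) * S (real n * t\<^sub>0) g2 x"
      unfolding g12 by (rule S_lin[OF S_int[OF nt g1] S_int[OF nt g2]])
    have 4: "AE x in \<mu>. \<bar>V n g2 x - w g2 * p x\<bar> \<le> r" using error_le g2 unfolding error_le_def by blast
    show "AE x in \<mu>. \<bar>V (Suc n) f x - w f * p x\<bar> \<le> e * E + r / 2"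
      using 1 2 3 4 L2[OF g1_sq]
    proof eventually_elim
      case (elim x)
      have "V (Suc n) f x = exp (l * (real n * t\<^sub>0)) * (exp (l * t\<^sub>0) * S (real n * t\<^sub>0) (S t\<^sub>0 f) x)"
        unfolding V_def nn elim(1) by (simp add: distrib_left exp_add)
      also have "\<dots> = exp (l * (real n * t\<^sub>0)) * (S (real n * t\<^sub>0) g1 x + 1/2 * S (real n * t\<^sub>0) g2 x)"
        using elim(2,3) by simp
      also have "\<dots> = V n g1 x + 1/2 * V n g2 x" by (simp add: V_def distrib_left)
      finally have eq: "V (Suc n) f x = V n g1 x + 1/2 * V n g2 x" .
      have "V (Suc n) f x - w f * p x = (V n g1 x - w g1 * p x) + 1/2 * (V n g2 x - w g2 * p x)"
        unfolding eq wg[symmetric] wg' by (simp add: algebra_simps)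
      moreover have "\<bar>V n g1 x - w g1 * p x\<bar> \<le> e * E"
        using elim(5) mult_left_mono[OF g1_n e] by linarith
      moreover have "\<bar>a + 1/2 * b\<bar> \<le> A + B / 2" if "\<bar>a\<bar> \<le> A" "\<bar>b\<bar> \<le> B" for a b A B :: real
        using that by linarith
      ultimately show ?case using elim(4) by simp
    qed
  qed
  moreover have "E \<ge> 0" by (simp add: E_def)
  ultimately show ?thesis by blast
qed

lemma error_le_mono: "error_le n r \<Longrightarrow> r \<le> s \<Longrightarrow> error_le n s"
  unfolding error_le_def by (fast elim: eventually_mono order_trans)

text \<open>
  Iterating \<open>r\<^sub>n\<^sub>+\<^sub>1 \<le> \<epsilon> / 4 + r\<^sub>n / 2\<close> gives \<open>r\<^sub>N\<^sub>+\<^sub>m \<le> \<epsilon> / 2 + r\<^sub>N / 2\<^sup>m\<close>.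
\<close>

theorem Linf_convergence:
  assumes q: "integrable \<mu> q" and \<epsilon>: "\<epsilon> > 0"
  shows "\<exists>N\<ge>1. \<forall>n\<ge>N. error_le n \<epsilon>"
proof -
  obtain E where E: "E \<ge> 0" and rec: "\<And>n r e. n \<ge> 1 \<Longrightarrow> e \<ge> 0 \<Longrightarrow> error_le n r \<Longrightarrow>
    (\<And>f. sqint \<mu> f \<Longrightarrow> AE x in \<mu>. \<bar>V n f x - w f * p x\<bar> \<le> e * l2n \<mu> f) \<Longrightarrow> error_le (Suc n) (e * E + r / 2)"
    using error_le_recursion[OF q] by blast
  define e where "e = \<epsilon> / 4 / (E + 1)"
  have e: "e > 0" using \<epsilon> E by (simp add: e_def)
  have eE: "e * E \<le> \<epsilon> / 4"
  proof -
    have "e * E \<le> e * (E + 1)" using e by simp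
    also have "\<dots> = \<epsilon> / 4"
      unfolding e_def by (rule nonzero_eq_divide_eq[THEN iffD1, OF _ refl]) (use E in linarith)
    finally show ?thesis .
  qed
  obtain N where N: "N \<ge> 1"
    "\<And>n f. n \<ge> N \<Longrightarrow> sqint \<mu> f \<Longrightarrow> AE x in \<mu>. \<bar>V n f x - w f * p x\<bar> \<le> e * l2n \<mu> f"
    using V_bound_L2_Linf[OF e] by blast
  obtain r where r: "r \<ge> 0" "error_le N r" using error_le_exists[OF q N(1)] by blast
  have step: "error_le (N + m) (\<epsilon> / 2 + r / 2 ^ m)" for m
  proof (induction m)
    case 0
    have "error_le N (\<epsilon> / 2 + r / 2 ^ 0)" by (rule error_le_mono[OF r(2)]) (use \<epsilon> in simp)
    then show ?case by (simp only: add_0_right)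
  next
    case (Suc m)
    have "error_le (Suc (N + m)) (e * E + (\<epsilon> / 2 + r / 2 ^ m) / 2)"
      by (rule rec[OF _ _ Suc]) (use N e in simp_all)
    then have "error_le (N + Suc m) (e * E + (\<epsilon> / 2 + r / 2 ^ m) / 2)" by simp
    moreover have "e * E + (\<epsilon> / 2 + r / 2 ^ m) / 2 \<le> \<epsilon> / 2 + r / 2 ^ Suc m"
      using eE by (simp add: add_divide_distrib)
    ultimately show ?case by (rule error_le_mono)
  qed
  obtain m where m: "2 * r / \<epsilon> < 2 ^ m" using real_arch_pow[of 2 "2 * r / \<epsilon>"] by auto
  have "error_le n \<epsilon>" if n: "n \<ge> N + m" for n
  proof -
    have "(2::real) ^ m \<le> 2 ^ (n - N)" using n by (intro power_increasing) simp_all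
    then have "2 * r / \<epsilon> \<le> 2 ^ (n - N)" using m by linarith
    then have "2 * r \<le> 2 ^ (n - N) * \<epsilon>" using \<epsilon> by (simp add: pos_divide_le_eq)
    then have "r / 2 ^ (n - N) \<le> \<epsilon> / 2" by (simp add: field_simps)
    then have le: "\<epsilon> / 2 + r / 2 ^ (n - N) \<le> \<epsilon>" by linarith
    show ?thesis using error_le_mono[OF step[of "n - N"] le] n by simp
  qed
  then show ?thesis using N(1) by (intro exI[of _ "N + m"]) simp
qed

text \<open>
  The time \<open>t\<close> is split as \<open>s + n * t\<^sub>0\<close> with \<open>s \<ge> t / 2\<close>. The part \<open>n * t\<^sub>0\<close> makes the error uniformly
  small, and the part \<open>s\<close> turns a uniformly small error into a small multiple of \<open>p\<close> on \<open>K (t / 2)\<close>,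
  because there \<open>T s 1\<close> is at most a multiple of \<open>p\<close>. Taking a multiple of \<open>t\<^sub>0\<close> for the first part makes the
  convergence along a sequence of times sufficient.
\<close>

theorem progressive_estimate:
  assumes exh: "exhausting_family t\<^sub>1 K" and C: "C > 0"
    and dom: "\<And>t x. t \<ge> t\<^sub>1 \<Longrightarrow> x \<in> K t \<Longrightarrow> T t (\<lambda>_. 1) x \<le> C * exp (- l * t) * p x"
    and \<epsilon>: "\<epsilon> > 0"
  shows "\<exists>t\<^sub>2. \<forall>t\<ge>t\<^sub>2. \<forall>x\<in>K (t/2). \<forall>f. ess_bdd \<mu> 1 f \<longrightarrow>
    \<bar>exp (l * t) * T t f x - w f * p x\<bar> \<le> \<epsilon> * p x"
proof -
  have q: "integrable \<mu> q" by (rule q_integrable[OF exh C dom])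
  have one: "ess_bdd \<mu> 1 (\<lambda>_. 1)" using ess_bdd_const[of \<mu> 1] by simp
  define r where "r = \<epsilon> / C"
  have r: "r > 0" using \<epsilon> C by (simp add: r_def)
  obtain N where N: "N \<ge> 1" "\<And>n. n \<ge> N \<Longrightarrow> error_le n r" using Linf_convergence[OF q r] by blast
  obtain P where P: "\<And>x. p x \<le> P" using p_bdd by blast
  have pb: "ess_bdd \<mu> P p" unfolding ess_bdd_def
    using P p_nonneg sqint_meas[OF p_sq] by (simp add: abs_of_nonneg)
  \<comment> \<open>These bounds ensure \<open>t / 2 \<ge> t\<^sub>1\<close>, \<open>t > 0\<close> and at least \<open>N\<close> steps in the first part.\<close>
  define t\<^sub>2 where "t\<^sub>2 = max (max (2 * t\<^sub>1) 1) (2 * t\<^sub>0 * (real N + 1))"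
  have "\<bar>exp (l * t) * T t f x - w f * p x\<bar> \<le> \<epsilon> * p x"
    if t: "t \<ge> t\<^sub>2" and x: "x \<in> K (t/2)" and f: "ess_bdd \<mu> 1 f" for t x f
  proof -
    have t': "t \<ge> 2 * t\<^sub>1" "t \<ge> 1" "t \<ge> 2 * t\<^sub>0 * (real N + 1)" using t by (auto simp: t\<^sub>2_def)
    define n where "n = nat \<lfloor>t / (2 * t\<^sub>0)\<rfloor>"
    have tq: "t / (2 * t\<^sub>0) \<ge> real N + 1" using t'(3) t0 by (simp add: pos_le_divide_eq mult.commute)
    then have fl: "\<lfloor>t / (2 * t\<^sub>0)\<rfloor> \<ge> int N" by (simp add: le_floor_iff)
    then have nN: "n \<ge> N" unfolding n_def by linarith
    have "real n = of_int \<lfloor>t / (2 * t\<^sub>0)\<rfloor>" unfolding n_def using fl by simp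
    then have "real n \<le> t / (2 * t\<^sub>0)" by linarith
    then have nt2: "real n * t\<^sub>0 \<le> t / 2" using t0 by (simp add: field_simps)
    define s where "s = t - real n * t\<^sub>0"
    have s: "s \<ge> t / 2" "s \<ge> t\<^sub>1" "s > 0" using nt2 t'(1,2) by (simp_all add: s_def)
    have n1: "n \<ge> 1" using nN N(1) by simp
    note nt = nt0[OF n1]
    have tpos: "t > 0" using t'(2) by simp
    have xs: "x \<in> K s"
      using exhausting_mono[OF exh _ s(1)] t'(1) x by auto
    define h where "h = (\<lambda>x. V n f x - w f * p x)"
    obtain D where D: "ess_bdd \<mu> D (S (real n * t\<^sub>0) f)" using ess_bdd_S[OF nt f] .
    let ?e = "exp (l * (real n * t\<^sub>0))"
    have h_eq: "h = (\<lambda>x. ?e * S (real n * t\<^sub>0) f x + (- w f) * p x)" by (simp add: h_def V_def fun_eq_iff)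
    have hm: "h \<in> borel_measurable \<mu>" unfolding h_eq by (rule ess_bdd_meas[OF ess_bdd_lin[OF D pb]])
    have "AE x in \<mu>. \<bar>h x\<bar> \<le> r" unfolding h_def using N(2)[OF nN] f unfolding error_le_def by blast
    then have h: "ess_bdd \<mu> r h" using hm by (simp add: ess_bdd_def)
    have rb: "ess_bdd \<mu> \<bar>r\<bar> (\<lambda>_. r)" by (rule ess_bdd_const)
    have 1: "AE x in \<mu>. \<bar>S s h x\<bar> \<le> S s (\<lambda>_. r) x"
      by (rule S_abs_le[OF s(3) h rb h[unfolded ess_bdd_def, THEN conjunct2]])
    have 2: "AE x in \<mu>. S s (\<lambda>_. r) x = r * S s (\<lambda>_. 1) x"
      using S_lin[OF S_int[OF s(3) one] S_int[OF s(3) one], of r 0] by simp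
    have 3: "AE x in \<mu>. S s h x = ?e * S s (S (real n * t\<^sub>0) f) x + (- w f) * S s p x"
      unfolding h_eq by (rule S_lin[OF S_int[OF s(3) D] S_int[OF s(3) pb]])
    have ts: "t = s + real n * t\<^sub>0" by (simp add: s_def)
    have 4: "AE x in \<mu>. S t f x = S s (S (real n * t\<^sub>0) f) x"
      unfolding ts by (rule S_semigroup[OF s(3) nt f])
    have "AE x in \<mu>. \<bar>exp (l * t) * T t f x - w f * p x\<bar> \<le> r * exp (l * s) * T s (\<lambda>_. 1) x"
      using 1 2 3 4 eig[OF s(3)] T_rep(4)[OF tpos f] T_rep(4)[OF s(3) one]
    proof eventually_elim
      case (elim x)
      have e1: "exp (l * t) = exp (l * s) * ?e" unfolding ts by (simp add: distrib_left exp_add)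
      have e2: "exp (l * s) * exp (- l * s) = 1" by (simp flip: exp_add)
      have "exp (l * t) * T t f x - w f * p x
          = exp (l * s) * ?e * S s (S (real n * t\<^sub>0) f) x - w f * (exp (l * s) * exp (- l * s)) * p x"
        unfolding elim(6) elim(4) e1 e2 by simp
      also have "\<dots> = exp (l * s) * S s h x"
        unfolding elim(3) elim(5) by (simp add: algebra_simps)
      finally have "\<bar>exp (l * t) * T t f x - w f * p x\<bar> = exp (l * s) * \<bar>S s h x\<bar>"
        by (simp add: abs_mult)
      also have "\<dots> \<le> exp (l * s) * (r * T s (\<lambda>_. 1) x)"
        using elim(1,2,7) by (intro mult_left_mono) simp_all
      finally show ?case by (simp add: mult_ac)
    qed
    then have "\<bar>exp (l * t) * T t f x - w f * p x\<bar> \<le> r * exp (l * s) * T s (\<lambda>_. 1) x"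
      by (rule AE_le_everywhere[rotated 2])
        (intro continuous_intros T_rep(2)[OF tpos f] T_rep(2)[OF s(3) one] p_cont)+
    also have "\<dots> \<le> r * exp (l * s) * (C * exp (- l * s) * p x)"
      using dom[OF s(2) xs] r by (intro mult_left_mono) simp_all
    also have "\<dots> = r * C * (exp (l * s) * exp (- l * s)) * p x" by simp
    also have "exp (l * s) * exp (- l * s) = 1" by (simp flip: exp_add)
    finally show ?thesis using C by (simp add: r_def)
  qed
  then show ?thesis by blast
qed

end

section \<open>Ratios, the quasi-ergodic measure and the converse implication\<close>

lemma ratio_bound:
  fixes a b P v v0 e :: real
  assumes P: "P > 0" and v0: "v0 > 0" and e: "0 \<le> e" "e \<le> v0 / 2"
    and a: "\<bar>a - v * P\<bar> \<le> e * P" and b: "\<bar>b - v0 * P\<bar> \<le> e * P" and v: "\<bar>v\<bar> \<le> v0"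
  shows "\<bar>a / b - v / v0\<bar> \<le> 4 * e / v0"
proof -
  have "e * P \<le> v0 / 2 * P" using e P by (intro mult_right_mono) simp_all
  then have bl: "v0 * P / 2 \<le> b" using b by (simp add: abs_le_iff)
  have bp: "b > 0" by (rule less_le_trans[OF _ bl]) (use P v0 in simp)
  have eq: "a / b - v / v0 = ((a - v * P) * v0 - v * (b - v0 * P)) / (b * v0)"
    using bp v0 by (simp add: field_simps)
  have num: "\<bar>(a - v * P) * v0 - v * (b - v0 * P)\<bar> \<le> 2 * e * P * v0"
  proof -
    have "\<bar>(a - v * P) * v0\<bar> \<le> e * P * v0"
      using a v0 by (simp add: abs_mult mult_right_mono)
    moreover have "\<bar>v * (b - v0 * P)\<bar> \<le> v0 * (e * P)"
      unfolding abs_mult using v b v0 by (intro mult_mono) simp_all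
    ultimately show ?thesis by (simp add: mult_ac)
  qed
  have "\<bar>a / b - v / v0\<bar> = \<bar>(a - v * P) * v0 - v * (b - v0 * P)\<bar> / (b * v0)"
    unfolding eq using bp v0 by (simp add: abs_divide)
  also have "\<dots> \<le> (2 * e * P * v0) / (b * v0)"
    using num bp v0 by (intro divide_right_mono) simp_all
  also have "\<dots> = 2 * e * P / b" using v0 by simp
  also have "\<dots> \<le> 2 * e * P / (v0 * P / 2)"
    using bl e P v0 by (intro divide_left_mono mult_pos_pos bp) simp_all
  also have "\<dots> = 4 * e / v0" using P by simp
  finally show ?thesis .
qed

text \<open>
  A compact set is covered by finitely many open sets, each contained in a compact set. The union of these
  compact sets lies in some \<open>K s\<close>, so the given set lies in the interior of \<open>K s\<close>.
\<close>

lemma exhausting_closure_interior: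
  fixes K :: "real \<Rightarrow> 'a::metric_space set"
  assumes lc: "locally_compact_space (euclidean :: 'a topology)"
    and exh: "exhausting_family t\<^sub>1 K" and t: "t\<^sub>1 \<le> t\<^sub>2"
  shows "exhausting_family t\<^sub>2 (\<lambda>t. closure (interior (K t)))"
proof -
  have cpt: "compact (K t)" if "t \<ge> t\<^sub>1" for t using exh that unfolding exhausting_family_def by simp
  have sub: "\<exists>s\<ge>t\<^sub>2. L \<subseteq> closure (interior (K s))" if L: "compact L" for L
  proof -
    have "\<exists>z. open (fst z) \<and> compact (snd z) \<and> x \<in> fst z \<and> fst z \<subseteq> snd z" for x :: 'a
    proof -
      have "\<exists>U. open U \<and> (\<exists>C. compact C \<and> x \<in> U \<and> U \<subseteq> C)"
        using lc[unfolded locally_compact_space_def, simplified, rule_format, of x] .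
      then obtain U C where "open U" "compact C" "x \<in> U" "U \<subseteq> C" by (elim exE conjE) (rule that)
      then show ?thesis by (intro exI[of _ "(U, C)"]) simp
    qed
    then have "\<exists>z. \<forall>x::'a. open (fst (z x)) \<and> compact (snd (z x)) \<and> x \<in> fst (z x) \<and> fst (z x) \<subseteq> snd (z x)"
      by (intro choice allI)
    then obtain z where z: "\<And>x::'a. open (fst (z x)) \<and> compact (snd (z x)) \<and> x \<in> fst (z x) \<and> fst (z x) \<subseteq> snd (z x)"
      by (elim exE) (rule that, erule spec)
    define U where "U x = fst (z x)" for x
    define C where "C x = snd (z x)" for x
    have UC: "\<And>x. open (U x)" "\<And>x. compact (C x)" "\<And>x. x \<in> U x" "\<And>x. U x \<subseteq> C x"
      using z by (simp_all add: U_def C_def)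
    obtain F where F: "finite F" "L \<subseteq> (\<Union>x\<in>F. U x)"
      by (rule compactE_image[OF L, of L U]) (use UC(1,3) in auto)
    have "compact (\<Union>x\<in>F. C x)" using F(1) UC(2) by (intro compact_UN) simp_all
    then obtain s where s: "s \<ge> t\<^sub>1" "(\<Union>x\<in>F. C x) \<subseteq> K s"
      using exhausting_compact[OF exh] by blast
    define s' where "s' = max s t\<^sub>2"
    have "(\<Union>x\<in>F. U x) \<subseteq> K s'"
      using s(2) UC(4) exhausting_mono[OF exh s(1), of s'] by (fastforce simp: s'_def)
    then have "(\<Union>x\<in>F. U x) \<subseteq> interior (K s')"
      by (intro interior_maximal open_UN ballI UC(1))
    then have "L \<subseteq> closure (interior (K s'))"
      using F(2) closure_subset[of "interior (K s')"] by blast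
    then show ?thesis by (intro exI[of _ s']) (simp add: s'_def)
  qed
  show ?thesis
    unfolding exhausting_family_def
  proof (intro conjI allI impI)
    fix t assume t2: "t\<^sub>2 \<le> t"
    have "closure (interior (K t)) \<subseteq> K t"
      using compact_imp_closed[OF cpt, of t] t t2 interior_subset by (intro closure_minimal) simp_all
    then show "compact (closure (interior (K t)))"
      using compact_Int_closed[OF cpt closed_closure, of t "interior (K t)"] t t2
      by (simp add: Int_absorb1)
  next
    fix t s assume ts: "t\<^sub>2 \<le> t \<and> t < s"
    show "closure (interior (K t)) \<subseteq> closure (interior (K s))"
      using exhausting_mono[OF exh, of t s] ts t by (intro closure_mono interior_mono) simp
  next
    show "(\<Union>t\<in>{t\<^sub>2..}. closure (interior (K t))) = UNIV"
    proof (rule UNIV_eq_I[symmetric])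
      fix x show "x \<in> (\<Union>t\<in>{t\<^sub>2..}. closure (interior (K t)))"
        using sub[OF compact_sing[of x]] by auto
    qed
  next
    fix L :: "'a set" assume "compact L"
    then show "\<exists>t\<ge>t\<^sub>2. L \<subseteq> closure (interior (K t))" by (rule sub)
  qed
qed

context ground_state_semigroup begin

lemma T_nonneg:
  assumes t: "t > 0"
  shows "0 \<le> T t (\<lambda>_. 1) x"
proof (rule AE_le_everywhere)
  have one: "ess_bdd \<mu> 1 (\<lambda>_. 1)" using ess_bdd_const[of \<mu> 1] by simp
  show "continuous_on UNIV (T t (\<lambda>_. 1))" by (rule T_rep(2)[OF t one])
  have "AE x in \<mu>. 0 \<le> S t (\<lambda>_. 1) x" by (rule S_nonneg[OF t one]) simp
  with T_rep(4)[OF t one] show "AE x in \<mu>. 0 \<le> T t (\<lambda>_. 1) x" by eventually_elim simp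
qed simp

lemma Linf_op_one: "t > 0 \<Longrightarrow> Linf_op \<mu> (k t) (\<lambda>_. 1) = (\<lambda>x. complex_of_real (T t (\<lambda>_. 1) x))"
  using T_rep(1)[of t 1 "\<lambda>_. 1"] ess_bdd_const[of \<mu> 1] by simp

lemma pGSD_real:
  "pGSD \<mu> k l (\<lambda>x. complex_of_real (p x)) \<longleftrightarrow>
    (\<exists>C>0. \<exists>t\<^sub>1>0. \<exists>K. exhausting_family t\<^sub>1 K \<and>
      (\<forall>t\<ge>t\<^sub>1. \<forall>x\<in>K t. T t (\<lambda>_. 1) x \<le> C * exp (- l * t) * p x))"
proof -
  have eq: "(\<forall>x. indicator A x * Linf_op \<mu> (k t) (\<lambda>_. 1) x \<le> complex_of_real (C * exp (- l * t)) * complex_of_real (p x))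
      \<longleftrightarrow> (\<forall>x\<in>A. T t (\<lambda>_. 1) x \<le> C * exp (- l * t) * p x)"
    if t: "t > 0" and C: "C > 0" for A t C
  proof -
    have "indicator A x * Linf_op \<mu> (k t) (\<lambda>_. 1) x \<le> complex_of_real (C * exp (- l * t)) * complex_of_real (p x)
      \<longleftrightarrow> (x \<in> A \<longrightarrow> T t (\<lambda>_. 1) x \<le> C * exp (- l * t) * p x)" for x
      using C p_nonneg[of x] unfolding Linf_op_one[OF t]
      by (cases "x \<in> A") (simp_all add: less_eq_complex_def)
    then show ?thesis by blast
  qed
  show ?thesis
    unfolding pGSD_def by (intro ex_cong1 conj_cong refl all_cong1 imp_cong eq) linarith+
qed

lemma q_integral_pos:
  assumes "integrable \<mu> q"
  shows "0 < (\<integral>x. q x \<partial>\<mu>)"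
proof -
  have "0 \<le> (\<integral>x. q x \<partial>\<mu>)" using q_nonneg by simp
  moreover have "(\<integral>x. q x \<partial>\<mu>) \<noteq> 0"
  proof
    assume "(\<integral>x. q x \<partial>\<mu>) = 0"
    then have "AE x in \<mu>. q x = 0"
      using integral_nonneg_eq_0_iff_AE[OF assms] q_nonneg by simp
    with q_pos have "AE x in \<mu>. False" by eventually_elim simp
    then show False using AE_witness by blast
  qed
  ultimately show ?thesis by linarith
qed

text \<open>
  The limit measure \<open>\<rho>\<close> of the normalized semigroup.
\<close>

definition quasi_ergodic :: "'a measure" where
  "quasi_ergodic = density \<mu> (\<lambda>x. ennreal (q x / (\<integral>x. q x \<partial>\<mu>)))"

lemma quasi_ergodic_prob:
  assumes q: "integrable \<mu> q"
  shows "prob_space quasi_ergodic" "sets quasi_ergodic = sets borel" "topological_support quasi_ergodic = UNIV"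
proof -
  let ?I = "\<integral>x. q x \<partial>\<mu>"
  have I: "?I > 0" by (rule q_integral_pos[OF q])
  have qm: "q \<in> borel_measurable \<mu>" by (rule sqint_meas[OF q_sq])
  have dm: "(\<lambda>x. ennreal (q x / ?I)) \<in> borel_measurable \<mu>" using qm by simp
  show "sets quasi_ergodic = sets borel" by (simp add: quasi_ergodic_def sets_mu)
  show "prob_space quasi_ergodic"
  proof (rule prob_spaceI)
    have "emeasure quasi_ergodic (space quasi_ergodic) = (\<integral>\<^sup>+x. ennreal (q x / ?I) \<partial>\<mu>)"
      unfolding quasi_ergodic_def space_density
      by (subst emeasure_density[OF dm sets.top]) (auto intro!: nn_integral_cong)
    also have "\<dots> = ennreal (\<integral>x. q x / ?I \<partial>\<mu>)"
      using q q_nonneg I by (intro nn_integral_eq_integral) simp_all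
    also have "(\<integral>x. q x / ?I \<partial>\<mu>) = 1" using I by simp
    finally show "emeasure quasi_ergodic (space quasi_ergodic) = 1" by simp
  qed
  have "0 < emeasure quasi_ergodic V" if V: "open V" "x \<in> V" for V x
  proof (rule ccontr)
    have Vs: "V \<in> sets \<mu>" unfolding sets_mu by (rule borel_open[OF V(1)])
    assume "\<not> ?thesis"
    then have "emeasure quasi_ergodic V = 0" by simp
    then have "(\<integral>\<^sup>+x. ennreal (q x / ?I) * indicator V x \<partial>\<mu>) = 0"
      unfolding quasi_ergodic_def using emeasure_density[OF dm Vs] by simp
    then have "AE x in \<mu>. ennreal (q x / ?I) * indicator V x = 0"
      using dm Vs by (subst (asm) nn_integral_0_iff_AE) simp_all
    then have "AE x in \<mu>. x \<notin> V"
      using q_pos by eventually_elim (use I in \<open>auto simp: ennreal_eq_0_iff divide_le_0_iff split: split_indicator_asm\<close>)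
    then have "V = {}" by (rule null_open_empty[OF V(1)])
    then show False using V(2) by simp
  qed
  then show "topological_support quasi_ergodic = UNIV"
    unfolding topological_support_def by auto
qed

lemma quasi_ergodic_integral:
  fixes f :: "'a \<Rightarrow> complex"
  assumes q: "integrable \<mu> q" and f: "f \<in> borel_measurable \<mu>"
    and r: "ess_bdd \<mu> C (\<lambda>x. Re (f x))" and i: "ess_bdd \<mu> D (\<lambda>x. Im (f x))"
  shows "(\<integral>x. f x \<partial>quasi_ergodic)
    = Complex (w (\<lambda>x. Re (f x)) / w (\<lambda>_. 1)) (w (\<lambda>x. Im (f x)) / w (\<lambda>_. 1))"
proof -
  let ?I = "\<integral>x. q x \<partial>\<mu>"
  have I: "?I > 0" by (rule q_integral_pos[OF q])
  have qm: "q \<in> borel_measurable \<mu>" by (rule sqint_meas[OF q_sq])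
  have "(\<integral>x. f x \<partial>quasi_ergodic) = (\<integral>x. (q x / ?I) *\<^sub>R f x \<partial>\<mu>)"
    unfolding quasi_ergodic_def using qm q_nonneg I f by (intro integral_density) simp_all
  also have "(\<lambda>x. (q x / ?I) *\<^sub>R f x) = (\<lambda>x. complex_of_real (Re (f x) * q x / ?I) + \<i> * complex_of_real (Im (f x) * q x / ?I))"
    by (auto simp: fun_eq_iff complex_eq_iff)
  also have "(\<integral>x. complex_of_real (Re (f x) * q x / ?I) + \<i> * complex_of_real (Im (f x) * q x / ?I) \<partial>\<mu>)
    = complex_of_real (\<integral>x. Re (f x) * q x / ?I \<partial>\<mu>) + \<i> * complex_of_real (\<integral>x. Im (f x) * q x / ?I \<partial>\<mu>)"
  proof -
    have r': "integrable \<mu> (\<lambda>x. complex_of_real (Re (f x) * q x / ?I))"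
      using ess_bdd_q_int(1)[OF q r] by (subst complex_of_real_integrable_eq) simp
    have i': "integrable \<mu> (\<lambda>x. complex_of_real (Im (f x) * q x / ?I))"
      using ess_bdd_q_int(1)[OF q i] by (subst complex_of_real_integrable_eq) simp
    have "(\<integral>x. complex_of_real (Re (f x) * q x / ?I) + \<i> * complex_of_real (Im (f x) * q x / ?I) \<partial>\<mu>)
      = (\<integral>x. complex_of_real (Re (f x) * q x / ?I) \<partial>\<mu>) + (\<integral>x. \<i> * complex_of_real (Im (f x) * q x / ?I) \<partial>\<mu>)"
      by (rule Bochner_Integration.integral_add[OF r']) (rule integrable_mult_right[OF i'])
    also have "(\<integral>x. \<i> * complex_of_real (Im (f x) * q x / ?I) \<partial>\<mu>) = \<i> * (\<integral>x. complex_of_real (Im (f x) * q x / ?I) \<partial>\<mu>)"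
      by (rule Bochner_Integration.integral_mult_right_zero)
    finally show ?thesis by (simp only: integral_complex_of_real)
  qed
  also have "\<dots> = Complex (w (\<lambda>x. Re (f x)) / w (\<lambda>_. 1)) (w (\<lambda>x. Im (f x)) / w (\<lambda>_. 1))"
    using pq_pos by (simp add: complex_eq_iff w_def)
  finally show ?thesis .
qed

text \<open>
  Dividing the estimate for \<open>f\<close> by the one for the constant \<open>1\<close> cancels \<open>exp (l * t)\<close> and \<open>p x\<close>; complex
  \<open>f\<close> are treated through real and imaginary part.
\<close>

theorem pGSD_imp_convergence:
  assumes exh: "exhausting_family t\<^sub>1 K" and C: "C > 0"
    and dom: "\<And>t x. t \<ge> t\<^sub>1 \<Longrightarrow> x \<in> K t \<Longrightarrow> T t (\<lambda>_. 1) x \<le> C * exp (- l * t) * p x"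
    and N: "{x. p x = 0} \<subseteq> N"
    and K': "\<And>t. t \<ge> t\<^sub>3 \<Longrightarrow> K' t \<subseteq> K (t / 2)"
  shows "progressive_uniform_convergence \<mu> k K' N quasi_ergodic"
proof -
  have q: "integrable \<mu> q" by (rule q_integrable[OF exh C dom])
  have one: "ess_bdd \<mu> 1 (\<lambda>_. 1)" using ess_bdd_const[of \<mu> 1] by simp
  define v0 where "v0 = w (\<lambda>_. 1)"
  have v0: "v0 > 0" using q_integral_pos[OF q] pq_pos by (simp add: v0_def w_def)
  have wv: "\<bar>w f\<bar> \<le> v0" if "ess_bdd \<mu> 1 f" for f
    using ess_bdd_q_int(2)[OF q that] pq_pos by (simp add: v0_def w_def abs_divide divide_right_mono)
  let ?g = "\<lambda>t x f. cmod (Linf_op \<mu> (k t) f x / Linf_op \<mu> (k t) (\<lambda>_. 1) x - (\<integral>y. f y \<partial>quasi_ergodic))"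
  have main: "\<forall>\<^sub>F t in at_top. (SUP x\<in>K' t - N. SUP f\<in>Linf_unit_ball \<mu>. ennreal (?g t x f)) \<le> ennreal \<delta>"
    if \<delta>: "\<delta> > 0" for \<delta>
  proof -
    \<comment> \<open>\<open>ratio_bound\<close> needs \<open>e \<le> v0 / 2\<close>, and costs \<open>4 * e / v0\<close> for each of real and imaginary part.\<close>
    define e where "e = min (v0 / 2) (\<delta> * v0 / 8)"
    have e: "e > 0" "e \<le> v0 / 2" "8 * e / v0 \<le> \<delta>" using v0 \<delta> by (auto simp: e_def min_def field_simps)
    obtain t\<^sub>2 where t2: "\<And>t x f. t \<ge> t\<^sub>2 \<Longrightarrow> x \<in> K (t/2) \<Longrightarrow> ess_bdd \<mu> 1 f \<Longrightarrow>
        \<bar>exp (l * t) * T t f x - w f * p x\<bar> \<le> e * p x"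
      using progressive_estimate[OF exh C dom e(1)] by blast
    have "?g t x f \<le> \<delta>" if t: "t \<ge> max (max t\<^sub>2 t\<^sub>3) 1" and x: "x \<in> K' t - N" and f: "f \<in> Linf_unit_ball \<mu>" for t x f
    proof -
      have t': "t \<ge> t\<^sub>2" "t \<ge> t\<^sub>3" "t > 0" using t by auto
      have xK: "x \<in> K (t/2)" using K'[OF t'(2)] x by blast
      have px: "p x > 0" using N x p_nonneg[of x] by (metis (mono_tags) DiffD2 less_eq_real_def mem_Collect_eq subset_eq)
      have fm: "f \<in> borel_measurable \<mu>" "AE x in \<mu>. cmod (f x) \<le> 1" and fL: "f \<in> Linf \<mu>"
        using f by (auto simp: Linf_unit_ball_def Linf_def)
      let ?r = "\<lambda>x. Re (f x)" and ?i = "\<lambda>x. Im (f x)"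
      have r: "ess_bdd \<mu> 1 ?r" unfolding ess_bdd_def
      proof
        show "AE x in \<mu>. \<bar>Re (f x)\<bar> \<le> 1"
          using fm(2) by eventually_elim (rule order_trans[OF abs_Re_le_cmod])
      qed (use fm(1) in simp)
      have i: "ess_bdd \<mu> 1 ?i" unfolding ess_bdd_def
      proof
        show "AE x in \<mu>. \<bar>Im (f x)\<bar> \<le> 1"
          using fm(2) by eventually_elim (rule order_trans[OF abs_Im_le_cmod])
      qed (use fm(1) in simp)
      have quot: "\<bar>T t g x / T t (\<lambda>_. 1) x - w g / v0\<bar> \<le> 4 * e / v0" if g: "ess_bdd \<mu> 1 g" for g
      proof -
        have "\<bar>(exp (l * t) * T t g x) / (exp (l * t) * T t (\<lambda>_. 1) x) - w g / v0\<bar> \<le> 4 * e / v0"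
          by (rule ratio_bound[OF px v0 less_imp_le[OF e(1)] e(2) t2[OF t'(1) xK g]
                t2[OF t'(1) xK one, folded v0_def] wv[OF g]])
        then show ?thesis by simp
      qed
      let ?z = "Linf_op \<mu> (k t) f x / Linf_op \<mu> (k t) (\<lambda>_. 1) x - (\<integral>y. f y \<partial>quasi_ergodic)"
      have z: "?z = Complex (T t ?r x / T t (\<lambda>_. 1) x - w ?r / v0) (T t ?i x / T t (\<lambda>_. 1) x - w ?i / v0)"
        unfolding Linf_op_one[OF t'(3)] Linf_op_complex[OF t'(3) fL r i] quasi_ergodic_integral[OF q fm(1) r i]
        by (simp add: complex_eq_iff v0_def Re_divide_of_real Im_divide_of_real)
      have "cmod ?z \<le> \<bar>Re ?z\<bar> + \<bar>Im ?z\<bar>" by (rule cmod_le)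
      also have "\<dots> \<le> 4 * e / v0 + 4 * e / v0"
        unfolding z complex.sel by (intro add_mono quot r i)
      also have "\<dots> \<le> \<delta>" using e(3) by simp
      finally show ?thesis .
    qed
    then have "(SUP x\<in>K' t - N. SUP f\<in>Linf_unit_ball \<mu>. ennreal (?g t x f)) \<le> ennreal \<delta>"
      if "t \<ge> max (max t\<^sub>2 t\<^sub>3) 1" for t
      using that by (intro SUP_least ennreal_leI)
    then show ?thesis using eventually_ge_at_top[of "max (max t\<^sub>2 t\<^sub>3) 1"] by (auto elim: eventually_mono)
  qed
  show ?thesis
    unfolding progressive_uniform_convergence_def
  proof (rule order_tendstoI)
    fix a :: ennreal assume "0 < a"
    then obtain b where b: "0 < b" "b < a" using dense by blast
    then have bt: "b < \<top>" by (meson less_le_trans top_greatest)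
    have "enn2real b > 0" using b(1) bt by (simp add: enn2real_positive_iff)
    from main[OF this] have "\<forall>\<^sub>F t in at_top. (SUP x\<in>K' t - N. SUP f\<in>Linf_unit_ball \<mu>. ennreal (?g t x f)) \<le> b"
      using bt by (simp add: ennreal_enn2real)
    then show "\<forall>\<^sub>F t in at_top. (SUP x\<in>K' t - N. SUP f\<in>Linf_unit_ball \<mu>. ennreal (?g t x f)) < a"
      by eventually_elim (rule le_less_trans[OF _ b(2)])
  qed simp
qed

text \<open>
  The convergence is used for a single function, the ground state scaled into the unit ball, which the
  semigroup multiplies by \<open>exp (- l * t)\<close>. The set where the resulting bound holds is closed and contains
  \<open>K t - N\<close>, with \<open>N\<close> null; so it contains the closure of the interior of \<open>K t\<close>.
\<close>

theorem convergence_imp_pGSD: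
  assumes lc: "locally_compact_space (euclidean :: 'a topology)"
    and prob: "prob_space \<rho>" and sets: "sets \<rho> = sets borel"
    and supp: "topological_support \<rho> \<inter> (UNIV - N) \<noteq> {}"
    and exh: "exhausting_family t\<^sub>1 K"
    and conv: "progressive_uniform_convergence \<mu> k K N \<rho>"
    and N: "{x. p x = 0} \<subseteq> N" "AE x in \<mu>. x \<notin> N"
  shows "pGSD \<mu> k l (\<lambda>x. complex_of_real (p x))"
proof -
  interpret \<rho>: prob_space \<rho> by (rule prob)
  have one: "ess_bdd \<mu> 1 (\<lambda>_. 1)" using ess_bdd_const[of \<mu> 1] by simp
  obtain P0 where P0: "\<And>x. p x \<le> P0" using p_bdd by blast
  define P where "P = max P0 1"
  have P: "P > 0" "\<And>x. p x \<le> P" using P0 by (auto simp: P_def le_max_iff_disj)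
  define f where "f = (\<lambda>x. p x / P)"
  have f01: "0 \<le> f x" "f x \<le> 1" for x using p_nonneg[of x] P by (simp_all add: f_def pos_divide_le_eq)
  have pm: "p \<in> borel_measurable \<rho>"
    using borel_measurable_continuous_onI[OF p_cont] measurable_cong_sets[OF sets refl, of borel] by blast
  have fm: "f \<in> borel_measurable \<mu>" unfolding f_def using sqint_meas[OF p_sq] by simp
  have f: "ess_bdd \<mu> 1 f" unfolding ess_bdd_def using fm f01 by simp
  have f_ball: "(\<lambda>x. complex_of_real (f x)) \<in> Linf_unit_ball \<mu>"
    unfolding Linf_unit_ball_def using ess_bdd_Linf[OF f] f01 by simp
  have f\<rho>: "integrable \<rho> f"
  proof (rule \<rho>.integrable_const_bound[of _ 1])
    show "AE x in \<rho>. norm (f x) \<le> 1" using f01 by simp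
    show "f \<in> borel_measurable \<rho>" unfolding f_def using pm by simp
  qed
  define a where "a = (\<integral>x. f x \<partial>\<rho>)"
  have a: "a > 0"
  proof -
    have "0 \<le> a" unfolding a_def using f01 by simp
    moreover have "a \<noteq> 0"
    proof
      assume "a = 0"
      then have ae: "AE x in \<rho>. f x = 0"
        unfolding a_def using integral_nonneg_eq_0_iff_AE[OF f\<rho>] f01 by simp
      obtain x where x: "x \<in> topological_support \<rho>" "x \<notin> N" using supp by blast
      have "p x \<noteq> 0" using x(2) N(1) by blast
      then have "x \<in> {y. p y \<noteq> 0}" by simp
      moreover have op: "open {y. p y \<noteq> 0}" by (intro open_Collect_neq p_cont continuous_on_const)
      ultimately have "0 < emeasure \<rho> {y. p y \<noteq> 0}"
        using x(1) unfolding topological_support_def by blast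
      moreover have "emeasure \<rho> {y. p y \<noteq> 0} = 0"
      proof (rule AE_iff_measurable[THEN iffD1])
        show "{y. p y \<noteq> 0} \<in> sets \<rho>" unfolding sets by (rule borel_open[OF op])
        show "{x \<in> space \<rho>. \<not> p x = 0} = {y. p y \<noteq> 0}"
          using sets_eq_imp_space_eq[OF sets] by simp
        show "AE x in \<rho>. p x = 0" using ae by eventually_elim (use P in \<open>simp add: f_def\<close>)
      qed
      ultimately show False by simp
    qed
    ultimately show ?thesis by linarith
  qed
  have Tf: "T t f x = exp (- l * t) * f x" if t: "t > 0" for t x
  proof -
    have pb: "ess_bdd \<mu> P p" unfolding ess_bdd_def
      using P p_nonneg sqint_meas[OF p_sq] by (simp add: abs_of_nonneg)
    have "AE x in \<mu>. S t f x = 1 / P * S t p x"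
      using S_lin[OF S_int[OF t pb] S_int[OF t pb], of "1/P" 0] by (simp add: f_def)
    with eig[OF t] T_rep(4)[OF t f] have "AE x in \<mu>. T t f x = exp (- l * t) * f x"
      by eventually_elim (simp add: f_def)
    then have "T t f = (\<lambda>x. exp (- l * t) * f x)"
      by (rule AE_eq_everywhere[OF T_rep(2)[OF t f], rotated])
        (unfold f_def, use P in \<open>auto intro!: continuous_intros p_cont\<close>)
    then show ?thesis by simp
  qed
  let ?g = "\<lambda>t x f. cmod (Linf_op \<mu> (k t) f x / Linf_op \<mu> (k t) (\<lambda>_. 1) x - (\<integral>y. f y \<partial>\<rho>))"
  have "\<forall>\<^sub>F t in at_top. (SUP x\<in>K t - N. SUP f\<in>Linf_unit_ball \<mu>. ennreal (?g t x f)) < ennreal (a / 2)"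
    using conv unfolding progressive_uniform_convergence_def
    by (rule order_tendstoD) (use a in simp)
  then obtain t\<^sub>2 where t2: "\<And>t. t \<ge> t\<^sub>2 \<Longrightarrow> (SUP x\<in>K t - N. SUP f\<in>Linf_unit_ball \<mu>. ennreal (?g t x f)) < ennreal (a / 2)"
    unfolding eventually_at_top_linorder by blast
  \<comment> \<open>From \<open>a / 2 < exp (- l * t) * (p x / P) / T t 1 x\<close>.\<close>
  define D where "D = 2 / (a * P)"
  have D: "D > 0" using a P by (simp add: D_def)
  define t\<^sub>3 where "t\<^sub>3 = max (max t\<^sub>1 t\<^sub>2) 1"
  have t3: "t\<^sub>3 \<ge> t\<^sub>1" "t\<^sub>3 \<ge> t\<^sub>2" "t\<^sub>3 > 0" by (auto simp: t\<^sub>3_def)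
  have off_N: "T t (\<lambda>_. 1) x \<le> D * exp (- l * t) * p x" if t: "t \<ge> t\<^sub>3" and x: "x \<in> K t - N" for t x
  proof -
    have tp: "t > 0" "t \<ge> t\<^sub>2" using t t3 by linarith+
    let ?b = "T t (\<lambda>_. 1) x"
    have "ennreal (?g t x (\<lambda>x. complex_of_real (f x)))
        \<le> (SUP f\<in>Linf_unit_ball \<mu>. ennreal (?g t x f))"
      by (rule SUP_upper[OF f_ball])
    also have "\<dots> \<le> (SUP x\<in>K t - N. SUP f\<in>Linf_unit_ball \<mu>. ennreal (?g t x f))"
      by (rule SUP_upper[OF x])
    also have "\<dots> < ennreal (a / 2)" by (rule t2[OF tp(2)])
    finally have "?g t x (\<lambda>x. complex_of_real (f x)) < a / 2"
      by (simp add: ennreal_less_iff)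
    moreover have "Linf_op \<mu> (k t) (\<lambda>x. complex_of_real (f x)) x / Linf_op \<mu> (k t) (\<lambda>_. 1) x
        - (\<integral>y. complex_of_real (f y) \<partial>\<rho>) = complex_of_real (exp (- l * t) * f x / ?b - a)"
      unfolding T_rep(1)[OF tp(1) f] Linf_op_one[OF tp(1)] Tf[OF tp(1)] integral_complex_of_real a_def by simp
    ultimately have "\<bar>exp (- l * t) * f x / ?b - a\<bar> < a / 2"
      by (simp only: norm_of_real)
    then have gt: "a / 2 < exp (- l * t) * f x / ?b" by arith
    have b: "?b > 0"
    proof (rule ccontr)
      assume "\<not> ?thesis"
      then have "?b = 0" using T_nonneg[OF tp(1), of x] by linarith
      then show False using gt a by simp
    qed
    have "a / 2 * ?b < exp (- l * t) * p x / P"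
      using gt unfolding pos_less_divide_eq[OF b] f_def by simp
    then have "a / 2 * ?b * P < exp (- l * t) * p x"
      unfolding pos_less_divide_eq[OF P(1)] .
    then have "?b * (a * P) \<le> 2 * (exp (- l * t) * p x)" by (simp add: mult_ac)
    then have "?b \<le> 2 * (exp (- l * t) * p x) / (a * P)"
      using a P(1) by (simp only: pos_le_divide_eq[OF mult_pos_pos])
    then show ?thesis by (simp add: D_def mult_ac)
  qed
  have dom: "T t (\<lambda>_. 1) x \<le> D * exp (- l * t) * p x"
    if t: "t \<ge> t\<^sub>3" and x: "x \<in> closure (interior (K t))" for t x
  proof -
    have tp: "t > 0" using t t3 by linarith
    define F where "F = {x. T t (\<lambda>_. 1) x \<le> D * exp (- l * t) * p x}"
    have F: "closed F" unfolding F_def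
      by (intro closed_Collect_le T_rep(2)[OF tp one] continuous_intros p_cont)
    have "open (interior (K t) - F)" using F by (simp add: open_Diff)
    moreover have "AE x in \<mu>. x \<notin> interior (K t) - F"
      using N(2)
    proof eventually_elim
      case (elim x)
      show ?case
      proof
        assume *: "x \<in> interior (K t) - F"
        then have "x \<in> K t - N" using elim interior_subset by blast
        from off_N[OF t this] * show False by (simp add: F_def)
      qed
    qed
    ultimately have "interior (K t) - F = {}" by (rule null_open_empty)
    then have "closure (interior (K t)) \<subseteq> F" by (intro closure_minimal F) blast
    then show ?thesis using x by (auto simp: F_def)
  qed
  show ?thesis
    unfolding pGSD_real
    by (intro exI[of _ D] conjI exI[of _ t\<^sub>3] exI[of _ "\<lambda>t. closure (interior (K t))"] D t3(3)
        exhausting_closure_interior[OF lc exh t3(1)] allI impI ballI dom)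
qed

end

section \<open>From the complex semigroup and its adjoint to real kernel operators\<close>

abbreviation cplx :: "('a \<Rightarrow> real) \<Rightarrow> 'a \<Rightarrow> complex" where
  "cplx f \<equiv> \<lambda>x. complex_of_real (f x)"

lemma cplx_L2: "sqint \<mu> f \<Longrightarrow> cplx f \<in> L2 \<mu>"
  by (auto simp: sqint_def L2_def)

lemma cplx_L2_norm: "L2_norm \<mu> (cplx f) = l2n \<mu> f"
  by (simp add: L2_norm_def l2n_def)

lemma L2_Re:
  assumes F: "F \<in> L2 \<mu>"
  shows "sqint \<mu> (\<lambda>x. Re (F x))" "l2n \<mu> (\<lambda>x. Re (F x)) \<le> L2_norm \<mu> F"
proof -
  have Fm: "F \<in> borel_measurable \<mu>" and Fi: "integrable \<mu> (\<lambda>x. (cmod (F x))\<^sup>2)"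
    using F by (simp_all add: L2_def)
  have s: "sqint \<mu> (\<lambda>x. cmod (F x))" using Fm Fi by (simp add: sqint_def)
  have ae: "AE x in \<mu>. \<bar>Re (F x)\<bar> \<le> \<bar>cmod (F x)\<bar>" by (simp add: abs_Re_le_cmod)
  have m: "(\<lambda>x. Re (F x)) \<in> borel_measurable \<mu>" using Fm by simp
  show "sqint \<mu> (\<lambda>x. Re (F x))" by (rule l2n_mono(1)[OF m s ae])
  have "l2n \<mu> (\<lambda>x. Re (F x)) \<le> l2n \<mu> (\<lambda>x. cmod (F x))" by (rule l2n_mono(2)[OF m s ae])
  then show "l2n \<mu> (\<lambda>x. Re (F x)) \<le> L2_norm \<mu> F" by (simp add: l2n_def L2_norm_def)
qed

lemma L2_diff:
  assumes F: "F \<in> L2 \<mu>" and G: "G \<in> L2 \<mu>"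
  shows "(\<lambda>x. F x - G x) \<in> L2 \<mu>"
proof -
  have m: "F \<in> borel_measurable \<mu>" "G \<in> borel_measurable \<mu>" using F G by (simp_all add: L2_def)
  have F': "sqint \<mu> (\<lambda>x. cmod (F x))" and G': "sqint \<mu> (\<lambda>x. cmod (G x))"
    using F G by (auto simp: sqint_def L2_def)
  have "sqint \<mu> (\<lambda>x. cmod (F x - G x))"
  proof (rule l2n_mono(1)[OF _ sqint_add[OF F' G']])
    show "(\<lambda>x. cmod (F x - G x)) \<in> borel_measurable \<mu>" using m by simp
    show "AE x in \<mu>. \<bar>cmod (F x - G x)\<bar> \<le> \<bar>cmod (F x) + cmod (G x)\<bar>"
      by (simp add: norm_triangle_ineq4)
  qed
  then show ?thesis using m by (simp add: sqint_def L2_def)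
qed

lemma L2_norm_AE_real:
  assumes "F \<in> borel_measurable \<mu>" "f \<in> borel_measurable \<mu>" "AE x in \<mu>. F x = complex_of_real (f x)"
  shows "L2_norm \<mu> F = l2n \<mu> f"
proof -
  have ae: "AE x in \<mu>. (cmod (F x))\<^sup>2 = (f x)\<^sup>2" using assms(3) by eventually_elim simp
  have "(\<integral>x. (cmod (F x))\<^sup>2 \<partial>\<mu>) = (\<integral>x. (f x)\<^sup>2 \<partial>\<mu>)"
    by (rule integral_cong_AE[OF _ _ ae]) (use assms(1,2) in simp_all)
  then show ?thesis by (simp add: L2_norm_def l2n_def)
qed

lemma AE_eq_by_testing:
  assumes a: "sqint \<mu> a" and b: "sqint \<mu> b"
    and eq: "\<And>f. sqint \<mu> f \<Longrightarrow> (\<integral>x. f x * a x \<partial>\<mu>) = (\<integral>x. f x * b x \<partial>\<mu>)"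
  shows "AE x in \<mu>. a x = b x"
proof -
  have d: "sqint \<mu> (\<lambda>x. a x - b x)" by (rule sqint_diff[OF a b])
  have "(l2n \<mu> (\<lambda>x. a x - b x))\<^sup>2 = (\<integral>x. (a x - b x) * a x - (a x - b x) * b x \<partial>\<mu>)"
    unfolding l2n_sq by (intro Bochner_Integration.integral_cong refl) (simp add: power2_eq_square algebra_simps)
  also have "\<dots> = 0"
    using eq[OF d] sqint_mult[OF d a] sqint_mult[OF d b] by simp
  finally have "l2n \<mu> (\<lambda>x. a x - b x) = 0" by simp
  then have "AE x in \<mu>. a x - b x = 0" using l2n_eq_0[OF d] by simp
  then show ?thesis by eventually_elim simp
qed

text \<open>
  Positivity of the adjoint: testing with the negative part \<open>h\<close> of \<open>A' g\<close> gives
  \<open>0 \<le> \<integral> A h * g = - \<integral> h\<^sup>2\<close>.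
\<close>

lemma pos_op_adjoint:
  assumes A: "pos_op \<mu> A"
    and sq: "\<And>g. sqint \<mu> g \<Longrightarrow> sqint \<mu> (A' g)"
    and lin: "\<And>f g a b. sqint \<mu> f \<Longrightarrow> sqint \<mu> g \<Longrightarrow>
      AE x in \<mu>. A' (\<lambda>x. a * f x + b * g x) x = a * A' f x + b * A' g x"
    and adj: "\<And>f g. sqint \<mu> f \<Longrightarrow> sqint \<mu> g \<Longrightarrow> (\<integral>x. A f x * g x \<partial>\<mu>) = (\<integral>x. f x * A' g x \<partial>\<mu>)"
    and M: "\<And>f. sqint \<mu> f \<Longrightarrow> l2n \<mu> (A f) \<le> M * l2n \<mu> f"
  shows "pos_op \<mu> A'" and "\<And>g. sqint \<mu> g \<Longrightarrow> l2n \<mu> (A' g) \<le> M * l2n \<mu> g"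
proof -
  show bound: "l2n \<mu> (A' g) \<le> M * l2n \<mu> g" if g: "sqint \<mu> g" for g
  proof (cases "l2n \<mu> (A' g) = 0")
    case True
    have "0 \<le> M * l2n \<mu> g" using M[OF g] l2n_nonneg[of \<mu> "A g"] by linarith
    then show ?thesis using True by simp
  next
    case False
    note g' = sq[OF g]
    have "(l2n \<mu> (A' g))\<^sup>2 = (\<integral>x. A (A' g) x * g x \<partial>\<mu>)"
      unfolding l2n_sq adj[OF g' g] by (simp add: power2_eq_square)
    also have "\<dots> \<le> l2n \<mu> (A (A' g)) * l2n \<mu> g"
      using l2n_Cauchy_Schwarz[OF pos_op_sqint[OF A g'] g] by linarith
    also have "\<dots> \<le> (M * l2n \<mu> (A' g)) * l2n \<mu> g"
      by (intro mult_right_mono M g') simp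
    finally have "l2n \<mu> (A' g) * l2n \<mu> (A' g) \<le> l2n \<mu> (A' g) * (M * l2n \<mu> g)"
      by (simp add: power2_eq_square mult_ac)
    moreover have "0 < l2n \<mu> (A' g)" using False l2n_nonneg[of \<mu> "A' g"] by linarith
    ultimately show ?thesis by (rule mult_left_le_imp_le)
  qed
  show "pos_op \<mu> A'"
    unfolding pos_op_def
  proof (intro conjI allI impI)
    show "\<exists>M. \<forall>f. sqint \<mu> f \<longrightarrow> l2n \<mu> (A' f) \<le> M * l2n \<mu> f" using bound by blast
    fix g assume g: "sqint \<mu> g" and pos: "AE x in \<mu>. 0 \<le> g x"
    note g' = sq[OF g]
    define h where "h = (\<lambda>x. max (- A' g x) 0)"
    have h: "sqint \<mu> h"
      unfolding h_def by (rule l2n_mono(1)[OF _ g']) (use sqint_meas[OF g'] in auto)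
    have "AE x in \<mu>. 0 \<le> A h x" by (rule pos_op_pos[OF A h]) (simp add: h_def)
    with pos have "AE x in \<mu>. 0 \<le> A h x * g x" by eventually_elim simp
    then have "0 \<le> (\<integral>x. A h x * g x \<partial>\<mu>)" by (rule integral_nonneg_AE)
    also have "\<dots> = (\<integral>x. - (h x)\<^sup>2 \<partial>\<mu>)"
      unfolding adj[OF h g]
      by (intro Bochner_Integration.integral_cong refl) (simp add: h_def max_def power2_eq_square)
    finally have "(l2n \<mu> h)\<^sup>2 \<le> 0" by (simp add: l2n_sq)
    then have "l2n \<mu> h = 0" by simp
    then have "AE x in \<mu>. h x = 0" using l2n_eq_0[OF h] by simp
    then show "AE x in \<mu>. 0 \<le> A' g x"
      by eventually_elim (simp add: h_def max_def split: if_splits)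
  qed (use sq lin in auto)
qed

context full_support_measure begin

lemma ground_state_real:
  assumes g: "ground_state \<mu> W l \<phi>"
  defines "p \<equiv> \<lambda>x. Re (\<phi> x)"
  shows "\<phi> = cplx p" "continuous_on UNIV p" "\<exists>D. \<forall>x. p x \<le> D" "\<And>x. 0 \<le> p x"
    "AE x in \<mu>. 0 < p x" "sqint \<mu> p"
    "((\<lambda>t. L2_norm \<mu> (\<lambda>x. (W t (cplx p) x - cplx p x) / of_real t + of_real l * cplx p x)) \<longlongrightarrow> 0) (at_right 0)"
proof -
  have gen: "(\<phi>, \<lambda>x. of_real l * \<phi> x) \<in> neg_operator (generator \<mu> W)"
    and pos: "AE x in \<mu>. 0 < \<phi> x" and cb: "continuous_on UNIV \<phi>" "bounded (range \<phi>)"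
    using g by (auto simp: ground_state_def Cb_def)
  show pc: "continuous_on UNIV p" unfolding p_def by (intro continuous_intros cb)
  show eq: "\<phi> = cplx p"
  proof (rule AE_eq_everywhere[OF cb(1)])
    show "continuous_on UNIV (cplx p)" by (intro continuous_intros pc)
    show "AE x in \<mu>. \<phi> x = cplx p x"
      using pos by eventually_elim (simp add: p_def complex_eq_iff less_complex_def)
  qed
  obtain D where "\<And>x. cmod (\<phi> x) \<le> D" using cb(2) by (auto simp: bounded_iff)
  then have "p x \<le> D" for x unfolding p_def by (meson complex_Re_le_cmod order_trans)
  then show "\<exists>D. \<forall>x. p x \<le> D" by blast
  show p0: "AE x in \<mu>. 0 < p x" using pos by eventually_elim (simp add: p_def less_complex_def)
  show "0 \<le> p x" for x
    by (rule AE_le_everywhere[OF continuous_on_const pc]) (use p0 in \<open>eventually_elim, simp\<close>)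
  obtain f h where fh: "(f, h) \<in> generator \<mu> W" "\<phi> = f" "(\<lambda>x. of_real l * \<phi> x) = (\<lambda>x. - h x)"
    using gen unfolding neg_operator_def by blast
  have h: "h = (\<lambda>x. - (of_real l * \<phi> x))"
    using fh(3) by (metis (no_types) add.inverse_inverse)
  have L2: "\<phi> \<in> L2 \<mu>" and lim: "((\<lambda>t. L2_norm \<mu> (\<lambda>x. (W t f x - f x) / of_real t - h x)) \<longlongrightarrow> 0) (at_right 0)"
    using fh(1,2) by (simp_all add: generator_def)
  show "sqint \<mu> p" unfolding p_def by (rule L2_Re(1)[OF L2])
  show "((\<lambda>t. L2_norm \<mu> (\<lambda>x. (W t (cplx p) x - cplx p x) / of_real t + of_real l * cplx p x)) \<longlongrightarrow> 0) (at_right 0)"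
    using lim unfolding fh(2)[symmetric] h unfolding eq by simp
qed

end

text \<open>
  The translation between the complex operators and the real kernel operators, for either of the two
  semigroups.
\<close>

locale kernel_operators = full_support_measure \<mu>
  for \<mu> :: "'a::polish_space measure" +
  fixes W :: "real \<Rightarrow> ('a \<Rightarrow> complex) \<Rightarrow> 'a \<Rightarrow> complex" and k :: "real \<Rightarrow> 'a \<Rightarrow> 'a \<Rightarrow> real"
  assumes W_L2: "\<And>t F. t > 0 \<Longrightarrow> F \<in> L2 \<mu> \<Longrightarrow> W t F \<in> L2 \<mu>"
    and k_meas: "\<And>t. t > 0 \<Longrightarrow> (\<lambda>(x, y). k t x y) \<in> borel_measurable (\<mu> \<Otimes>\<^sub>M \<mu>)"
    and given: "given_by_kernel \<mu> W k"
begin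

lemma k_int:
  assumes t: "t > 0" and f: "sqint \<mu> f"
  shows "AE x in \<mu>. integrable \<mu> (\<lambda>y. k t x y * f y)"
proof -
  have "AE x in \<mu>. integrable \<mu> (\<lambda>y. of_real (k t x y) * cplx f y) \<and> W t (cplx f) x = kernel_op \<mu> (k t) (cplx f) x"
    using given[unfolded given_by_kernel_def, rule_format, OF t cplx_L2[OF f]] .
  then have "AE x in \<mu>. integrable \<mu> (\<lambda>y. complex_of_real (k t x y * f y))"
    by eventually_elim simp
  then show ?thesis by (simp only: complex_of_real_integrable_eq)
qed

lemma W_eq:
  assumes t: "t > 0" and f: "sqint \<mu> f"
  shows "AE x in \<mu>. W t (cplx f) x = complex_of_real (kop \<mu> (k t) f x)"
proof -
  have "AE x in \<mu>. integrable \<mu> (\<lambda>y. of_real (k t x y) * cplx f y) \<and> W t (cplx f) x = kernel_op \<mu> (k t) (cplx f) x"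
    using given[unfolded given_by_kernel_def, rule_format, OF t cplx_L2[OF f]] .
  then show ?thesis by eventually_elim (simp only: kernel_op_of_real)
qed

lemma kop_meas: "t > 0 \<Longrightarrow> f \<in> borel_measurable \<mu> \<Longrightarrow> kop \<mu> (k t) f \<in> borel_measurable \<mu>"
  by (rule kop_measurable[OF sigma_finite k_meas])

lemma kop_sqint:
  assumes t: "t > 0" and f: "sqint \<mu> f"
  shows "sqint \<mu> (kop \<mu> (k t) f)"
proof (rule l2n_cong(1)[OF kop_meas[OF t sqint_meas[OF f]] L2_Re(1)[OF W_L2[OF t cplx_L2[OF f]]]])
  show "AE x in \<mu>. kop \<mu> (k t) f x = Re (W t (cplx f) x)"
    using W_eq[OF t f] by eventually_elim simp
qed

lemma W_meas: "t > 0 \<Longrightarrow> F \<in> L2 \<mu> \<Longrightarrow> W t F \<in> borel_measurable \<mu>"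
  using W_L2 by (simp add: L2_def)

lemma eigenfunction:
  assumes pos: "\<And>t. t > 0 \<Longrightarrow> pos_op \<mu> (kop \<mu> (k t))"
    and semigroup: "\<And>s t f. s > 0 \<Longrightarrow> t > 0 \<Longrightarrow> sqint \<mu> f \<Longrightarrow>
      AE x in \<mu>. kop \<mu> (k (s + t)) f x = kop \<mu> (k s) (kop \<mu> (k t) f) x"
    and \<delta>: "0 < \<delta>"
    and bound: "\<And>t f. 0 < t \<Longrightarrow> t < \<delta> \<Longrightarrow> sqint \<mu> f \<Longrightarrow> l2n \<mu> (kop \<mu> (k t) f) \<le> M * l2n \<mu> f"
    and g: "ground_state \<mu> W l \<phi>" and t: "t > 0"
  shows "AE x in \<mu>. kop \<mu> (k t) (\<lambda>x. Re (\<phi> x)) x = exp (- l * t) * Re (\<phi> x)"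
proof -
  let ?p = "\<lambda>x. Re (\<phi> x)"
  note G = ground_state_real[OF g]
  have "\<forall>\<^sub>F h in at_right 0. L2_norm \<mu> (\<lambda>x. (W h (cplx ?p) x - cplx ?p x) / of_real h + of_real l * cplx ?p x)
      = l2n \<mu> (\<lambda>x. (kop \<mu> (k h) ?p x - ?p x) / h + l * ?p x)"
    using eventually_at_right_less[of "0::real"]
  proof eventually_elim
    case (elim h)
    note m = sqint_meas[OF G(6)] kop_meas[OF elim sqint_meas[OF G(6)]] W_meas[OF elim cplx_L2[OF G(6)]]
    show ?case
    proof (rule L2_norm_AE_real)
      have c: "cplx ?p \<in> borel_measurable \<mu>" using cplx_L2[OF G(6)] by (simp add: L2_def)
      show "(\<lambda>x. (W h (cplx ?p) x - cplx ?p x) / of_real h + of_real l * cplx ?p x) \<in> borel_measurable \<mu>"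
        by (intro borel_measurable_add borel_measurable_divide borel_measurable_diff
            borel_measurable_times borel_measurable_const m(3) c)
      show "(\<lambda>x. (kop \<mu> (k h) ?p x - ?p x) / h + l * ?p x) \<in> borel_measurable \<mu>"
        by (intro borel_measurable_add borel_measurable_divide borel_measurable_diff
            borel_measurable_times borel_measurable_const m(1,2))
      show "AE x in \<mu>. (W h (cplx ?p) x - cplx ?p x) / of_real h + of_real l * cplx ?p x
          = complex_of_real ((kop \<mu> (k h) ?p x - ?p x) / h + l * ?p x)"
        using W_eq[OF elim G(6)] by eventually_elim simp
    qed
  qed
  note lim = Lim_transform_eventually[OF G(7) this]
  show ?thesis
    by (rule generator_eigenfunction[where S="\<lambda>t. kop \<mu> (k t)", OF pos semigroup \<delta> bound G(6) lim t])
qed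

end

text \<open>
  A semigroup and its adjoint with a common ground state eigenvalue \<open>l\<close>. Compactness, positivity
  improvement, boundedness from \<open>L\<^sup>2\<close> to \<open>L\<^sup>\<infinity>\<close> and decay at infinity all refer to the time \<open>t\<^sub>0\<close>, the step in which
  the long time limit is taken.
\<close>

locale dual_feller_semigroups = full_support_measure \<mu>
  for \<mu> :: "'a::polish_space measure" +
  fixes U Us :: "real \<Rightarrow> ('a \<Rightarrow> complex) \<Rightarrow> 'a \<Rightarrow> complex"
    and u :: "real \<Rightarrow> 'a \<Rightarrow> 'a \<Rightarrow> real" and t\<^sub>0 l :: real and \<phi> \<psi> :: "'a \<Rightarrow> complex"
  assumes C0: "C0_semigroup_L2 \<mu> U"
    and positive: "\<And>t. t \<ge> 0 \<Longrightarrow> positivity_preserving \<mu> (U t)"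
    and adjoint: "\<And>t. t \<ge> 0 \<Longrightarrow> adjoint_L2 \<mu> (U t) (Us t)"
    and u_meas: "\<And>t. t > 0 \<Longrightarrow> (\<lambda>(x, y). u t x y) \<in> borel_measurable (\<mu> \<Otimes>\<^sub>M \<mu>)"
    and kernel: "given_by_kernel \<mu> U u"
    and kernel_adj: "given_by_kernel \<mu> Us (transpose_kernel u)"
    and t0: "t\<^sub>0 > 0"
    and compactness: "compact_L2 \<mu> (U t\<^sub>0)"
    and improving: "positivity_improving \<mu> (U t\<^sub>0)"
    and feller: "strong_feller \<mu> u"
    and feller_adj: "strong_feller \<mu> (transpose_kernel u)"
    and ultra: "bounded_L2_Linf \<mu> (U t\<^sub>0)"
    and ultra_adj: "bounded_L2_Linf \<mu> (Us t\<^sub>0)"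
    and decay: "\<And>\<epsilon>. \<epsilon> > 0 \<Longrightarrow>
           \<exists>K. compact K \<and> (\<forall>x\<in>- K. Linf_op \<mu> (u t\<^sub>0) (\<lambda>_. 1) x \<le> of_real \<epsilon> \<and>
                                   Linf_op \<mu> (transpose_kernel u t\<^sub>0) (\<lambda>_. 1) x \<le> of_real \<epsilon>)"
    and gs: "ground_state \<mu> U l \<phi>"
    and gs_adj: "ground_state \<mu> Us l \<psi>"
begin

lemma U_L2: "t > 0 \<Longrightarrow> F \<in> L2 \<mu> \<Longrightarrow> U t F \<in> L2 \<mu>"
  using C0 unfolding C0_semigroup_L2_def bounded_linear_L2_def by (meson less_imp_le)

lemma Us_L2: "t > 0 \<Longrightarrow> F \<in> L2 \<mu> \<Longrightarrow> Us t F \<in> L2 \<mu>"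
  using adjoint unfolding adjoint_L2_def by (meson less_imp_le)

lemma u_meas_transposed:
  assumes "t > 0"
  shows "(\<lambda>(x, y). transpose_kernel u t x y) \<in> borel_measurable (\<mu> \<Otimes>\<^sub>M \<mu>)"
  using measurable_compose[OF measurable_pair_swap' u_meas[OF assms]]
  by (simp add: transpose_kernel_def case_prod_beta')

sublocale K: kernel_operators \<mu> U u
  by unfold_locales (use U_L2 u_meas kernel in simp_all)

sublocale K': kernel_operators \<mu> Us "transpose_kernel u"
  by unfold_locales (use Us_L2 u_meas_transposed kernel_adj in simp_all)

abbreviation A :: "real \<Rightarrow> ('a \<Rightarrow> real) \<Rightarrow> 'a \<Rightarrow> real" where
  "A t \<equiv> kop \<mu> (u t)"

abbreviation A' :: "real \<Rightarrow> ('a \<Rightarrow> real) \<Rightarrow> 'a \<Rightarrow> real" where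
  "A' t \<equiv> kop \<mu> (transpose_kernel u t)"

definition p :: "'a \<Rightarrow> real" where "p x = Re (\<phi> x)"
definition q :: "'a \<Rightarrow> real" where "q x = Re (\<psi> x)"

lemmas p_facts = ground_state_real[OF gs, folded p_def]
lemmas q_facts = ground_state_real[OF gs_adj, folded q_def]

lemma adjoint_real:
  assumes t: "t > 0" and f: "sqint \<mu> f" and g: "sqint \<mu> g"
  shows "(\<integral>x. A t f x * g x \<partial>\<mu>) = (\<integral>x. f x * A' t g x \<partial>\<mu>)"
proof -
  have fm: "f \<in> borel_measurable \<mu>" "g \<in> borel_measurable \<mu>" using f g by (auto simp: sqint_def)
  have m: "A t f \<in> borel_measurable \<mu>" "A' t g \<in> borel_measurable \<mu>"
    by (rule K.kop_meas[OF t fm(1)], rule K'.kop_meas[OF t fm(2)])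
  have c: "cplx f \<in> borel_measurable \<mu>" "cplx g \<in> borel_measurable \<mu>"
    using cplx_L2[OF f] cplx_L2[OF g] by (simp_all add: L2_def)
  have W: "U t (cplx f) \<in> borel_measurable \<mu>" "Us t (cplx g) \<in> borel_measurable \<mu>"
    by (rule K.W_meas[OF t cplx_L2[OF f]], rule K'.W_meas[OF t cplx_L2[OF g]])
  have 1: "L2_inner \<mu> (U t (cplx f)) (cplx g) = (\<integral>x. complex_of_real (A t f x * g x) \<partial>\<mu>)"
    unfolding L2_inner_def
  proof (rule integral_cong_AE)
    show "AE x in \<mu>. U t (cplx f) x * cnj (cplx g x) = complex_of_real (A t f x * g x)"
      using K.W_eq[OF t f] by eventually_elim simp
    show "(\<lambda>x. U t (cplx f) x * cnj (cplx g x)) \<in> borel_measurable \<mu>"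
      using W(1) c(2) by simp
    show "(\<lambda>x. complex_of_real (A t f x * g x)) \<in> borel_measurable \<mu>"
      using m(1) fm(2) by simp
  qed
  have 2: "L2_inner \<mu> (cplx f) (Us t (cplx g)) = (\<integral>x. complex_of_real (f x * A' t g x) \<partial>\<mu>)"
    unfolding L2_inner_def
  proof (rule integral_cong_AE)
    show "AE x in \<mu>. cplx f x * cnj (Us t (cplx g) x) = complex_of_real (f x * A' t g x)"
      using K'.W_eq[OF t g] by eventually_elim simp
    have "(\<lambda>x. cnj (Us t (cplx g) x)) \<in> borel_measurable \<mu>"
      by (rule measurable_compose[OF W(2)]) (intro borel_measurable_continuous_onI continuous_intros)
    then show "(\<lambda>x. cplx f x * cnj (Us t (cplx g) x)) \<in> borel_measurable \<mu>"
      using c(1) by simp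
    show "(\<lambda>x. complex_of_real (f x * A' t g x)) \<in> borel_measurable \<mu>"
      using m(2) fm(1) by simp
  qed
  have "L2_inner \<mu> (U t (cplx f)) (cplx g) = L2_inner \<mu> (cplx f) (Us t (cplx g))"
    using adjoint[of t] t cplx_L2[OF f] cplx_L2[OF g] unfolding adjoint_L2_def by simp
  then show ?thesis unfolding 1 2 integral_complex_of_real by (simp only: of_real_eq_iff)
qed

lemma pos_A:
  assumes t: "t > 0"
  shows "pos_op \<mu> (A t)"
  unfolding pos_op_def
proof (intro conjI allI impI)
  fix f assume f: "sqint \<mu> f"
  show "sqint \<mu> (A t f)" by (rule K.kop_sqint[OF t f])
  assume pos: "AE x in \<mu>. 0 \<le> f x"
  have "AE x in \<mu>. 0 \<le> cplx f x" using pos by eventually_elim (simp add: less_eq_complex_def)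
  then have "AE x in \<mu>. 0 \<le> U t (cplx f) x"
    using positive[of t] t cplx_L2[OF f] unfolding positivity_preserving_def by simp
  with K.W_eq[OF t f] show "AE x in \<mu>. 0 \<le> A t f x"
    by eventually_elim (simp add: less_eq_complex_def)
next
  fix f g and a b :: real assume f: "sqint \<mu> f" and g: "sqint \<mu> g"
  show "AE x in \<mu>. A t (\<lambda>x. a * f x + b * g x) x = a * A t f x + b * A t g x"
    by (rule kop_lin[OF K.k_int[OF t f] K.k_int[OF t g]])
next
  obtain C where C: "\<And>F. F \<in> L2 \<mu> \<Longrightarrow> L2_norm \<mu> (U t F) \<le> C * L2_norm \<mu> F"
    using C0 t unfolding C0_semigroup_L2_def bounded_linear_L2_def by (meson less_imp_le)
  have "l2n \<mu> (A t f) \<le> C * l2n \<mu> f" if f: "sqint \<mu> f" for f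
    using C[OF cplx_L2[OF f]]
      L2_norm_AE_real[OF K.W_meas[OF t cplx_L2[OF f]] K.kop_meas[OF t sqint_meas[OF f]] K.W_eq[OF t f]]
    by (simp add: cplx_L2_norm)
  then show "\<exists>M. \<forall>f. sqint \<mu> f \<longrightarrow> l2n \<mu> (A t f) \<le> M * l2n \<mu> f" by blast
qed

lemma pos_A'_bound:
  assumes t: "t > 0" and M: "\<And>f. sqint \<mu> f \<Longrightarrow> l2n \<mu> (A t f) \<le> M * l2n \<mu> f"
  shows "pos_op \<mu> (A' t)" "\<And>f. sqint \<mu> f \<Longrightarrow> l2n \<mu> (A' t f) \<le> M * l2n \<mu> f"
  by (rule pos_op_adjoint[OF pos_A[OF t] K'.kop_sqint[OF t] _ adjoint_real[OF t] M];
      (rule kop_lin[OF K'.k_int[OF t] K'.k_int[OF t]])?; assumption)+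

lemma pos_A':
  assumes t: "t > 0"
  shows "pos_op \<mu> (A' t)"
proof -
  obtain M where "\<And>f. sqint \<mu> f \<Longrightarrow> l2n \<mu> (A t f) \<le> M * l2n \<mu> f"
    by (rule pos_op_bound[OF pos_A[OF t]]) (rule that)
  then show ?thesis by (rule pos_A'_bound(1)[OF t])
qed

lemma semigroup_A:
  assumes s: "s > 0" and t: "t > 0" and f: "sqint \<mu> f"
  shows "AE x in \<mu>. A (s + t) f x = A s (A t f) x"
proof -
  have st: "s + t > 0" using s t by simp
  have Af: "sqint \<mu> (A t f)" by (rule K.kop_sqint[OF t f])
  have UF: "U t (cplx f) \<in> L2 \<mu>" by (rule U_L2[OF t cplx_L2[OF f]])
  have 1: "AE x in \<mu>. U (s + t) (cplx f) x = U s (U t (cplx f)) x"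
    using C0 s t cplx_L2[OF f] unfolding C0_semigroup_L2_def by (meson less_imp_le)
  have 2: "AE x in \<mu>. U s (U t (cplx f)) x = kernel_op \<mu> (u s) (U t (cplx f)) x"
    using kernel[unfolded given_by_kernel_def, rule_format, OF s UF] by eventually_elim simp
  have 3: "kernel_op \<mu> (u s) (U t (cplx f)) x = complex_of_real (A s (A t f) x)" for x
  proof -
    have km: "(\<lambda>y. u s x y) \<in> borel_measurable \<mu>"
      using measurable_compose_Pair1[OF _ u_meas[OF s], of x] by simp
    have "kernel_op \<mu> (u s) (U t (cplx f)) x = kernel_op \<mu> (u s) (cplx (A t f)) x"
      unfolding kernel_op_def
    proof (rule integral_cong_AE)
      show "AE y in \<mu>. complex_of_real (u s x y) * U t (cplx f) y = complex_of_real (u s x y) * cplx (A t f) y"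
        using K.W_eq[OF t f] by eventually_elim simp
      show "(\<lambda>y. complex_of_real (u s x y) * U t (cplx f) y) \<in> borel_measurable \<mu>"
        using km K.W_meas[OF t cplx_L2[OF f]] by simp
      show "(\<lambda>y. complex_of_real (u s x y) * cplx (A t f) y) \<in> borel_measurable \<mu>"
        using km sqint_meas[OF Af] by simp
    qed
    then show ?thesis by (simp only: kernel_op_of_real)
  qed
  show ?thesis
    using 1 2 K.W_eq[OF st f]
  proof eventually_elim
    case (elim x)
    then have "complex_of_real (A (s + t) f x) = complex_of_real (A s (A t f) x)" using 3[of x] by simp
    then show ?case by (simp only: of_real_eq_iff)
  qed
qed

text \<open>
  The adjoint family inherits the semigroup law by testing against square integrable functions, with the order of
  the factors reversed.
\<close>

lemma semigroup_A':
  assumes s: "s > 0" and t: "t > 0" and g: "sqint \<mu> g"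
  shows "AE x in \<mu>. A' (s + t) g x = A' s (A' t g) x"
proof (rule AE_eq_by_testing)
  have st: "s + t > 0" using s t by simp
  have A'g: "sqint \<mu> (A' t g)" by (rule K'.kop_sqint[OF t g])
  show "sqint \<mu> (A' (s + t) g)" by (rule K'.kop_sqint[OF st g])
  show "sqint \<mu> (A' s (A' t g))" by (rule K'.kop_sqint[OF s A'g])
  fix f assume f: "sqint \<mu> f"
  have Af: "sqint \<mu> (A s f)" by (rule K.kop_sqint[OF s f])
  have ae: "AE x in \<mu>. A (t + s) f x * g x = A t (A s f) x * g x"
    using semigroup_A[OF t s f] by eventually_elim simp
  have "(\<integral>x. f x * A' (s + t) g x \<partial>\<mu>) = (\<integral>x. A (t + s) f x * g x \<partial>\<mu>)"
    using adjoint_real[OF st f g] by (simp add: add.commute)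
  also have "\<dots> = (\<integral>x. A t (A s f) x * g x \<partial>\<mu>)"
    by (rule integral_cong_AE[OF _ _ ae])
      (use st in \<open>intro borel_measurable_times sqint_meas[OF g] K.kop_meas s t sqint_meas[OF f]; simp\<close>)+
  also have "\<dots> = (\<integral>x. f x * A' s (A' t g) x \<partial>\<mu>)"
    unfolding adjoint_real[OF t Af g] adjoint_real[OF s f A'g] ..
  finally show "(\<integral>x. f x * A' (s + t) g x \<partial>\<mu>) = (\<integral>x. f x * A' s (A' t g) x \<partial>\<mu>)" .
qed

text \<open>
  Strong continuity is known for the semigroup and gives its bound near zero. The adjoint operators have
  the same bound, so both ground states are treated by the same argument.
\<close>

lemma eig_A: "t > 0 \<Longrightarrow> AE x in \<mu>. A t p x = exp (- l * t) * p x"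
  and eig_A': "t > 0 \<Longrightarrow> AE x in \<mu>. A' t q x = exp (- l * t) * q x"
proof -
  have sc: "((\<lambda>t. l2n \<mu> (\<lambda>x. A t f x - f x)) \<longlongrightarrow> 0) (at_right 0)" if f: "sqint \<mu> f" for f
  proof (rule Lim_transform_eventually)
    show "((\<lambda>t. L2_norm \<mu> (\<lambda>x. U t (cplx f) x - cplx f x)) \<longlongrightarrow> 0) (at_right 0)"
      using C0 cplx_L2[OF f] unfolding C0_semigroup_L2_def by blast
    show "\<forall>\<^sub>F t in at_right 0. L2_norm \<mu> (\<lambda>x. U t (cplx f) x - cplx f x) = l2n \<mu> (\<lambda>x. A t f x - f x)"
      using eventually_at_right_less[of "0::real"]
    proof eventually_elim
      case (elim t)
      show ?case
      proof (rule L2_norm_AE_real)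
        have "(\<lambda>x. U t (cplx f) x - cplx f x) \<in> L2 \<mu>"
          by (rule L2_diff[OF U_L2[OF elim cplx_L2[OF f]] cplx_L2[OF f]])
        then show "(\<lambda>x. U t (cplx f) x - cplx f x) \<in> borel_measurable \<mu>" by (simp add: L2_def)
        show "(\<lambda>x. A t f x - f x) \<in> borel_measurable \<mu>"
          by (rule sqint_meas[OF sqint_diff[OF K.kop_sqint[OF elim f] f]])
        show "AE x in \<mu>. U t (cplx f) x - cplx f x = complex_of_real (A t f x - f x)"
          using K.W_eq[OF elim f] by eventually_elim simp
      qed
    qed
  qed
  obtain M \<delta> where \<delta>: "0 < \<delta>"
    and M: "\<And>t f. 0 < t \<Longrightarrow> t < \<delta> \<Longrightarrow> sqint \<mu> f \<Longrightarrow> l2n \<mu> (A t f) \<le> M * l2n \<mu> f"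
    using bounded_near_0[where S=A, OF pos_A sc] by blast
  have M': "l2n \<mu> (A' t f) \<le> M * l2n \<mu> f" if "0 < t" "t < \<delta>" "sqint \<mu> f" for t f
    by (rule pos_A'_bound(2)[OF that(1) M[OF that(1,2)] that(3)])
  show "t > 0 \<Longrightarrow> AE x in \<mu>. A t p x = exp (- l * t) * p x"
    using K.eigenfunction[OF pos_A semigroup_A \<delta> M gs] unfolding p_def .
  show "t > 0 \<Longrightarrow> AE x in \<mu>. A' t q x = exp (- l * t) * q x"
    using K'.eigenfunction[OF pos_A' semigroup_A' \<delta> M' gs_adj] unfolding q_def .
qed

lemma inv_A:
  assumes t: "t > 0" and f: "sqint \<mu> f"
  shows "(\<integral>x. A t f x * q x \<partial>\<mu>) = exp (- l * t) * (\<integral>x. f x * q x \<partial>\<mu>)"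
proof -
  note m = sqint_meas[OF f] sqint_meas[OF q_facts(6)]
  have ae: "AE x in \<mu>. f x * A' t q x = exp (- l * t) * (f x * q x)"
    using eig_A'[OF t] by eventually_elim simp
  have "(\<integral>x. f x * A' t q x \<partial>\<mu>) = (\<integral>x. exp (- l * t) * (f x * q x) \<partial>\<mu>)"
    by (rule integral_cong_AE[OF _ _ ae])
      (intro borel_measurable_times borel_measurable_const m K'.kop_meas[OF t])+
  then show ?thesis unfolding adjoint_real[OF t f q_facts(6)] by simp
qed

lemma inv_A':
  assumes t: "t > 0" and f: "sqint \<mu> f"
  shows "(\<integral>x. A' t f x * p x \<partial>\<mu>) = exp (- l * t) * (\<integral>x. f x * p x \<partial>\<mu>)"
proof -
  note m = sqint_meas[OF f] sqint_meas[OF p_facts(6)]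
  have ae: "AE x in \<mu>. A t p x * f x = exp (- l * t) * (f x * p x)"
    using eig_A[OF t] by eventually_elim simp
  have "(\<integral>x. A t p x * f x \<partial>\<mu>) = (\<integral>x. exp (- l * t) * (f x * p x) \<partial>\<mu>)"
    by (rule integral_cong_AE[OF _ _ ae])
      (intro borel_measurable_times borel_measurable_const m K.kop_meas[OF t])+
  then show ?thesis using adjoint_real[OF t p_facts(6) f] by (simp add: mult.commute)
qed

lemma pq_pos: "0 < (\<integral>x. p x * q x \<partial>\<mu>)"
proof -
  have "0 \<le> (\<integral>x. p x * q x \<partial>\<mu>)" using p_facts(4) q_facts(4) by simp
  moreover have "(\<integral>x. p x * q x \<partial>\<mu>) \<noteq> 0"
  proof
    assume "(\<integral>x. p x * q x \<partial>\<mu>) = 0"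
    then have "AE x in \<mu>. p x * q x = 0"
      using integral_nonneg_eq_0_iff_AE[OF sqint_mult[OF p_facts(6) q_facts(6)]] p_facts(4) q_facts(4) by simp
    with p_facts(5) q_facts(5) have "AE x in \<mu>. False" by eventually_elim simp
    then show False using AE_witness by blast
  qed
  ultimately show ?thesis by linarith
qed

lemma ultra_A: "\<exists>C. \<forall>f. sqint \<mu> f \<longrightarrow> (AE x in \<mu>. \<bar>A t\<^sub>0 f x\<bar> \<le> C * l2n \<mu> f)"
  and ultra_A': "\<exists>C. \<forall>f. sqint \<mu> f \<longrightarrow> (AE x in \<mu>. \<bar>A' t\<^sub>0 f x\<bar> \<le> C * l2n \<mu> f)"
proof -
  obtain C where C: "\<And>F. F \<in> L2 \<mu> \<Longrightarrow> AE x in \<mu>. cmod (U t\<^sub>0 F x) \<le> C * L2_norm \<mu> F"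
    using ultra unfolding bounded_L2_Linf_def by blast
  have "AE x in \<mu>. \<bar>A t\<^sub>0 f x\<bar> \<le> C * l2n \<mu> f" if f: "sqint \<mu> f" for f
    using C[OF cplx_L2[OF f]] K.W_eq[OF t0 f] by eventually_elim (simp add: cplx_L2_norm)
  then show "\<exists>C. \<forall>f. sqint \<mu> f \<longrightarrow> (AE x in \<mu>. \<bar>A t\<^sub>0 f x\<bar> \<le> C * l2n \<mu> f)" by blast
  obtain C' where C': "\<And>F. F \<in> L2 \<mu> \<Longrightarrow> AE x in \<mu>. cmod (Us t\<^sub>0 F x) \<le> C' * L2_norm \<mu> F"
    using ultra_adj unfolding bounded_L2_Linf_def by blast
  have "AE x in \<mu>. \<bar>A' t\<^sub>0 f x\<bar> \<le> C' * l2n \<mu> f" if f: "sqint \<mu> f" for f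
    using C'[OF cplx_L2[OF f]] K'.W_eq[OF t0 f] by eventually_elim (simp add: cplx_L2_norm)
  then show "\<exists>C. \<forall>f. sqint \<mu> f \<longrightarrow> (AE x in \<mu>. \<bar>A' t\<^sub>0 f x\<bar> \<le> C * l2n \<mu> f)" by blast
qed

text \<open>
  The operator to which the Jentzsch theorem is applied; by \<open>J_power\<close> its powers are the normalized semigroup
  at the multiples of \<open>t\<^sub>0\<close>.
\<close>

definition J :: "('a \<Rightarrow> real) \<Rightarrow> 'a \<Rightarrow> real" where
  "J f x = exp (l * t\<^sub>0) * A t\<^sub>0 f x"

lemma J_jentzsch: "\<exists>C. jentzsch \<mu> J p q C"
proof -
  obtain C where C: "\<And>f. sqint \<mu> f \<Longrightarrow> AE x in \<mu>. \<bar>A t\<^sub>0 f x\<bar> \<le> C * l2n \<mu> f"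
    using ultra_A by blast
  have e1: "exp (l * t\<^sub>0) * exp (- l * t\<^sub>0) = 1" by (simp flip: exp_add)
  have "jentzsch \<mu> J p q (exp (l * t\<^sub>0) * C)"
  proof
    show "pos_op \<mu> J" unfolding J_def[abs_def] by (rule pos_op_smult[OF pos_A[OF t0]]) simp
  next
    fix f assume f: "sqint \<mu> f" and pos: "AE x in \<mu>. 0 \<le> f x" and nz: "\<not> (AE x in \<mu>. f x = 0)"
    have pos': "AE x in \<mu>. 0 \<le> cplx f x" using pos by eventually_elim (simp add: less_eq_complex_def)
    have nz': "\<not> (AE x in \<mu>. cplx f x = 0)" using nz by simp
    have "AE x in \<mu>. 0 < U t\<^sub>0 (cplx f) x"
      using improving[unfolded positivity_improving_def, THEN bspec, OF cplx_L2[OF f], THEN mp, OF conjI[OF pos' nz']] .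
    with K.W_eq[OF t0 f] show "AE x in \<mu>. 0 < J f x"
      by eventually_elim (simp add: J_def less_complex_def)
  next
    fix f :: "nat \<Rightarrow> 'a \<Rightarrow> real" and B assume f: "\<And>n. sqint \<mu> (f n)" and B: "\<And>n. l2n \<mu> (f n) \<le> B"
    have "(\<forall>n. cplx (f n) \<in> L2 \<mu>) \<and> (\<exists>B. \<forall>n. L2_norm \<mu> (cplx (f n)) \<le> B)"
      using f B by (auto simp: cplx_L2 cplx_L2_norm)
    then have "\<exists>g\<in>L2 \<mu>. \<exists>r::nat \<Rightarrow> nat. strict_mono r \<and>
           (\<lambda>n. L2_norm \<mu> (\<lambda>x. U t\<^sub>0 (cplx (f (r n))) x - g x)) \<longlonglongrightarrow> 0"
      using compactness[unfolded compact_L2_def, rule_format, of "\<lambda>n. cplx (f n)"] by simp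
    then obtain G r where G: "G \<in> L2 \<mu>" and r: "strict_mono r"
      and lim: "(\<lambda>n. L2_norm \<mu> (\<lambda>x. U t\<^sub>0 (cplx (f (r n))) x - G x)) \<longlonglongrightarrow> 0"
      by (elim bexE exE conjE) (rule that)
    define g where "g = (\<lambda>x. exp (l * t\<^sub>0) * Re (G x))"
    have g: "sqint \<mu> g" unfolding g_def by (rule sqint_scale[OF L2_Re(1)[OF G]])
    have le: "l2n \<mu> (\<lambda>x. J (f (r n)) x - g x) \<le> exp (l * t\<^sub>0) * L2_norm \<mu> (\<lambda>x. U t\<^sub>0 (cplx (f (r n))) x - G x)" for n
    proof -
      let ?D = "\<lambda>x. U t\<^sub>0 (cplx (f (r n))) x - G x"
      have D: "?D \<in> L2 \<mu>" by (rule L2_diff[OF U_L2[OF t0 cplx_L2[OF f]] G])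
      have m: "(\<lambda>x. J (f (r n)) x - g x) \<in> borel_measurable \<mu>"
        unfolding J_def by (rule sqint_meas[OF sqint_diff[OF sqint_scale[OF K.kop_sqint[OF t0 f]] g]])
      have "l2n \<mu> (\<lambda>x. J (f (r n)) x - g x) = l2n \<mu> (\<lambda>x. exp (l * t\<^sub>0) * Re (?D x))"
      proof (rule l2n_cong(2)[OF m sqint_scale[OF L2_Re(1)[OF D]]])
        show "AE x in \<mu>. J (f (r n)) x - g x = exp (l * t\<^sub>0) * Re (?D x)"
          using K.W_eq[OF t0 f[of "r n"]]
          by eventually_elim (simp add: J_def g_def right_diff_distrib)
      qed
      also have "\<dots> = exp (l * t\<^sub>0) * l2n \<mu> (\<lambda>x. Re (?D x))" by (subst l2n_scale) simp
      also have "\<dots> \<le> exp (l * t\<^sub>0) * L2_norm \<mu> ?D" by (intro mult_left_mono L2_Re(2)[OF D]) simp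
      finally show ?thesis .
    qed
    have "(\<lambda>n. l2n \<mu> (\<lambda>x. J (f (r n)) x - g x)) \<longlonglongrightarrow> 0"
      by (rule l2n_tendsto_0_bound[OF le tendsto_mult_right_zero[OF lim]])
    then show "\<exists>g r. sqint \<mu> g \<and> strict_mono r \<and> (\<lambda>n. l2n \<mu> (\<lambda>x. J (f (r n)) x - g x)) \<longlonglongrightarrow> 0"
      using g r by blast
  next
    fix f assume f: "sqint \<mu> f"
    show "AE x in \<mu>. \<bar>J f x\<bar> \<le> exp (l * t\<^sub>0) * C * l2n \<mu> f"
      using C[OF f] by eventually_elim (simp add: J_def abs_mult mult.assoc)
    have "(\<integral>x. J f x * q x \<partial>\<mu>) = exp (l * t\<^sub>0) * (\<integral>x. A t\<^sub>0 f x * q x \<partial>\<mu>)"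
      by (simp add: J_def mult.assoc)
    also have "\<dots> = (exp (l * t\<^sub>0) * exp (- l * t\<^sub>0)) * (\<integral>x. f x * q x \<partial>\<mu>)"
      unfolding inv_A[OF t0 f] by simp
    finally show "(\<integral>x. J f x * q x \<partial>\<mu>) = (\<integral>x. f x * q x \<partial>\<mu>)" unfolding e1 by simp
  next
    show "AE x in \<mu>. J p x = p x"
      using eig_A[OF t0]
    proof eventually_elim
      case (elim x)
      have "J p x = (exp (l * t\<^sub>0) * exp (- l * t\<^sub>0)) * p x" unfolding J_def elim by simp
      then show ?case unfolding e1 by simp
    qed
  qed (use p_facts q_facts pq_pos in simp_all)
  then show ?thesis by blast
qed

lemma J_pos: "pos_op \<mu> J"
  using J_jentzsch by (auto simp: jentzsch_def)

lemma J_power: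
  assumes f: "sqint \<mu> f"
  shows "AE x in \<mu>. (J ^^ Suc n) f x = exp (l * (real (Suc n) * t\<^sub>0)) * A (real (Suc n) * t\<^sub>0) f x"
proof (induction n)
  case 0
  show ?case by (simp add: J_def)
next
  case (Suc n)
  let ?t = "real (Suc n) * t\<^sub>0" and ?e = "exp (l * (real (Suc n) * t\<^sub>0))"
  have t: "?t > 0" using t0 by (intro mult_pos_pos) simp_all
  have At: "sqint \<mu> (A ?t f)" by (rule K.kop_sqint[OF t f])
  have Jn: "sqint \<mu> ((J ^^ Suc n) f)" by (rule pos_op_sqint[OF pos_op_funpow[OF J_pos] f])
  have 1: "AE x in \<mu>. J ((J ^^ Suc n) f) x = J (\<lambda>x. ?e * A ?t f x) x"
    by (rule pos_op_cong[OF J_pos Jn sqint_scale[OF At] Suc])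
  have 2: "AE x in \<mu>. J (\<lambda>x. ?e * A ?t f x) x = ?e * J (A ?t f) x"
    by (rule pos_op_scale[OF J_pos At])
  have 3: "AE x in \<mu>. A (t\<^sub>0 + ?t) f x = A t\<^sub>0 (A ?t f) x"
    by (rule semigroup_A[OF t0 t f])
  have tt: "real (Suc (Suc n)) * t\<^sub>0 = t\<^sub>0 + ?t" by (simp add: algebra_simps)
  show ?case
    using 1 2 3
  proof eventually_elim
    case (elim x)
    have "(J ^^ Suc (Suc n)) f x = J ((J ^^ Suc n) f) x" by simp
    also have "\<dots> = ?e * (exp (l * t\<^sub>0) * A t\<^sub>0 (A ?t f) x)" unfolding elim(1) elim(2) by (simp only: J_def)
    also have "\<dots> = exp (l * (t\<^sub>0 + ?t)) * A (t\<^sub>0 + ?t) f x"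
      unfolding elim(3) by (simp only: distrib_left exp_add mult_ac)
    finally show ?case unfolding tt .
  qed
qed

lemma conv_A:
  assumes \<epsilon>: "\<epsilon> > 0"
  shows "\<exists>N\<ge>1. \<forall>n\<ge>N. \<forall>f. sqint \<mu> f \<longrightarrow>
      l2n \<mu> (\<lambda>x. exp (l * (real n * t\<^sub>0)) * A (real n * t\<^sub>0) f x
        - (\<integral>x. f x * q x \<partial>\<mu>) / (\<integral>x. p x * q x \<partial>\<mu>) * p x) \<le> \<epsilon> * l2n \<mu> f"
proof -
  obtain C where "jentzsch \<mu> J p q C" using J_jentzsch by blast
  from jentzsch.uniform_convergence[OF this \<epsilon>] obtain N where N: "\<And>n f. n \<ge> N \<Longrightarrow> sqint \<mu> f \<Longrightarrow>
    l2n \<mu> (\<lambda>x. (J ^^ n) f x - (\<integral>x. f x * q x \<partial>\<mu>) / (\<integral>x. p x * q x \<partial>\<mu>) * p x) \<le> \<epsilon> * l2n \<mu> f" by blast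
  have "l2n \<mu> (\<lambda>x. exp (l * (real n * t\<^sub>0)) * A (real n * t\<^sub>0) f x
        - (\<integral>x. f x * q x \<partial>\<mu>) / (\<integral>x. p x * q x \<partial>\<mu>) * p x) \<le> \<epsilon> * l2n \<mu> f"
    if n: "n \<ge> Suc N" and f: "sqint \<mu> f" for n f
  proof -
    obtain m where m: "n = Suc m" using n by (cases n) auto
    have t: "real n * t\<^sub>0 > 0" using t0 m by (intro mult_pos_pos) simp_all
    let ?c = "(\<integral>x. f x * q x \<partial>\<mu>) / (\<integral>x. p x * q x \<partial>\<mu>)"
    have "l2n \<mu> (\<lambda>x. exp (l * (real n * t\<^sub>0)) * A (real n * t\<^sub>0) f x - ?c * p x)
        = l2n \<mu> (\<lambda>x. (J ^^ n) f x - ?c * p x)"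
    proof (rule l2n_cong(2))
      show "(\<lambda>x. exp (l * (real n * t\<^sub>0)) * A (real n * t\<^sub>0) f x - ?c * p x) \<in> borel_measurable \<mu>"
        by (rule sqint_meas[OF sqint_diff[OF sqint_scale[OF K.kop_sqint[OF t f]] sqint_scale[OF p_facts(6)]]])
      show "sqint \<mu> (\<lambda>x. (J ^^ n) f x - ?c * p x)"
        by (intro sqint_diff sqint_scale p_facts(6) pos_op_sqint[OF pos_op_funpow[OF J_pos] f])
      show "AE x in \<mu>. exp (l * (real n * t\<^sub>0)) * A (real n * t\<^sub>0) f x - ?c * p x = (J ^^ n) f x - ?c * p x"
        using J_power[OF f, of m] unfolding m by eventually_elim simp
    qed
    also have "\<dots> \<le> \<epsilon> * l2n \<mu> f" by (rule N[OF _ f]) (use n in simp)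
    finally show ?thesis .
  qed
  then show ?thesis by (intro exI[of _ "Suc N"]) simp
qed

text \<open>
  Operator norms are preserved by taking adjoints: with \<open>h\<close> the error for \<open>g\<close> and \<open>k\<close> the error of the original
  semigroup for \<open>h\<close>, one has \<open>\<parallel>h\<parallel>\<^sup>2 = \<integral> k g \<le> \<epsilon> \<parallel>h\<parallel> \<parallel>g\<parallel>\<close>.
\<close>

lemma conv_A':
  assumes \<epsilon>: "\<epsilon> > 0"
  shows "\<exists>N. \<forall>n\<ge>N. \<forall>g. sqint \<mu> g \<longrightarrow>
      l2n \<mu> (\<lambda>x. exp (l * (real n * t\<^sub>0)) * A' (real n * t\<^sub>0) g x
        - (\<integral>x. g x * p x \<partial>\<mu>) / (\<integral>x. q x * p x \<partial>\<mu>) * q x) \<le> \<epsilon> * l2n \<mu> g"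
proof -
  let ?\<gamma> = "\<integral>x. p x * q x \<partial>\<mu>"
  obtain N where N1: "N \<ge> 1" and N: "\<And>n f. n \<ge> N \<Longrightarrow> sqint \<mu> f \<Longrightarrow>
      l2n \<mu> (\<lambda>x. exp (l * (real n * t\<^sub>0)) * A (real n * t\<^sub>0) f x
        - (\<integral>x. f x * q x \<partial>\<mu>) / ?\<gamma> * p x) \<le> \<epsilon> * l2n \<mu> f"
    using conv_A[OF \<epsilon>] by blast
  have \<gamma>: "(\<integral>x. q x * p x \<partial>\<mu>) = ?\<gamma>" by (simp add: mult.commute)
  have "l2n \<mu> (\<lambda>x. exp (l * (real n * t\<^sub>0)) * A' (real n * t\<^sub>0) g x
        - (\<integral>x. g x * p x \<partial>\<mu>) / ?\<gamma> * q x) \<le> \<epsilon> * l2n \<mu> g"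
    if n: "n \<ge> N" and g: "sqint \<mu> g" for n g
  proof -
    let ?t = "real n * t\<^sub>0" and ?e = "exp (l * (real n * t\<^sub>0))" and ?c = "(\<integral>x. g x * p x \<partial>\<mu>) / ?\<gamma>"
    have t: "?t > 0" using t0 n N1 by (intro mult_pos_pos) simp_all
    define h where "h = (\<lambda>x. ?e * A' ?t g x - ?c * q x)"
    have A'g: "sqint \<mu> (A' ?t g)" by (rule K'.kop_sqint[OF t g])
    have h: "sqint \<mu> h"
      unfolding h_def by (intro sqint_diff sqint_scale q_facts(6) A'g)
    have Ah: "sqint \<mu> (A ?t h)" by (rule K.kop_sqint[OF t h])
    let ?d = "(\<integral>x. h x * q x \<partial>\<mu>) / ?\<gamma>"
    define k where "k = (\<lambda>x. ?e * A ?t h x - ?d * p x)"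
    have k: "sqint \<mu> k" unfolding k_def by (intro sqint_diff sqint_scale p_facts(6) Ah)
    have "(l2n \<mu> h)\<^sup>2 = (\<integral>x. ?e * (h x * A' ?t g x) - ?c * (h x * q x) \<partial>\<mu>)"
      unfolding l2n_sq by (intro Bochner_Integration.integral_cong refl)
        (simp add: h_def power2_eq_square algebra_simps)
    also have "\<dots> = ?e * (\<integral>x. h x * A' ?t g x \<partial>\<mu>) - ?c * (\<integral>x. h x * q x \<partial>\<mu>)"
      using sqint_mult[OF h A'g] sqint_mult[OF h q_facts(6)] by simp
    also have "(\<integral>x. h x * A' ?t g x \<partial>\<mu>) = (\<integral>x. A ?t h x * g x \<partial>\<mu>)"
      by (rule adjoint_real[OF t h g, symmetric])
    also have "?e * (\<integral>x. A ?t h x * g x \<partial>\<mu>) - ?c * (\<integral>x. h x * q x \<partial>\<mu>)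
        = ?e * (\<integral>x. A ?t h x * g x \<partial>\<mu>) - ?d * (\<integral>x. p x * g x \<partial>\<mu>)"
      by (simp add: mult.commute)
    also have "\<dots> = (\<integral>x. ?e * (A ?t h x * g x) - ?d * (p x * g x) \<partial>\<mu>)"
      using sqint_mult[OF Ah g] sqint_mult[OF p_facts(6) g] by simp
    also have "\<dots> = (\<integral>x. k x * g x \<partial>\<mu>)"
      by (intro Bochner_Integration.integral_cong refl) (simp add: k_def algebra_simps)
    also have "\<dots> \<le> l2n \<mu> k * l2n \<mu> g"
      using l2n_Cauchy_Schwarz[OF k g] by linarith
    also have "\<dots> \<le> (\<epsilon> * l2n \<mu> h) * l2n \<mu> g"
      unfolding k_def by (intro mult_right_mono N[OF n h]) simp
    finally have le: "l2n \<mu> h * l2n \<mu> h \<le> l2n \<mu> h * (\<epsilon> * l2n \<mu> g)"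
      by (simp add: power2_eq_square mult_ac)
    have "l2n \<mu> h \<le> \<epsilon> * l2n \<mu> g"
    proof (cases "l2n \<mu> h = 0")
      case True then show ?thesis using \<epsilon> by simp
    next
      case False
      then have "0 < l2n \<mu> h" using l2n_nonneg[of \<mu> h] by linarith
      with le show ?thesis by (rule mult_left_le_imp_le)
    qed
    then show ?thesis by (simp add: h_def)
  qed
  then show ?thesis unfolding \<gamma> by blast
qed

sublocale G: ground_state_semigroup \<mu> u l t\<^sub>0 p q
proof -
  interpret S: kernel_semigroup \<mu> u
    by unfold_locales (use u_meas K.k_int pos_A semigroup_A feller in simp_all)
  show "ground_state_semigroup \<mu> u l t\<^sub>0 p q"
  proof unfold_locales
    show "\<exists>K. compact K \<and> (\<forall>x\<in>- K. S.T t\<^sub>0 (\<lambda>_. 1) x \<le> \<epsilon>)" if "\<epsilon> > 0" for \<epsilon>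
      using decay[OF that] by (auto simp: S.T_def less_eq_complex_def)
    show "\<exists>N. \<forall>n\<ge>N. \<forall>f. sqint \<mu> f \<longrightarrow>
      l2n \<mu> (\<lambda>x. exp (l * (real n * t\<^sub>0)) * A (real n * t\<^sub>0) f x
        - (\<integral>x. f x * q x \<partial>\<mu>) / (\<integral>x. p x * q x \<partial>\<mu>) * p x) \<le> \<epsilon> * l2n \<mu> f" if "\<epsilon> > 0" for \<epsilon>
      using conv_A[OF that] by blast
  qed (use p_facts q_facts eig_A inv_A t0 ultra_A pq_pos in simp_all)
qed

sublocale G': ground_state_semigroup \<mu> "transpose_kernel u" l t\<^sub>0 q p
proof -
  interpret S: kernel_semigroup \<mu> "transpose_kernel u"
    by unfold_locales (use u_meas_transposed K'.k_int pos_A' semigroup_A' feller_adj in simp_all)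
  show "ground_state_semigroup \<mu> (transpose_kernel u) l t\<^sub>0 q p"
  proof unfold_locales
    show "\<exists>K. compact K \<and> (\<forall>x\<in>- K. S.T t\<^sub>0 (\<lambda>_. 1) x \<le> \<epsilon>)" if "\<epsilon> > 0" for \<epsilon>
      using decay[OF that] by (auto simp: S.T_def less_eq_complex_def)
    show "0 < (\<integral>x. q x * p x \<partial>\<mu>)" using pq_pos by (simp add: mult.commute)
    show "\<exists>N. \<forall>n\<ge>N. \<forall>f. sqint \<mu> f \<longrightarrow>
      l2n \<mu> (\<lambda>x. exp (l * (real n * t\<^sub>0)) * A' (real n * t\<^sub>0) f x
        - (\<integral>x. f x * p x \<partial>\<mu>) / (\<integral>x. q x * p x \<partial>\<mu>) * q x) \<le> \<epsilon> * l2n \<mu> f" if "\<epsilon> > 0" for \<epsilon>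
      by (rule conv_A'[OF that])
  qed (use p_facts q_facts eig_A' inv_A' t0 ultra_A' in simp_all)
qed

end

text \<open>
  The two semigroups may be dominated along different exhausting families; both estimates hold at time \<open>t\<close> on
  the intersection of the members at time \<open>t / 2\<close>. Small times, for which these are not yet defined, get the empty set.
\<close>

lemma exhausting_inter_half:
  assumes e1: "exhausting_family s\<^sub>1 (K\<^sub>1 :: real \<Rightarrow> 'a::t2_space set)" and e2: "exhausting_family s\<^sub>2 K\<^sub>2"
    and R: "2 * s\<^sub>1 \<le> R" "2 * s\<^sub>2 \<le> R"
  shows "exhausting_family s (\<lambda>t. if t < R then {} else K\<^sub>1 (t / 2) \<inter> K\<^sub>2 (t / 2))"
proof -
  let ?K = "\<lambda>t. if t < R then {} else K\<^sub>1 (t / 2) \<inter> K\<^sub>2 (t / 2)"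
  have cpt: "compact (K\<^sub>1 (t / 2) \<inter> K\<^sub>2 (t / 2))" if "t \<ge> R" for t
    using e1 e2 R that unfolding exhausting_family_def by (intro compact_Int) simp_all
  have sub: "\<exists>t\<ge>s. L \<subseteq> ?K t" if L: "compact L" for L
  proof -
    obtain a where a: "a \<ge> s\<^sub>1" "L \<subseteq> K\<^sub>1 a" using exhausting_compact[OF e1 L] by blast
    obtain b where b: "b \<ge> s\<^sub>2" "L \<subseteq> K\<^sub>2 b" using exhausting_compact[OF e2 L] by blast
    define t where "t = max (max s R) (max (2 * a) (2 * b))"
    have t: "t \<ge> s" "t \<ge> R" "a \<le> t / 2" "b \<le> t / 2" by (auto simp: t_def)
    have "L \<subseteq> K\<^sub>1 (t / 2)" using a(2) exhausting_mono[OF e1 a(1) t(3)] by (rule order_trans)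
    moreover have "L \<subseteq> K\<^sub>2 (t / 2)" using b(2) exhausting_mono[OF e2 b(1) t(4)] by (rule order_trans)
    ultimately show ?thesis using t by (intro exI[of _ t]) simp
  qed
  show ?thesis
    unfolding exhausting_family_def
  proof (intro conjI allI impI)
    fix t show "compact (?K t)" using cpt by simp
  next
    fix t t' assume "s \<le> t \<and> t < t'"
    then show "?K t \<subseteq> ?K t'"
      using exhausting_mono[OF e1, of "t/2" "t'/2"] exhausting_mono[OF e2, of "t/2" "t'/2"] R by auto
  next
    show "(\<Union>t\<in>{s..}. ?K t) = UNIV"
    proof (rule UNIV_eq_I[symmetric])
      fix x
      obtain t where "t \<ge> s" "{x} \<subseteq> ?K t" using sub[OF compact_sing[of x]] by blast
      then show "x \<in> (\<Union>t\<in>{s..}. ?K t)" by (intro UN_I[of t]) simp_all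
    qed
  next
    fix L :: "'a set" assume "compact L"
    then show "\<exists>t\<ge>s. L \<subseteq> ?K t" by (rule sub)
  qed
qed

context dual_feller_semigroups begin

theorem equivalence:
  assumes lc: "locally_compact_space (euclidean :: 'a topology)"
    and N: "N = {x. \<phi> x = 0} \<union> {x. \<psi> x = 0}"
  shows "(pGSD \<mu> u l \<phi> \<and> pGSD \<mu> (transpose_kernel u) l \<psi>) \<longleftrightarrow>
    (\<exists>\<rho> \<rho>s K. prob_space \<rho> \<and> sets \<rho> = sets borel \<and> prob_space \<rho>s \<and> sets \<rho>s = sets borel \<and>
       topological_support \<rho> \<inter> (UNIV - N) \<noteq> {} \<and> topological_support \<rho>s \<inter> (UNIV - N) \<noteq> {} \<and>
       exhausting_family t\<^sub>0 K \<and>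
       progressive_uniform_convergence \<mu> u K N \<rho> \<and>
       progressive_uniform_convergence \<mu> (transpose_kernel u) K N \<rho>s)" (is "?L \<longleftrightarrow> ?R")
proof -
  have \<phi>_0: "\<phi> x = 0 \<longleftrightarrow> p x = 0" for x
    by (subst p_facts(1)) (rule of_real_eq_0_iff)
  have \<psi>_0: "\<psi> x = 0 \<longleftrightarrow> q x = 0" for x
    by (subst q_facts(1)) (rule of_real_eq_0_iff)
  have N': "N = {x. p x = 0} \<union> {x. q x = 0}" unfolding N \<phi>_0 \<psi>_0 ..
  have Np: "{x. p x = 0} \<subseteq> N" and Nq: "{x. q x = 0} \<subseteq> N"
    unfolding N' by blast+
  have N_null: "AE x in \<mu>. x \<notin> N"
    using p_facts(5) q_facts(5) unfolding N' by eventually_elim simp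
  obtain z where z: "z \<notin> N" using AE_witness[OF N_null] by blast
  have \<phi>_p: "pGSD \<mu> u l \<phi> = pGSD \<mu> u l (cplx p)"
    by (rule arg_cong[OF p_facts(1)])
  have \<psi>_q: "pGSD \<mu> (transpose_kernel u) l \<psi> = pGSD \<mu> (transpose_kernel u) l (cplx q)"
    by (rule arg_cong[OF q_facts(1)])
  show ?thesis
    unfolding \<phi>_p \<psi>_q
  proof
    assume "pGSD \<mu> u l (cplx p) \<and> pGSD \<mu> (transpose_kernel u) l (cplx q)"
    then obtain C\<^sub>1 s\<^sub>1 K\<^sub>1 C\<^sub>2 s\<^sub>2 K\<^sub>2 where
      1: "C\<^sub>1 > 0" "exhausting_family s\<^sub>1 K\<^sub>1"
        "\<forall>t\<ge>s\<^sub>1. \<forall>x\<in>K\<^sub>1 t. G.T t (\<lambda>_. 1) x \<le> C\<^sub>1 * exp (- l * t) * p x" and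
      2: "C\<^sub>2 > 0" "exhausting_family s\<^sub>2 K\<^sub>2"
        "\<forall>t\<ge>s\<^sub>2. \<forall>x\<in>K\<^sub>2 t. G'.T t (\<lambda>_. 1) x \<le> C\<^sub>2 * exp (- l * t) * q x"
      unfolding G.pGSD_real G'.pGSD_real by (elim exE conjE) (rule that)
    note d1 = 1(3)[rule_format] and d2 = 2(3)[rule_format]
    \<comment> \<open>From time \<open>R\<close> on, both dominations hold at time \<open>t / 2\<close>.\<close>
  define R where "R = max (2 * s\<^sub>1) (2 * s\<^sub>2)"
    define K where "K t = (if t < R then {} else K\<^sub>1 (t / 2) \<inter> K\<^sub>2 (t / 2))" for t
    have K: "exhausting_family t\<^sub>0 K"
      unfolding K_def[abs_def] by (rule exhausting_inter_half[OF 1(2) 2(2)]) (simp_all add: R_def)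
    have sub: "K t \<subseteq> K\<^sub>1 (t / 2)" "K t \<subseteq> K\<^sub>2 (t / 2)" for t by (auto simp: K_def)
    have q: "integrable \<mu> q" by (rule G.q_integrable[OF 1(2,1) d1])
    have p: "integrable \<mu> p" by (rule G'.q_integrable[OF 2(2,1) d2])
    show ?R
    proof (intro exI conjI)
      show "progressive_uniform_convergence \<mu> u K N G.quasi_ergodic"
        by (rule G.pGSD_imp_convergence[OF 1(2,1) d1 Np sub(1)])
      show "progressive_uniform_convergence \<mu> (transpose_kernel u) K N G'.quasi_ergodic"
        by (rule G'.pGSD_imp_convergence[OF 2(2,1) d2 Nq sub(2)])
    qed (use K z in \<open>auto simp: G.quasi_ergodic_prob[OF q] G'.quasi_ergodic_prob[OF p]\<close>)
  next
    assume ?R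
    then obtain \<rho> \<rho>s K where R: "prob_space \<rho>" "sets \<rho> = sets borel" "prob_space \<rho>s" "sets \<rho>s = sets borel"
       "topological_support \<rho> \<inter> (UNIV - N) \<noteq> {}" "topological_support \<rho>s \<inter> (UNIV - N) \<noteq> {}"
       "exhausting_family t\<^sub>0 K"
       "progressive_uniform_convergence \<mu> u K N \<rho>"
       "progressive_uniform_convergence \<mu> (transpose_kernel u) K N \<rho>s" by (elim exE conjE) (rule that)
    show "pGSD \<mu> u l (cplx p) \<and> pGSD \<mu> (transpose_kernel u) l (cplx q)"
    proof
      show "pGSD \<mu> u l (cplx p)"
        by (rule G.convergence_imp_pGSD[OF lc R(1,2,5,7,8) Np N_null])
      show "pGSD \<mu> (transpose_kernel u) l (cplx q)"
        by (rule G'.convergence_imp_pGSD[OF lc R(3,4,6,7,9) Nq N_null])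
    qed
  qed
qed

end

theorem theorem5p4:
  fixes \<mu> :: "'a::polish_space measure"
    and U Us :: "real \<Rightarrow> ('a \<Rightarrow> complex) \<Rightarrow> 'a \<Rightarrow> complex"
    and u :: "real \<Rightarrow> 'a \<Rightarrow> 'a \<Rightarrow> real"
    and t\<^sub>0 l\<^sub>0 :: real
    and \<phi>\<^sub>0 \<psi>\<^sub>0 :: "'a \<Rightarrow> complex"
    and N :: "'a set"
  assumes "locally_compact_space (euclidean :: 'a topology)"
    and "\<not> compact (UNIV :: 'a set)"
    and "sets \<mu> = sets borel"
    and "locally_finite_measure \<mu>"
    and "topological_support \<mu> = UNIV"
    and "C0_semigroup_L2 \<mu> U"
    and "\<And>t. t \<ge> 0 \<Longrightarrow> positivity_preserving \<mu> (U t)"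
    and "\<And>t. t \<ge> 0 \<Longrightarrow> adjoint_L2 \<mu> (U t) (Us t)"
    and "\<And>t. t > 0 \<Longrightarrow> (\<lambda>(x, y). u t x y) \<in> borel_measurable (\<mu> \<Otimes>\<^sub>M \<mu>)"
    and "given_by_kernel \<mu> U u"
    and "given_by_kernel \<mu> Us (transpose_kernel u)"
    and "t\<^sub>0 > 0"
    and "\<And>t. t > 0 \<Longrightarrow> compact_L2 \<mu> (U t)"
    and "positivity_improving \<mu> (U t\<^sub>0)"
    and "strong_feller \<mu> u"
    and "strong_feller \<mu> (transpose_kernel u)"
    and "bounded_L2_Linf \<mu> (U t\<^sub>0)"
    and "bounded_L2_Linf \<mu> (Us t\<^sub>0)"
    and "\<And>t \<epsilon>. t \<ge> t\<^sub>0 \<Longrightarrow> \<epsilon> > 0 \<Longrightarrow>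
           \<exists>K. compact K \<and> (\<forall>x\<in>- K. Linf_op \<mu> (u t) (\<lambda>_. 1) x \<le> of_real \<epsilon> \<and>
                                   Linf_op \<mu> (transpose_kernel u t) (\<lambda>_. 1) x \<le> of_real \<epsilon>)"
    and "l\<^sub>0 = spectral_bottom \<mu> U"
    and "ground_state \<mu> U l\<^sub>0 \<phi>\<^sub>0"
    and "ground_state \<mu> Us l\<^sub>0 \<psi>\<^sub>0"
    and "N = {x. \<phi>\<^sub>0 x = 0} \<union> {x. \<psi>\<^sub>0 x = 0}"
  shows "(pGSD \<mu> u l\<^sub>0 \<phi>\<^sub>0 \<and> pGSD \<mu> (transpose_kernel u) l\<^sub>0 \<psi>\<^sub>0) \<longleftrightarrow>
    (\<exists>\<rho> \<rho>s K. prob_space \<rho> \<and> sets \<rho> = sets borel \<and> prob_space \<rho>s \<and> sets \<rho>s = sets borel \<and>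
       topological_support \<rho> \<inter> (UNIV - N) \<noteq> {} \<and> topological_support \<rho>s \<inter> (UNIV - N) \<noteq> {} \<and>
       exhausting_family t\<^sub>0 K \<and>
       progressive_uniform_convergence \<mu> u K N \<rho> \<and>
       progressive_uniform_convergence \<mu> (transpose_kernel u) K N \<rho>s)"
proof -
  interpret dual_feller_semigroups \<mu> U Us u t\<^sub>0 l\<^sub>0 \<phi>\<^sub>0 \<psi>\<^sub>0
    by unfold_locales
      (fact assms(3-8) assms(9-12) assms(13)[OF assms(12)] assms(14-18) assms(19)[OF order_refl] assms(21,22))+
  show ?thesis by (rule equivalence[OF assms(1,23)])
qed

end
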